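(* Let $K$ be a $\Sigma\Delta\partial$-field of characteristic zero. Then for every $\Sigma\Delta$-linear system over $K$ there exists a $\partial$-Picard-Vessiot ring $R$ for this system such that the ring of $\Sigma\Delta$-constants $R^{\Sigma\Delta}$ is a finite algebraic field extension of $K^{\Sigma\Delta}$.
   Context: All rings are commutative and all fields have characteristic zero. $\Sigma=\{\sigma_i\}$ and $\Delta=\{\delta_i\}$ are arbitrary sets of symbols, possibly infinite; one of them may be empty, but not both. A $\Sigma\Delta\partial$-ring is a ring $R$ together with a ring automorphism $\sigma:R\to R$ for every $\sigma\in\Sigma$, a derivation $\delta:R\to R$ for every $\delta\in\Delta$ and a derivation $\partial:R\to R$, such that all these operators commute pairwise. A $\Sigma\Delta\partial$-field is a $\Sigma\Delta\partial$-ring whose underlying ring is a field. Morphisms of $\Sigma\Delta\partial$-rings are ring morphisms commuting with all operators. A $K$-$\Sigma\Delta\partial$-algebra is a $\Sigma\Delta\partial$-ring $R$ with a morphism of $\Sigma\Delta\partial$-rings $K\to R$. A $\Sigma\Delta$-ideal is an ideal mapped into itself by every $\sigma\in\Sigma$ and every $\delta\in\Delta$. $R$ is $\Sigma\Delta$-simple if $R\neq 0$ and the only $\Sigma\Delta$-ideals of $R$ are $0$ and $R$. The $\Sigma\Delta$-constants of $R$ are $R^{\Sigma\Delta}=\{r\in R \mid \sigma(r)=r\ \forall \sigma\in\Sigma,\ \delta(r)=0\ \forall\delta\in\Delta\}$. A $\Sigma\Delta$-linear system over $K$ is a system of equations $$\sigma_i(Y)=A_iY,\quad A_i\in \mathrm{GL}_n(K),\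 \sigma_i\in\Sigma;\qquad \delta_i(Y)=B_iY,\quad B_i\in K^{n\times n},\ \delta_i\in\Delta,$$ satisfying the integrability conditions $$\sigma_i(A_j)A_i=\sigma_j(A_i)A_j,\qquad \sigma_i(B_j)A_i=\delta_j(A_i)+A_iB_j,\qquad \delta_i(B_j)+B_jB_i=\delta_j(B_i)+B_iB_j$$ for all $\sigma_i,\sigma_j\in\Sigma$ and all $\delta_i,\delta_j\in\Delta$ (whenever the symbols involved make sense). A $\partial$-Picard-Vessiot ring (also called $\partial$-parameterized Picard-Vessiot ring) for this system is a $K$-$\Sigma\Delta\partial$-algebra $R$ such that: (i) there exists $Z\in\mathrm{GL}_n(R)$ with $\sigma_i(Z)=A_iZ$ for all $\sigma_i\in\Sigma$ and $\delta_i(Z)=B_iZ$ for all $\delta_i\in\Delta$, and, as a $K$-$\partial$-algebra, $R$ is generated by the entries of $Z$ and $\frac{1}{\det(Z)}$ (i.e. $R$ is generated as a $K$-algebra by these elements and all their iterated $\partial$-derivatives); (ii) $R$ is $\Sigma\Delta$-simple. *)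

theory Defs
  imports
    "HOL-Algebra.Algebra"
    "HOL-Combinatorics.Permutations"
    "Jordan_Normal_Form.Matrix"
begin

section \<open>Rings with commuting automorphisms and derivations\<close>

text \<open>
  The operators are indexed by symbols: \<open>aut R s\<close> is the automorphism denoted by the symbol
  \<open>s \<in> \<Sigma>\<close>, \<open>der R d\<close> the derivation denoted by \<open>d \<in> \<Delta>\<close>, and \<open>par R\<close> the parametric
  derivation. Values of \<open>aut R\<close> and \<open>der R\<close> at symbols outside \<open>\<Sigma>\<close> and \<open>\<Delta>\<close> are irrelevant; using
  sets of symbols (rather than types) allows one of the two to be empty.
\<close>

record ('a, 's, 'd) op_ring = "'a ring" +
  aut :: "'s \<Rightarrow> 'a \<Rightarrow> 'a"
  der :: "'d \<Rightarrow> 'a \<Rightarrow> 'a"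
  par :: "'a \<Rightarrow> 'a"

definition derivation :: "('a, 'm) ring_scheme \<Rightarrow> ('a \<Rightarrow> 'a) \<Rightarrow> bool" where
  "derivation R f \<longleftrightarrow> f \<in> carrier R \<rightarrow> carrier R \<and>
    (\<forall>x\<in>carrier R. \<forall>y\<in>carrier R.
      f (x \<oplus>\<^bsub>R\<^esub> y) = f x \<oplus>\<^bsub>R\<^esub> f y \<and>
      f (x \<otimes>\<^bsub>R\<^esub> y) = f x \<otimes>\<^bsub>R\<^esub> y \<oplus>\<^bsub>R\<^esub> x \<otimes>\<^bsub>R\<^esub> f y)"

definition operators :: "'s set \<Rightarrow> 'd set \<Rightarrow> ('a, 's, 'd) op_ring \<Rightarrow> ('a \<Rightarrow> 'a) set" where
  "operators \<Sigma> \<Delta> R = aut R ` \<Sigma> \<union> der R ` \<Delta> \<union> {par R}"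

locale sdp_ring = cring R
  for \<Sigma> :: "'s set" and \<Delta> :: "'d set" and R :: "('a, 's, 'd) op_ring" (structure) +
  assumes aut_iso: "s \<in> \<Sigma> \<Longrightarrow> aut R s \<in> ring_iso R R"
    and der_derivation: "d \<in> \<Delta> \<Longrightarrow> derivation R (der R d)"
    and par_derivation: "derivation R (par R)"
    and operators_commute:
      "\<lbrakk>f \<in> operators \<Sigma> \<Delta> R; g \<in> operators \<Sigma> \<Delta> R; x \<in> carrier R\<rbrakk> \<Longrightarrow> f (g x) = g (f x)"

locale sdp_field = sdp_ring \<Sigma> \<Delta> R + field R
  for \<Sigma> :: "'s set" and \<Delta> :: "'d set" and R :: "('a, 's, 'd) op_ring" (structure)

definition sdp_hom ::
  "'s set \<Rightarrow> 'd set \<Rightarrow> ('a, 's, 'd) op_ring \<Rightarrow> ('b, 's, 'd) op_ring \<Rightarrow> ('a \<Rightarrow> 'b) set" where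
  "sdp_hom \<Sigma> \<Delta> R S = {h \<in> Ring.ring_hom R S. \<forall>x\<in>carrier R.
      (\<forall>s\<in>\<Sigma>. h (aut R s x) = aut S s (h x)) \<and>
      (\<forall>d\<in>\<Delta>. h (der R d x) = der S d (h x)) \<and>
      h (par R x) = par S (h x)}"

text \<open>\<open>sdp_algebra \<Sigma> \<Delta> K R h\<close>: \<open>R\<close> is a \<open>K\<close>-algebra via the structure morphism \<open>h\<close>.\<close>

definition sdp_algebra ::
  "'s set \<Rightarrow> 'd set \<Rightarrow> ('a, 's, 'd) op_ring \<Rightarrow> ('b, 's, 'd) op_ring \<Rightarrow> ('a \<Rightarrow> 'b) \<Rightarrow> bool" where
  "sdp_algebra \<Sigma> \<Delta> K R h \<longleftrightarrow> sdp_ring \<Sigma> \<Delta> R \<and> h \<in> sdp_hom \<Sigma> \<Delta> K R"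

definition sd_ideal :: "'s set \<Rightarrow> 'd set \<Rightarrow> 'a set \<Rightarrow> ('a, 's, 'd) op_ring \<Rightarrow> bool" where
  "sd_ideal \<Sigma> \<Delta> I R \<longleftrightarrow>
    ideal I R \<and> (\<forall>s\<in>\<Sigma>. aut R s ` I \<subseteq> I) \<and> (\<forall>d\<in>\<Delta>. der R d ` I \<subseteq> I)"

definition sd_simple :: "'s set \<Rightarrow> 'd set \<Rightarrow> ('a, 's, 'd) op_ring \<Rightarrow> bool" where
  "sd_simple \<Sigma> \<Delta> R \<longleftrightarrow> carrier R \<noteq> {\<zero>\<^bsub>R\<^esub>} \<and>
    (\<forall>I. sd_ideal \<Sigma> \<Delta> I R \<longrightarrow> I = {\<zero>\<^bsub>R\<^esub>} \<or> I = carrier R)"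

definition sd_constants :: "'s set \<Rightarrow> 'd set \<Rightarrow> ('a, 's, 'd) op_ring \<Rightarrow> 'a set" where
  "sd_constants \<Sigma> \<Delta> R =
    {r \<in> carrier R. (\<forall>s\<in>\<Sigma>. aut R s r = r) \<and> (\<forall>d\<in>\<Delta>. der R d r = \<zero>\<^bsub>R\<^esub>)}"

text \<open>
  The field given by a type of class \<open>field\<close>, equipped with operators. A base field of
  characteristic zero is a type of class \<open>field_char_0\<close>. An algebra generated by countably many
  elements over such a field \<open>K\<close> has at most as many elements as \<open>K\<close>, because \<open>K\<close> is infinite;
  asking for a Picard-Vessiot ring whose carrier is a set of elements of the type of \<open>K\<close> is
  therefore no restriction. The ring operations of such a ring are unrelated to those of the type.
\<close>

definition op_ring_of_type ::
  "('s \<Rightarrow> 'a \<Rightarrow> 'a) \<Rightarrow> ('d \<Rightarrow> 'a \<Rightarrow> 'a) \<Rightarrow> ('a \<Rightarrow> 'a) \<Rightarrow> ('a::field, 's, 'd) op_ring" where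
  "op_ring_of_type sg dl pa =
    \<lparr>carrier = UNIV, monoid.mult = (*), one = 1, ring.zero = 0, add = (+),
     aut = sg, der = dl, par = pa\<rparr>"

section \<open>Square matrices over a ring structure\<close>

text \<open>
  The type \<open>'a mat\<close> serves as a container; its own arithmetic comes from type classes and does not
  apply to the operations of a ring structure \<open>R\<close>.
\<close>

definition mats :: "('a, 'm) ring_scheme \<Rightarrow> nat \<Rightarrow> 'a mat set" where
  "mats R n = {A \<in> carrier_mat n n. elements_mat A \<subseteq> carrier R}"

definition madd :: "('a, 'm) ring_scheme \<Rightarrow> nat \<Rightarrow> 'a mat \<Rightarrow> 'a mat \<Rightarrow> 'a mat" where
  "madd R n A B = mat n n (\<lambda>(i, j). A $$ (i, j) \<oplus>\<^bsub>R\<^esub> B $$ (i, j))"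

definition mmul :: "('a, 'm) ring_scheme \<Rightarrow> nat \<Rightarrow> 'a mat \<Rightarrow> 'a mat \<Rightarrow> 'a mat" where
  "mmul R n A B =
    mat n n (\<lambda>(i, j). \<Oplus>\<^bsub>R\<^esub>k\<in>{..<n}. A $$ (i, k) \<otimes>\<^bsub>R\<^esub> B $$ (k, j))"

definition mone :: "('a, 'm) ring_scheme \<Rightarrow> nat \<Rightarrow> 'a mat" where
  "mone R n = mat n n (\<lambda>(i, j). if i = j then \<one>\<^bsub>R\<^esub> else \<zero>\<^bsub>R\<^esub>)"

definition GL :: "('a, 'm) ring_scheme \<Rightarrow> nat \<Rightarrow> 'a mat set" where
  "GL R n = {A \<in> mats R n. \<exists>B\<in>mats R n. mmul R n A B = mone R n \<and> mmul R n B A = mone R n}"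

text \<open>Leibniz formula; \<open>evenperm p\<close> decides the sign.\<close>

definition mdet :: "('a, 'm) ring_scheme \<Rightarrow> nat \<Rightarrow> 'a mat \<Rightarrow> 'a" where
  "mdet R n A = (\<Oplus>\<^bsub>R\<^esub>p\<in>{p. p permutes {..<n}}.
     let t = (\<Otimes>\<^bsub>R\<^esub>i\<in>{..<n}. A $$ (i, p i)) in if evenperm p then t else \<ominus>\<^bsub>R\<^esub> t)"

section \<open>Linear systems and Picard-Vessiot rings\<close>

definition sd_linear_system ::
  "'s set \<Rightarrow> 'd set \<Rightarrow> ('a, 's, 'd) op_ring \<Rightarrow> nat \<Rightarrow> ('s \<Rightarrow> 'a mat) \<Rightarrow> ('d \<Rightarrow> 'a mat) \<Rightarrow> bool" where
  "sd_linear_system \<Sigma> \<Delta> K n A B \<longleftrightarrow>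
    (\<forall>i\<in>\<Sigma>. A i \<in> GL K n) \<and>
    (\<forall>i\<in>\<Delta>. B i \<in> mats K n) \<and>
    (\<forall>i\<in>\<Sigma>. \<forall>j\<in>\<Sigma>.
      mmul K n (map_mat (aut K i) (A j)) (A i) = mmul K n (map_mat (aut K j) (A i)) (A j)) \<and>
    (\<forall>i\<in>\<Sigma>. \<forall>j\<in>\<Delta>.
      mmul K n (map_mat (aut K i) (B j)) (A i) =
      madd K n (map_mat (der K j) (A i)) (mmul K n (A i) (B j))) \<and>
    (\<forall>i\<in>\<Delta>. \<forall>j\<in>\<Delta>.
      madd K n (map_mat (der K i) (B j)) (mmul K n (B j) (B i)) =
      madd K n (map_mat (der K j) (B i)) (mmul K n (B i) (B j)))"

definition fundamental_matrix ::
  "'s set \<Rightarrow> 'd set \<Rightarrow> nat \<Rightarrow> ('s \<Rightarrow> 'a mat) \<Rightarrow> ('d \<Rightarrow> 'a mat) \<Rightarrow>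
    ('b, 's, 'd) op_ring \<Rightarrow> ('a \<Rightarrow> 'b) \<Rightarrow> 'b mat \<Rightarrow> bool" where
  "fundamental_matrix \<Sigma> \<Delta> n A B R h Z \<longleftrightarrow> Z \<in> GL R n \<and>
    (\<forall>i\<in>\<Sigma>. map_mat (aut R i) Z = mmul R n (map_mat h (A i)) Z) \<and>
    (\<forall>i\<in>\<Delta>. map_mat (der R i) Z = mmul R n (map_mat h (B i)) Z)"

text \<open>The \<open>K\<close>-subalgebra of \<open>R\<close> generated by all iterated \<open>par\<close>-derivatives of elements of \<open>S\<close>.\<close>

definition par_generated ::
  "('a, 's, 'd) op_ring \<Rightarrow> ('b, 's, 'd) op_ring \<Rightarrow> ('a \<Rightarrow> 'b) \<Rightarrow> 'b set \<Rightarrow> 'b set" where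
  "par_generated K R h S = generate_ring R (h ` carrier K \<union> {(par R ^^ k) x | k x. x \<in> S})"

definition par_picard_vessiot_ring ::
  "'s set \<Rightarrow> 'd set \<Rightarrow> ('a, 's, 'd) op_ring \<Rightarrow> nat \<Rightarrow> ('s \<Rightarrow> 'a mat) \<Rightarrow> ('d \<Rightarrow> 'a mat) \<Rightarrow>
    ('b, 's, 'd) op_ring \<Rightarrow> ('a \<Rightarrow> 'b) \<Rightarrow> bool" where
  "par_picard_vessiot_ring \<Sigma> \<Delta> K n A B R h \<longleftrightarrow>
    sdp_algebra \<Sigma> \<Delta> K R h \<and>
    (\<exists>Z. fundamental_matrix \<Sigma> \<Delta> n A B R h Z \<and>
         carrier R = par_generated K R h (elements_mat Z \<union> {inv\<^bsub>R\<^esub> (mdet R n Z)})) \<and>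
    sd_simple \<Sigma> \<Delta> R"

text \<open>\<open>finite_algebraic_extension F E\<close>: the ring structure \<open>E\<close> is a field, finite and algebraic over
  its subfield \<open>F\<close>.\<close>

definition finite_algebraic_extension :: "'a set \<Rightarrow> ('a, 'm) ring_scheme \<Rightarrow> bool" where
  "finite_algebraic_extension F E \<longleftrightarrow> field E \<and> subfield F E \<and>
    ring.finite_dimension E F (carrier E) \<and> (\<forall>x\<in>carrier E. ring.algebraic E F x)"

end

theory Submission
  imports Defs "HOL-Computational_Algebra.Computational_Algebra" "HOL-Library.Poly_Mapping"
    "HOL-Algebra.Algebraic_Closure_Type" "HOL-Algebra.Free_Abelian_Groups"
    "Jordan_Normal_Form.Determinant"
begin

text \<open>
  The Picard-Vessiot ring is a quotient of the universal ring of the system, a polynomial ring over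
  \<open>K\<close> filtered by the order of the \<open>\<partial>\<close>-derivatives of the entries. Its ideal, closed under
  \<open>\<partial>\<close>, is built along this filtration as a union of maximal \<open>\<Sigma>\<Delta>\<close>-ideals. A maximal \<open>\<Sigma>\<Delta>\<close>-ideal of order
  \<open>r\<close> is compatible with the next order because \<open>\<partial>\<close> preserves a minimal prime over the ideal of
  order \<open>r - 1\<close>, extends to a derivation on order \<open>r\<close> variable by variable, and the values of that
  extension at a point (Nullstellensatz) define a point of the prolonged ideal.

  For the constants, let \<open>Q\<close> be a minimal prime of the quotient. A constant \<open>c\<close> is algebraic modulo
  \<open>Q\<close>, since all \<open>c - k\<close> with \<open>k\<close> an integer are zero or units. Modulo \<open>Q\<close> every high derivative is either free
  or given linearly by lower ones, all with the same leading coefficient. Hence one element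
  outside \<open>Q\<close> annihilates \<open>Q\<close>, and the points of \<open>Q\<close> over a fixed finite extension of \<open>K\<close> bound the
  dimension modulo \<open>Q\<close> of the \<open>K\<close>-span of the constants. By \<open>\<Sigma>\<Delta>\<close>-simplicity the bound holds in the
  quotient itself, and constants that are linearly dependent over \<open>K\<close> are so over the constants of \<open>K\<close>.
\<close>

section \<open>Subrings, prime ideals and homomorphisms to a field\<close>

text \<open>A maximal \<open>\<Sigma>\<Delta>\<close>-ideal need not be closed under
  \<open>\<partial>\<close>, while an ideal maximal among the \<open>\<partial>\<close>-closed ones
  only gives simplicity for all operators together. Working order by order meets both demands: if
  \<open>M\<close> is maximal in one order and its prolongation to the next is proper, every maximal
  ideal above the prolongation contracts back to \<open>M\<close>. Nothing decided in a lower order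
  is ever revised, so properness of the prolongation is the one real point of the existence proof.
  For the constants the obstacle is that the quotient need not be finitely generated and the
  constants of \<open>K\<close> need not be algebraically closed. That a single constant is
  algebraic involves finitely many variables only, but a finite degree needs a bound independent of
  the order; hence the uniform annihilator and the fixed extension. Characteristic zero enters
  through radicals of differential ideals, separants and the supply of integers. Up to the final
  quotient all rings are subsets of one polynomial type and congruences are memberships in ideals;
  denominators are cleared instead of forming fraction fields.\<close>

definition sring :: "'r::comm_ring_1 set \<Rightarrow> bool" where
  "sring A \<longleftrightarrow> 1 \<in> A \<and> (\<forall>x\<in>A. \<forall>y\<in>A. x + y \<in> A \<and> x * y \<in> A \<and> - x \<in> A)"

lemma sringD:
  assumes "sring A"
  shows "1 \<in> A" "0 \<in> A" "x \<in> A \<Longrightarrow> y \<in> A \<Longrightarrow> x + y \<in> A"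
    "x \<in> A \<Longrightarrow> y \<in> A \<Longrightarrow> x * y \<in> A" "x \<in> A \<Longrightarrow> - x \<in> A"
    "x \<in> A \<Longrightarrow> y \<in> A \<Longrightarrow> x - y \<in> A"
proof -
  have a: "1 \<in> A" and b: "\<And>x y. x \<in> A \<Longrightarrow> y \<in> A \<Longrightarrow> x + y \<in> A"
    and c: "\<And>x. x \<in> A \<Longrightarrow> - x \<in> A" and d: "\<And>x y. x \<in> A \<Longrightarrow> y \<in> A \<Longrightarrow> x * y \<in> A"
    using assms by (auto simp: sring_def)
  show "1 \<in> A" "0 \<in> A" "x \<in> A \<Longrightarrow> y \<in> A \<Longrightarrow> x + y \<in> A"
    "x \<in> A \<Longrightarrow> y \<in> A \<Longrightarrow> x * y \<in> A" "x \<in> A \<Longrightarrow> - x \<in> A"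
    "x \<in> A \<Longrightarrow> y \<in> A \<Longrightarrow> x - y \<in> A"
    using a b[OF a c[OF a]] b c d b[of x "- y"] by simp_all
qed

lemma sring_UNIV: "sring UNIV"
  by (simp add: sring_def)

lemma sring_sum: "sring A \<Longrightarrow> (\<And>i. i \<in> I \<Longrightarrow> f i \<in> A) \<Longrightarrow> sum f I \<in> A"
  by (induction I rule: infinite_finite_induct) (auto intro: sringD)

lemma sring_prod: "sring A \<Longrightarrow> (\<And>i. i \<in> I \<Longrightarrow> f i \<in> A) \<Longrightarrow> prod f I \<in> A"
  by (induction I rule: infinite_finite_induct) (auto intro: sringD)

lemma sring_power: "sring A \<Longrightarrow> x \<in> A \<Longrightarrow> x ^ n \<in> A"
  by (induction n) (auto intro: sringD)

lemma sring_of_nat: "sring A \<Longrightarrow> of_nat n \<in> A"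
  by (induction n) (auto intro: sringD)

definition ideal_on :: "'r::comm_ring_1 set \<Rightarrow> 'r set \<Rightarrow> bool" where
  "ideal_on A I \<longleftrightarrow> I \<subseteq> A \<and> 0 \<in> I \<and> (\<forall>x\<in>I. \<forall>y\<in>I. x + y \<in> I) \<and> (\<forall>a\<in>A. \<forall>x\<in>I. a * x \<in> I)"

lemma ideal_onD:
  assumes "ideal_on A I"
  shows "I \<subseteq> A" "x \<in> I \<Longrightarrow> x \<in> A" "0 \<in> I" "x \<in> I \<Longrightarrow> y \<in> I \<Longrightarrow> x + y \<in> I"
    "a \<in> A \<Longrightarrow> x \<in> I \<Longrightarrow> a * x \<in> I" "a \<in> A \<Longrightarrow> x \<in> I \<Longrightarrow> x * a \<in> I"
  using assms by (auto simp: ideal_on_def mult.commute)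

lemma ideal_on_uminus: "ideal_on A I \<Longrightarrow> sring A \<Longrightarrow> x \<in> I \<Longrightarrow> - x \<in> I"
  using ideal_onD(5)[of A I "-1" x] sringD(1,5)[of A] by auto

lemma ideal_on_diff: "ideal_on A I \<Longrightarrow> sring A \<Longrightarrow> x \<in> I \<Longrightarrow> y \<in> I \<Longrightarrow> x - y \<in> I"
  using ideal_onD(4)[of A I x "-y"] ideal_on_uminus[of A I y] by auto

lemma ideal_on_sum: "ideal_on A I \<Longrightarrow> (\<And>i. i \<in> S \<Longrightarrow> f i \<in> I) \<Longrightarrow> sum f S \<in> I"
  by (induction S rule: infinite_finite_induct) (auto intro: ideal_onD)

lemma ideal_on_cancel: "ideal_on A I \<Longrightarrow> sring A \<Longrightarrow> x + y \<in> I \<Longrightarrow> y \<in> I \<Longrightarrow> x \<in> I"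
  using ideal_on_diff[of A I "x + y" y] by auto

text \<open>Also used with an ideal in place of a ring: \<open>p \<in> polys_over Q\<close> says
  that \<open>p\<close> is zero modulo \<open>Q\<close>. A nontrivial relation of \<open>u\<close>
  is thus a \<open>p \<notin> polys_over Q\<close> with \<open>poly p u \<in> Q\<close>.\<close>

definition polys_over :: "'r::comm_ring_1 set \<Rightarrow> 'r poly set" where
  "polys_over A = {p. \<forall>i. coeff p i \<in> A}"

lemma polys_over_coeff: "p \<in> polys_over A \<Longrightarrow> coeff p i \<in> A"
  by (simp add: polys_over_def)

lemma polys_over_mono: "A \<subseteq> B \<Longrightarrow> p \<in> polys_over A \<Longrightarrow> p \<in> polys_over B"
  by (auto simp: polys_over_def)

lemma polys_over_closed:
  assumes "sring A"
  shows "0 \<in> polys_over A" "1 \<in> polys_over A"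
    "p \<in> polys_over A \<Longrightarrow> q \<in> polys_over A \<Longrightarrow> p + q \<in> polys_over A"
    "p \<in> polys_over A \<Longrightarrow> q \<in> polys_over A \<Longrightarrow> p - q \<in> polys_over A"
    "p \<in> polys_over A \<Longrightarrow> - p \<in> polys_over A"
    "p \<in> polys_over A \<Longrightarrow> q \<in> polys_over A \<Longrightarrow> p * q \<in> polys_over A"
    "a \<in> A \<Longrightarrow> p \<in> polys_over A \<Longrightarrow> smult a p \<in> polys_over A"
    "a \<in> A \<Longrightarrow> p \<in> polys_over A \<Longrightarrow> pCons a p \<in> polys_over A"
    "a \<in> A \<Longrightarrow> monom a n \<in> polys_over A"
proof -
  note c = sringD[OF assms] sring_sum[OF assms] sring_of_nat[OF assms]
  show "1 \<in> polys_over A" using c by (auto simp: polys_over_def coeff_1)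
  show "a \<in> A \<Longrightarrow> p \<in> polys_over A \<Longrightarrow> pCons a p \<in> polys_over A"
    by (auto simp: polys_over_def coeff_pCons split: nat.splits)
  show "p \<in> polys_over A \<Longrightarrow> q \<in> polys_over A \<Longrightarrow> p * q \<in> polys_over A"
    by (auto simp: polys_over_def coeff_mult intro!: sring_sum[OF assms] c(4))
qed (use sringD[OF assms] in \<open>auto simp: polys_over_def coeff_monom\<close>)

lemma polys_over_pderiv:
  fixes A :: "'r::idom set"
  shows "sring A \<Longrightarrow> p \<in> polys_over A \<Longrightarrow> pderiv p \<in> polys_over A"
  by (auto simp: polys_over_def coeff_pderiv intro!: sringD(4) sring_of_nat simp del: of_nat_Suc)

lemma poly_in_sring: "sring A \<Longrightarrow> p \<in> polys_over A \<Longrightarrow> u \<in> A \<Longrightarrow> poly p u \<in> A"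
  unfolding poly_altdef by (intro sring_sum) (auto intro: sringD sring_power simp: polys_over_def)

lemma poly_in_ideal: "ideal_on A I \<Longrightarrow> sring A \<Longrightarrow> p \<in> polys_over I \<Longrightarrow> u \<in> A \<Longrightarrow> poly p u \<in> I"
  unfolding poly_altdef by (intro ideal_on_sum[of A]) (auto intro: ideal_onD sring_power simp: polys_over_def)

definition adjoin :: "'r::comm_ring_1 set \<Rightarrow> 'r \<Rightarrow> 'r set" where
  "adjoin A u = (\<lambda>p. poly p u) ` polys_over A"

lemma adjoinI: "p \<in> polys_over A \<Longrightarrow> poly p u \<in> adjoin A u"
  by (auto simp: adjoin_def)

lemma adjoin_sring: "sring A \<Longrightarrow> sring (adjoin A u)"
  unfolding sring_def[of "adjoin A u"]
proof (intro conjI ballI)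
  assume A: "sring A"
  show "1 \<in> adjoin A u" using adjoinI[OF polys_over_closed(2)[OF A], of u] by simp
  fix x y assume "x \<in> adjoin A u" "y \<in> adjoin A u"
  then obtain p q where "p \<in> polys_over A" "q \<in> polys_over A" "x = poly p u" "y = poly q u"
    by (auto simp: adjoin_def)
  then show "x + y \<in> adjoin A u" "x * y \<in> adjoin A u" "- x \<in> adjoin A u"
    using adjoinI[OF polys_over_closed(3)[OF A], of p q u] adjoinI[OF polys_over_closed(6)[OF A], of p q u]
      adjoinI[OF polys_over_closed(5)[OF A], of p u] by auto
qed

lemma adjoin_subset: "sring A \<Longrightarrow> A \<subseteq> adjoin A u"
proof
  fix x assume "sring A" "x \<in> A"
  then have "poly (pCons x 0) u \<in> adjoin A u" by (intro adjoinI polys_over_closed) auto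
  then show "x \<in> adjoin A u" by simp
qed

lemma adjoin_gen: "sring A \<Longrightarrow> u \<in> adjoin A u"
proof -
  assume "sring A"
  then have "poly [:0, 1:] u \<in> adjoin A u" by (intro adjoinI polys_over_closed sringD) auto
  then show ?thesis by simp
qed

lemma adjoin_mono: "A \<subseteq> A' \<Longrightarrow> adjoin A u \<subseteq> adjoin A' u"
  unfolding adjoin_def using polys_over_mono by blast

lemma adjoin_least: "sring B \<Longrightarrow> A \<subseteq> B \<Longrightarrow> u \<in> B \<Longrightarrow> adjoin A u \<subseteq> B"
  unfolding adjoin_def using poly_in_sring polys_over_mono by blast

section \<open>Prime ideals, minimal relations and pseudo-division\<close>

definition prime_on :: "'r::comm_ring_1 set \<Rightarrow> 'r set \<Rightarrow> bool" where
  "prime_on B Q \<longleftrightarrow> sring B \<and> ideal_on B Q \<and> 1 \<notin> Q \<and> (\<forall>x\<in>B. \<forall>y\<in>B. x * y \<in> Q \<longrightarrow> x \<in> Q \<or> y \<in> Q)"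

lemma prime_onD:
  assumes "prime_on B Q"
  shows "sring B" "ideal_on B Q" "1 \<notin> Q" "x * y \<in> Q \<Longrightarrow> x \<in> B \<Longrightarrow> y \<in> B \<Longrightarrow> x \<in> Q \<or> y \<in> Q"
  using assms by (auto simp: prime_on_def)

lemma prime_on_power:
  assumes "prime_on B Q" "x \<in> B" "x ^ n \<in> Q"
  shows "x \<in> Q"
  using assms(3)
proof (induction n)
  case 0 then show ?case using prime_onD(3)[OF assms(1)] by simp
next
  case (Suc n) then show ?case using prime_onD(4)[OF assms(1), of x "x ^ n"] assms(2)
    sring_power[OF prime_onD(1)[OF assms(1)] assms(2)] by auto
qed

lemma prime_on_cancel:
  "prime_on B Q \<Longrightarrow> x \<in> B \<Longrightarrow> x \<notin> Q \<Longrightarrow> y \<in> B \<Longrightarrow> x ^ n * y \<in> Q \<Longrightarrow> y \<in> Q"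
  using prime_onD(4)[of B Q "x ^ n" y] prime_on_power[of B Q x n] sring_power[of B x n] prime_onD(1)[of B Q]
  by blast

text \<open>The minimal polynomial of \<open>u\<close> over the fraction field of \<open>A\<close>
  modulo \<open>Q\<close>, with denominators cleared: the leading coefficient is only known to be
  outside \<open>Q\<close>, and relations of smaller degree are trivial modulo
  \<open>Q\<close>.\<close>

definition min_rel :: "'r::comm_ring_1 set \<Rightarrow> 'r set \<Rightarrow> 'r \<Rightarrow> 'r poly \<Rightarrow> bool" where
  "min_rel A Q u h \<longleftrightarrow> h \<in> polys_over A \<and> lead_coeff h \<notin> Q \<and> poly h u \<in> Q \<and>
     (\<forall>r\<in>polys_over A. Polynomial.degree r < Polynomial.degree h \<longrightarrow> poly r u \<in> Q \<longrightarrow> r \<in> polys_over Q)"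

lemma min_rel_degree: "min_rel A Q u h \<Longrightarrow> 0 < Polynomial.degree h"
proof (rule ccontr)
  assume h: "min_rel A Q u h" and "\<not> 0 < Polynomial.degree h"
  then obtain c where "h = [:c:]" by (metis degree_eq_zeroE gr_zeroI)
  with h show False by (auto simp: min_rel_def)
qed

lemma degree_less_of_coeff:
  assumes "Polynomial.degree p \<le> n" "coeff p n = 0" "0 < n"
  shows "Polynomial.degree p < n"
  using assms by (metis le_neq_implies_less leading_coeff_0_iff degree_0)

text \<open>Among the nontrivial relations one of least degree works. If its leading coefficient
  were in \<open>Q\<close>, dropping the leading term would leave a relation of smaller degree that
  is still nontrivial.\<close>

lemma exists_min_rel:
  assumes Q: "prime_on B Q" and A: "sring A" "A \<subseteq> B" and u: "u \<in> B"
    and p: "p \<in> polys_over A" "poly p u \<in> Q" "p \<notin> polys_over Q"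
  shows "\<exists>h. min_rel A Q u h"
proof -
  let ?P = "\<lambda>p. p \<in> polys_over A \<and> poly p u \<in> Q \<and> p \<notin> polys_over Q"
  obtain h where h: "?P h" and min: "\<And>r. ?P r \<Longrightarrow> Polynomial.degree h \<le> Polynomial.degree r"
    using ex_has_least_nat[of ?P p Polynomial.degree] p by auto
  note B = prime_onD[OF Q]
  have "lead_coeff h \<notin> Q"
  proof
    assume lc: "lead_coeff h \<in> Q"
    define d where "d = Polynomial.degree h"
    define r where "r = h - monom (lead_coeff h) d"
    have r1: "r \<in> polys_over A" unfolding r_def using h
      by (intro polys_over_closed[OF A(1)]) (auto simp: polys_over_def)
    have "poly r u = poly h u - lead_coeff h * u ^ d" by (simp add: r_def poly_monom)
    then have r2: "poly r u \<in> Q"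
      using ideal_on_diff[OF B(2,1)] h ideal_onD(6)[OF B(2) sring_power[OF B(1) u] lc] by auto
    have r3: "r \<notin> polys_over Q"
    proof
      assume r: "r \<in> polys_over Q"
      have "coeff h i \<in> Q" for i
        using polys_over_coeff[OF r, of i] lc ideal_onD(3)[OF B(2)]
        by (cases "i = d") (auto simp: r_def d_def)
      with h show False by (auto simp: polys_over_def)
    qed
    have "d \<noteq> 0"
    proof
      assume "d = 0"
      then have "r = 0" unfolding r_def d_def by (metis cancel_comm_monoid_add_class.diff_cancel degree_eq_zeroE monom_0 lead_coeff_pCons(2) coeff_pCons_0)
      with r3 ideal_onD(3)[OF B(2)] show False by (auto simp: polys_over_def)
    qed
    then have "Polynomial.degree r < d" unfolding r_def
      by (intro degree_less_of_coeff) (auto simp: d_def degree_diff_le degree_monom_le)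
    with min[of r] r1 r2 r3 show False by (auto simp: d_def)
  qed
  with h min show ?thesis unfolding min_rel_def by (metis leD)
qed

text \<open>The power of the leading coefficient replaces division in the fraction field. The degree
  bound on \<open>q\<close> serves \<open>exists_multiple_in_base\<close>, where the quotient itself
  has to be of smaller degree than a minimal relation.\<close>

lemma pseudo_division:
  assumes A: "sring A" and h: "h \<in> polys_over A" "0 < Polynomial.degree h" and g: "g \<in> polys_over A"
  shows "\<exists>k q r. q \<in> polys_over A \<and> r \<in> polys_over A \<and> smult (lead_coeff h ^ k) g = q * h + r \<and>
    Polynomial.degree r < Polynomial.degree h \<and> Polynomial.degree q \<le> Polynomial.degree g - Polynomial.degree h"
  using g
proof (induction "Polynomial.degree g" arbitrary: g rule: less_induct)
  case less
  show ?case
  proof (cases "Polynomial.degree g < Polynomial.degree h")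
    case True
    then show ?thesis using less.prems polys_over_closed(1)[OF A]
      by (intro exI[of _ 0] exI[of _ 0] exI[of _ g]) auto
  next
    case False
    define dg dh where "dg = Polynomial.degree g" and "dh = Polynomial.degree h"
    define b where "b = lead_coeff h"
    define m where "m = monom (lead_coeff g) (dg - dh)"
    define g1 where "g1 = smult b g - m * h"
    have bA: "b \<in> A" using h by (simp add: b_def polys_over_def)
    have m: "m \<in> polys_over A" unfolding m_def using less.prems polys_over_closed(9)[OF A]
      by (auto simp: polys_over_def)
    have g1: "g1 \<in> polys_over A" unfolding g1_def using bA m h less.prems
      by (intro polys_over_closed[OF A]) auto
    have dd: "dh \<le> dg" "0 < dh" using False h by (auto simp: dg_def dh_def)
    have "coeff (m * h) dg = lead_coeff g * b"
      unfolding m_def using coeff_monom_mult[of "lead_coeff g" "dg - dh" h dg] dd by (simp add: dh_def b_def)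
    then have c: "coeff g1 dg = 0" by (simp add: g1_def dg_def mult.commute)
    have "Polynomial.degree m \<le> dg - dh" by (simp add: m_def degree_monom_le)
    then have "Polynomial.degree (m * h) \<le> dg" using degree_mult_le[of m h] dd by (simp add: dh_def)
    then have "Polynomial.degree g1 \<le> dg" unfolding g1_def
      by (intro degree_diff_le) (auto simp: dg_def degree_smult_le)
    then have "Polynomial.degree g1 < dg" using c dd by (intro degree_less_of_coeff) auto
    from less.hyps[OF this[unfolded dg_def] g1] obtain k q r where
      IH: "q \<in> polys_over A" "r \<in> polys_over A" "smult (b ^ k) g1 = q * h + r"
        "Polynomial.degree r < Polynomial.degree h" "Polynomial.degree q \<le> Polynomial.degree g1 - dh"
      unfolding b_def dh_def by blast
    have "Polynomial.degree (smult (b ^ k) m) \<le> dg - dh"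
      using degree_smult_le[of "b ^ k" m] \<open>Polynomial.degree m \<le> dg - dh\<close> by linarith
    then have q: "Polynomial.degree (q + smult (b ^ k) m) \<le> dg - dh"
      using IH(5) \<open>Polynomial.degree g1 < dg\<close> by (intro degree_add_le) auto
    have "smult (b ^ Suc k) g = smult (b ^ k) g1 + smult (b ^ k) m * h"
      by (simp add: g1_def smult_diff_right mult.commute)
    also have "\<dots> = (q + smult (b ^ k) m) * h + r" using IH by (simp add: algebra_simps)
    finally have "smult (lead_coeff h ^ Suc k) g = (q + smult (b ^ k) m) * h + r" by (simp add: b_def)
    moreover have "q + smult (b ^ k) m \<in> polys_over A"
      using IH m sring_power[OF A bA] by (intro polys_over_closed[OF A]) auto
    ultimately show ?thesis using IH(2,4) q unfolding dg_def dh_def by blast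
  qed
qed

text \<open>The remainder of a relation is a relation of smaller degree than \<open>h\<close>, hence
  trivial modulo \<open>Q\<close>. So \<open>h\<close> generates all relations up to powers of its
  leading coefficient.\<close>

lemma min_rel_division:
  assumes Q: "prime_on B Q" and A: "sring A" "A \<subseteq> B" and u: "u \<in> B" and h: "min_rel A Q u h"
    and g: "g \<in> polys_over A" "poly g u \<in> Q"
  shows "\<exists>k q r. q \<in> polys_over A \<and> r \<in> polys_over A \<and> r \<in> polys_over Q \<and>
    smult (lead_coeff h ^ k) g = q * h + r"
proof -
  have hA: "h \<in> polys_over A" using h by (simp add: min_rel_def)
  obtain k q r where *: "q \<in> polys_over A" "r \<in> polys_over A"
    "smult (lead_coeff h ^ k) g = q * h + r" "Polynomial.degree r < Polynomial.degree h"
    using pseudo_division[OF A(1) hA min_rel_degree[OF h] g(1)] by blast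
  note B = prime_onD[OF Q]
  have "poly r u = lead_coeff h ^ k * poly g u - poly q u * poly h u"
    using arg_cong[OF *(3), of "\<lambda>p. poly p u"] by simp
  also have "\<dots> \<in> Q"
  proof (rule ideal_on_diff[OF B(2,1)])
    show "lead_coeff h ^ k * poly g u \<in> Q"
      using hA A(2) g by (intro ideal_onD(5)[OF B(2)] sring_power[OF B(1)]) (auto simp: polys_over_def)
    show "poly q u * poly h u \<in> Q"
      using h *(1) A(2) u by (intro ideal_onD(5)[OF B(2)] poly_in_sring[OF B(1)]) (auto simp: polys_over_def min_rel_def)
  qed
  finally have "r \<in> polys_over Q" using h * by (auto simp: min_rel_def)
  with * show ?thesis by blast
qed

section \<open>Points of a subring modulo a prime with values in a field, and their
  extension\<close>

definition fhom :: "'r::comm_ring_1 set \<Rightarrow> 'r set \<Rightarrow> ('r \<Rightarrow> 'o::field) \<Rightarrow> bool" where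
  "fhom A Q f \<longleftrightarrow> f 1 = 1 \<and> (\<forall>x\<in>A. \<forall>y\<in>A. f (x + y) = f x + f y \<and> f (x * y) = f x * f y) \<and>
     (\<forall>x\<in>A \<inter> Q. f x = 0)"

lemma fhomD:
  assumes "fhom A Q f"
  shows "f 1 = 1" "x \<in> A \<Longrightarrow> y \<in> A \<Longrightarrow> f (x + y) = f x + f y"
    "x \<in> A \<Longrightarrow> y \<in> A \<Longrightarrow> f (x * y) = f x * f y" "x \<in> A \<Longrightarrow> x \<in> Q \<Longrightarrow> f x = 0"
  using assms by (auto simp: fhom_def)

lemma fhom_0: "fhom A Q f \<Longrightarrow> sring A \<Longrightarrow> f 0 = 0"
  using fhomD(2)[of A Q f 0 0] sringD(2)[of A] by (metis add_0_left add_cancel_right_right)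

lemma fhom_minus: "fhom A Q f \<Longrightarrow> sring A \<Longrightarrow> x \<in> A \<Longrightarrow> f (- x) = - f x"
  using fhomD(2)[of A Q f x "-x"] sringD(5)[of A x] fhom_0[of A Q f] by (auto simp: eq_neg_iff_add_eq_0 add.commute)

lemma fhom_diff: "fhom A Q f \<Longrightarrow> sring A \<Longrightarrow> x \<in> A \<Longrightarrow> y \<in> A \<Longrightarrow> f (x - y) = f x - f y"
  using fhomD(2)[of A Q f x "-y"] sringD(5)[of A y] fhom_minus[of A Q f y] by auto

lemma fhom_sum: "fhom A Q f \<Longrightarrow> sring A \<Longrightarrow> (\<And>i. i \<in> S \<Longrightarrow> g i \<in> A) \<Longrightarrow> f (sum g S) = (\<Sum>i\<in>S. f (g i))"
proof (induction S rule: infinite_finite_induct)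
  case (insert x F)
  then have "sum g F \<in> A" "g x \<in> A" by (auto intro: sring_sum)
  with insert show ?case by (simp add: fhomD(2)[OF insert.prems(1)])
qed (auto simp: fhom_0)

lemma fhom_power: "fhom A Q f \<Longrightarrow> sring A \<Longrightarrow> x \<in> A \<Longrightarrow> f (x ^ n) = f x ^ n"
  by (induction n) (auto simp: fhomD(1) fhomD(3) sring_power)

lemma fhom_mono: "fhom A Q f \<Longrightarrow> A' \<subseteq> A \<Longrightarrow> fhom A' Q f"
  unfolding fhom_def by blast

context
  fixes A Q :: "'r::comm_ring_1 set" and f :: "'r \<Rightarrow> 'o::field"
  assumes A: "sring A" and f: "fhom A Q f"
begin

lemma map_poly_fhom:
  "p \<in> polys_over A \<Longrightarrow> q \<in> polys_over A \<Longrightarrow> map_poly f (p + q) = map_poly f p + map_poly f q"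
  "p \<in> polys_over A \<Longrightarrow> q \<in> polys_over A \<Longrightarrow> map_poly f (p - q) = map_poly f p - map_poly f q"
  "p \<in> polys_over A \<Longrightarrow> q \<in> polys_over A \<Longrightarrow> map_poly f (p * q) = map_poly f p * map_poly f q"
  "a \<in> A \<Longrightarrow> p \<in> polys_over A \<Longrightarrow> map_poly f (smult a p) = smult (f a) (map_poly f p)"
  "p \<in> polys_over Q \<Longrightarrow> p \<in> polys_over A \<Longrightarrow> map_poly f p = 0"
  by (rule poly_eqI; simp add: coeff_map_poly fhom_0[OF f A] fhomD[OF f] fhom_diff[OF f A]
      polys_over_def coeff_mult fhom_sum[OF f A] sringD[OF A])+

lemma poly_map_poly_fhom:
  "p \<in> polys_over A \<Longrightarrow> u \<in> A \<Longrightarrow> poly (map_poly f p) (f u) = f (poly p u)"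
proof (induction p)
  case 0 then show ?case by (simp add: fhom_0[OF f A])
next
  case (pCons a p)
  have p: "p \<in> polys_over A" "a \<in> A"
    using polys_over_coeff[OF pCons.prems(1), of 0] polys_over_coeff[OF pCons.prems(1), of "Suc i" for i]
    by (auto simp: polys_over_def)
  then show ?case using pCons poly_in_sring[OF A p(1) pCons.prems(2)]
    by (simp add: map_poly_pCons fhom_0[OF f A] fhomD[OF f] sringD[OF A])
qed

text \<open>Universal property of \<open>adjoin A u\<close>: sending \<open>u\<close> to
  \<open>\<xi>\<close> is well defined once \<open>\<xi>\<close> satisfies the image of every
  relation of \<open>u\<close> modulo \<open>Q\<close>.\<close>

lemma fhom_extend:
  assumes Q: "0 \<in> Q"
    and ker: "\<And>p. p \<in> polys_over A \<Longrightarrow> poly p u \<in> Q \<Longrightarrow> poly (map_poly f p) \<xi> = 0"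
  shows "\<exists>g. fhom (adjoin A u) Q g \<and> (\<forall>x\<in>A. g x = f x) \<and> g u = \<xi> \<and>
    (\<forall>p\<in>polys_over A. g (poly p u) = poly (map_poly f p) \<xi>)"
proof -
  \<comment> \<open>The value is read off an arbitrarily chosen polynomial representing
    \<open>x\<close>; two choices differ by a relation, which \<open>ker\<close> sends to 0.\<close>
  define g where "g x = poly (map_poly f (SOME p. p \<in> polys_over A \<and> poly p u = x)) \<xi>" for x
  have g: "g (poly p u) = poly (map_poly f p) \<xi>" if p: "p \<in> polys_over A" for p
  proof -
    define q where "q = (SOME q. q \<in> polys_over A \<and> poly q u = poly p u)"
    have q: "q \<in> polys_over A \<and> poly q u = poly p u" unfolding q_def
      by (rule someI[of _ p]) (use p in auto)
    then have "poly (q - p) u \<in> Q" using Q by simp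
    then have "poly (map_poly f (q - p)) \<xi> = 0"
      using q p by (intro ker polys_over_closed(4)[OF A]) auto
    then show ?thesis using q p by (simp add: g_def map_poly_fhom q_def[symmetric])
  qed
  have ext: "g x = f x" if "x \<in> A" for x
    using g[of "pCons x 0"] that polys_over_closed[OF A] by (simp add: map_poly_pCons fhom_0[OF f A])
  have gu: "g u = \<xi>" using g[of "[:0,1:]"] polys_over_closed[OF A] sringD[OF A]
    by (simp add: map_poly_pCons fhom_0[OF f A] fhomD[OF f])
  have "fhom (adjoin A u) Q g" unfolding fhom_def
  proof (intro conjI ballI)
    show "g 1 = 1" using ext[of 1] sringD[OF A] fhomD[OF f] by simp
    show "g x = 0" if "x \<in> adjoin A u \<inter> Q" for x
      using that ker by (auto simp: adjoin_def g)
    fix x y assume "x \<in> adjoin A u" "y \<in> adjoin A u"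
    then obtain p q where pq: "p \<in> polys_over A" "q \<in> polys_over A" "x = poly p u" "y = poly q u"
      by (auto simp: adjoin_def)
    show "g (x + y) = g x + g y" using pq g[of "p + q"] polys_over_closed(3)[OF A pq(1,2)]
      by (simp add: g map_poly_fhom)
    show "g (x * y) = g x * g y" using pq g[of "p * q"] polys_over_closed(6)[OF A pq(1,2)]
      by (simp add: g map_poly_fhom)
  qed
  with ext gu g show ?thesis by blast
qed

end

text \<open>Takes the place of the norm of \<open>v\<close>, by the Euclidean algorithm: a
  polynomial \<open>p\<close> of least degree whose value at \<open>u\<close> is a multiple of
  \<open>v\<close> modulo \<open>Q\<close> without lying in \<open>Q\<close> must be constant, since
  otherwise dividing \<open>p\<close> by \<open>h\<close>, or \<open>h\<close> by \<open>p\<close>,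
  yields a smaller one.\<close>

lemma exists_multiple_in_base:
  assumes Q: "prime_on B Q" and A: "sring A" "A \<subseteq> B" and u: "u \<in> B" and h: "min_rel A Q u h"
    and v: "v \<in> adjoin A u" "v \<notin> Q"
  shows "\<exists>a\<in>A. \<exists>w\<in>adjoin A u. a \<notin> Q \<and> a - v * w \<in> Q"
proof -
  note B = prime_onD[OF Q]
  note I = ideal_onD[OF B(2)]
  let ?S = "\<lambda>p. p \<in> polys_over A \<and> poly p u \<notin> Q \<and> (\<exists>w\<in>adjoin A u. poly p u - v * w \<in> Q)"
  have adjB: "adjoin A u \<subseteq> B" by (rule adjoin_least[OF B(1) A(2) u])
  have ps: "poly p u \<in> adjoin A u" "poly p u \<in> B" if "p \<in> polys_over A" for p
    using adjoinI[OF that] adjB by auto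
  obtain p0 where "?S p0"
  proof -
    obtain p where "p \<in> polys_over A" "v = poly p u" using v by (auto simp: adjoin_def)
    then have "?S p" using v I(3) sringD(1)[OF adjoin_sring[OF A(1)]] by (auto intro!: bexI[of _ 1])
    then show ?thesis using that by blast
  qed
  then obtain p where p: "?S p" and min: "\<And>r. ?S r \<Longrightarrow> Polynomial.degree p \<le> Polynomial.degree r"
    using ex_has_least_nat[of ?S p0 Polynomial.degree] by auto
  then obtain w where w: "w \<in> adjoin A u" "poly p u - v * w \<in> Q" by auto
  have hA: "h \<in> polys_over A" and hu: "poly h u \<in> Q" using h by (auto simp: min_rel_def)
  define b where "b = lead_coeff h"
  have b: "b \<in> A" "b \<notin> Q" using h by (auto simp: b_def min_rel_def polys_over_def)
  define c where "c = lead_coeff p"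
  have cA: "c \<in> A" using p by (auto simp: c_def polys_over_def)
  have "Polynomial.degree p = 0"
  proof (rule ccontr)
    assume dp: "Polynomial.degree p \<noteq> 0"
    have cQ: "c \<notin> Q"
    proof
      assume c: "c \<in> Q"
      define r where "r = p - monom c (Polynomial.degree p)"
      have rA: "r \<in> polys_over A" unfolding r_def using p cA by (intro polys_over_closed[OF A(1)]) auto
      have cu: "c * u ^ Polynomial.degree p \<in> Q" using c by (intro I(6) sring_power[OF B(1) u])
      have ru: "poly r u = poly p u - c * u ^ Polynomial.degree p" by (simp add: r_def poly_monom)
      have "poly r u \<notin> Q" using p ideal_on_cancel[OF B(2,1), of "poly p u" "- (c * u ^ Polynomial.degree p)"]
          ideal_on_uminus[OF B(2,1) cu] by (auto simp: ru)
      moreover have "poly r u - v * w \<in> Q"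
        using ideal_on_diff[OF B(2,1) w(2) cu] by (simp add: ru algebra_simps)
      ultimately have "?S r" using rA w by auto
      moreover have "Polynomial.degree r < Polynomial.degree p" unfolding r_def c_def
        using dp by (intro degree_less_of_coeff) (auto simp: degree_diff_le degree_monom_le)
      ultimately show False using min[of r] by auto
    qed
    show False
    proof (cases "Polynomial.degree h \<le> Polynomial.degree p")
      case True
      obtain k q r where *: "q \<in> polys_over A" "r \<in> polys_over A" "smult (b ^ k) p = q * h + r"
        "Polynomial.degree r < Polynomial.degree h"
        using pseudo_division[OF A(1) hA min_rel_degree[OF h], of p] p by (auto simp: b_def)
      have ru: "poly r u = b ^ k * poly p u - poly q u * poly h u"
        using arg_cong[OF *(3), of "\<lambda>p. poly p u"] by simp
      have qh: "poly q u * poly h u \<in> Q" using ps[OF *(1)] hu by (intro I(5)) auto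
      have bk: "b ^ k \<in> adjoin A u" "b ^ k \<in> B" using sring_power[OF A(1) b(1)] adjoin_subset[OF A(1)] A(2) by auto
      have "poly r u \<notin> Q"
      proof
        assume "poly r u \<in> Q"
        then have "b ^ k * poly p u \<in> Q" using ideal_onD(4)[OF B(2) _ qh, of "poly r u"] by (simp add: ru)
        then show False using prime_on_cancel[OF Q _ b(2), of "poly p u" k] b(1) A(2) p ps[of p] by auto
      qed
      moreover have "poly r u - v * (b ^ k * w) \<in> Q"
      proof -
        have "poly r u - v * (b ^ k * w) = b ^ k * (poly p u - v * w) - poly q u * poly h u"
          by (simp add: ru algebra_simps)
        also have "\<dots> \<in> Q" by (rule ideal_on_diff[OF B(2,1) I(5)[OF bk(2) w(2)] qh])
        finally show ?thesis .
      qed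
      moreover have "b ^ k * w \<in> adjoin A u" using bk w by (intro sringD(4)[OF adjoin_sring[OF A(1)]]) auto
      ultimately have "?S r" using * by auto
      with min[of r] *(4) True show False by auto
    next
      case False
      obtain k q r where *: "q \<in> polys_over A" "r \<in> polys_over A" "smult (c ^ k) h = q * p + r"
        "Polynomial.degree r < Polynomial.degree p" "Polynomial.degree q \<le> Polynomial.degree h - Polynomial.degree p"
        using pseudo_division[OF A(1) _ _ hA, of p] p dp unfolding c_def by blast
      have ru: "poly r u = c ^ k * poly h u - poly q u * poly p u"
        using arg_cong[OF *(3), of "\<lambda>p. poly p u"] by simp
      have ch: "c ^ k * poly h u \<in> Q" using hu sring_power[OF A(1) cA] A(2) by (intro I(5)) auto
      have "poly r u \<in> Q"
      proof (rule ccontr)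
        assume "poly r u \<notin> Q"
        moreover have "poly r u - v * (- poly q u * w) \<in> Q"
        proof -
          have "poly r u - v * (- poly q u * w) = c ^ k * poly h u - poly q u * (poly p u - v * w)"
            by (simp add: ru algebra_simps)
          also have "\<dots> \<in> Q" by (rule ideal_on_diff[OF B(2,1) ch I(5)[OF ps(2)[OF *(1)] w(2)]])
          finally show ?thesis .
        qed
        moreover have "- poly q u * w \<in> adjoin A u"
          using w ps[OF *(1)] by (intro sringD(4,5)[OF adjoin_sring[OF A(1)]]) auto
        ultimately have "?S r" using *(2) by blast
        with min[of r] *(4) show False by auto
      qed
      \<comment> \<open>Now \<open>p\<close> would divide \<open>h\<close> modulo \<open>Q\<close>
        up to a power of \<open>c\<close>. As \<open>p\<close> does not vanish at \<open>u\<close>,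
        the cofactor \<open>q\<close> is a relation of degree below that of \<open>h\<close>, hence
        trivial; then so is \<open>c ^ k\<close> times \<open>h\<close>, against its leading
        coefficient.\<close>
      then have r: "r \<in> polys_over Q" using h *(2,4) False by (auto simp: min_rel_def)
      have "poly q u * poly p u \<in> Q"
        using ideal_on_diff[OF B(2,1) ch \<open>poly r u \<in> Q\<close>] by (simp add: ru)
      then have "poly q u \<in> Q" using B(4) p ps[OF *(1)] ps[of p] by blast
      then have q: "q \<in> polys_over Q" using h *(1,5) False dp by (auto simp: min_rel_def)
      have "coeff (q * p + r) i \<in> Q" for i
        unfolding coeff_add coeff_mult using q r p A(2)
        by (intro I(4) ideal_on_sum[OF B(2)] I(6)) (auto simp: polys_over_def)
      then have "c ^ k * b \<in> Q" unfolding *(3)[symmetric] by (metis coeff_smult b_def)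
      then show False using prime_on_cancel[OF Q _ cQ, of b k] cA b A(2) by auto
    qed
  qed
  then obtain a where "p = [:a:]" by (metis degree_eq_zeroE)
  then show ?thesis using p w polys_over_coeff[of p A 0] by auto
qed

text \<open>Since \<open>f\<close> does not kill the leading coefficient, its powers in
  \<open>min_rel_division\<close> cancel after applying \<open>f\<close>, and a root of the image of
  \<open>h\<close> satisfies the image of every relation.\<close>

lemma fhom_extend_root:
  fixes f :: "'r::comm_ring_1 \<Rightarrow> 'o::field"
  assumes Q: "prime_on B Q" and A: "sring A" "A \<subseteq> B" and u: "u \<in> B" and h: "min_rel A Q u h"
    and f: "fhom A Q f" "f (lead_coeff h) \<noteq> 0" and \<xi>: "poly (map_poly f h) \<xi> = 0"
  shows "\<exists>g. fhom (adjoin A u) Q g \<and> (\<forall>x\<in>A. g x = f x) \<and> g u = \<xi>"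
proof -
  define b where "b = lead_coeff h"
  have hA: "h \<in> polys_over A" using h by (auto simp: min_rel_def)
  have b: "b \<in> A" "f b \<noteq> 0" using h f by (auto simp: b_def min_rel_def polys_over_def)
  have "poly (map_poly f r) \<xi> = 0" if r: "r \<in> polys_over A" "poly r u \<in> Q" for r
  proof -
    obtain k q s where *: "q \<in> polys_over A" "s \<in> polys_over A" "s \<in> polys_over Q" "smult (b ^ k) r = q * h + s"
      using min_rel_division[OF Q A u h r] by (auto simp: b_def)
    have "map_poly f (smult (b ^ k) r) = smult (f (b ^ k)) (map_poly f r)"
      using r b sring_power[OF A(1)] by (intro map_poly_fhom[OF A(1) f(1)]) auto
    moreover have "map_poly f (q * h + s) = map_poly f q * map_poly f h"
      using * hA polys_over_closed(6)[OF A(1) *(1) hA]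
        map_poly_fhom(1)[OF A(1) f(1) _ *(2)] map_poly_fhom(5)[OF A(1) f(1) *(3,2)]
        map_poly_fhom(3)[OF A(1) f(1) *(1) hA] by simp
    ultimately have "smult (f (b ^ k)) (map_poly f r) = map_poly f q * map_poly f h" using *(4) by simp
    then have "f (b ^ k) * poly (map_poly f r) \<xi> = 0" using \<xi> by (metis poly_smult poly_mult mult_zero_right)
    then show ?thesis using b fhom_power[OF f(1) A(1) b(1)] by simp
  qed
  from fhom_extend[OF A(1) f(1) ideal_onD(3)[OF prime_onD(2)[OF Q]] this] show ?thesis by blast
qed

text \<open>One variable of Chevalley's theorem: the restrictions to \<open>A\<close> of the points
  with \<open>v \<noteq> 0\<close> contain all points of an open set \<open>a \<noteq> 0\<close>
  with \<open>a\<close> outside \<open>Q\<close>.\<close>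

lemma fhom_extend_generic:
  assumes Q: "prime_on B Q" and A: "sring A" "A \<subseteq> B" and u: "u \<in> B"
    and v: "v \<in> adjoin A u" "v \<notin> Q"
  shows "\<exists>a\<in>A. a \<notin> Q \<and> (\<forall>f :: 'r::comm_ring_1 \<Rightarrow> 'o::{alg_closed_field, field_char_0}. fhom A Q f \<longrightarrow> f a \<noteq> 0 \<longrightarrow>
    (\<exists>g. fhom (adjoin A u) Q g \<and> (\<forall>x\<in>A. g x = f x) \<and> g v \<noteq> 0))"
proof -
  note B = prime_onD[OF Q]
  note I = ideal_onD[OF B(2)]
  show ?thesis
  proof (cases "\<forall>p\<in>polys_over A. poly p u \<in> Q \<longrightarrow> p \<in> polys_over Q")
    case True
    obtain p where p: "p \<in> polys_over A" "v = poly p u" using v by (auto simp: adjoin_def)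
    have "p \<notin> polys_over Q"
      using p v poly_in_ideal[OF B(2,1) _ u, of p] by auto
    then obtain i where i: "coeff p i \<notin> Q" by (auto simp: polys_over_def)
    show ?thesis
    proof (intro bexI[of _ "coeff p i"] conjI allI impI i)
      show "coeff p i \<in> A" using p by (simp add: polys_over_def)
      fix f :: "'r \<Rightarrow> 'o" assume f: "fhom A Q f" "f (coeff p i) \<noteq> 0"
      then have "map_poly f p \<noteq> 0" using fhom_0[OF f(1) A(1)] by (metis coeff_0 coeff_map_poly)
      then have "finite {x. poly (map_poly f p) x = 0}" by (rule poly_roots_finite)
      \<comment> \<open>A free \<open>u\<close> may take any value, so only the finitely many roots
        of the image of \<open>p\<close> have to be avoided.\<close>
      then obtain \<xi> where \<xi>: "poly (map_poly f p) \<xi> \<noteq> 0"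
        using infinite_UNIV_char_0[where 'a='o] by (metis (mono_tags, lifting) UNIV_eq_I mem_Collect_eq)
      have "poly (map_poly f r) \<xi> = 0" if "r \<in> polys_over A" "poly r u \<in> Q" for r
        using True that map_poly_fhom(5)[OF A(1) f(1), of r] by simp
      from fhom_extend[OF A(1) f(1) I(3) this] obtain g where
        "fhom (adjoin A u) Q g" "\<forall>x\<in>A. g x = f x" "\<forall>p\<in>polys_over A. g (poly p u) = poly (map_poly f p) \<xi>"
        by blast
      then show "\<exists>g. fhom (adjoin A u) Q g \<and> (\<forall>x\<in>A. g x = f x) \<and> g v \<noteq> 0"
        using p \<xi> by auto
    qed
  next
    case False
    then obtain h where h: "min_rel A Q u h" using exists_min_rel[OF Q A u] by blast
    from exists_multiple_in_base[OF Q A u h v] obtain a w where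
      aw: "a \<in> A" "w \<in> adjoin A u" "a \<notin> Q" "a - v * w \<in> Q" by blast
    define b where "b = lead_coeff h"
    have hA: "h \<in> polys_over A" using h by (auto simp: min_rel_def)
    have b: "b \<in> A" "b \<notin> Q" using h by (auto simp: b_def min_rel_def polys_over_def)
    \<comment> \<open>Two conditions in one witness: \<open>f b \<noteq> 0\<close> keeps the degree
      of \<open>map_poly f h\<close> positive, so that it has a root, and
      \<open>f a \<noteq> 0\<close> forces \<open>g v \<noteq> 0\<close> because \<open>a\<close> is
      a multiple of \<open>v\<close> modulo \<open>Q\<close>.\<close>
    show ?thesis
    proof (intro bexI[of _ "a * b"] conjI allI impI)
      show "a * b \<in> A" using sringD(4)[OF A(1)] aw b by auto
      show "a * b \<notin> Q" using B(4)[of a b] aw b A(2) by auto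
      fix f :: "'r \<Rightarrow> 'o" assume f: "fhom A Q f" "f (a * b) \<noteq> 0"
      then have fab: "f a \<noteq> 0" "f b \<noteq> 0" using fhomD(3)[OF f(1)] aw b by auto
      have "coeff (map_poly f h) (Polynomial.degree h) \<noteq> 0"
        using fab fhom_0[OF f(1) A(1)] by (simp add: coeff_map_poly b_def)
      then have "0 < Polynomial.degree (map_poly f h)"
        using min_rel_degree[OF h] le_degree by (metis order.strict_trans2)
      then obtain \<xi> where \<xi>: "poly (map_poly f h) \<xi> = 0" using alg_closed_imp_poly_has_root by blast
      from fhom_extend_root[OF Q A u h f(1) fab(2)[unfolded b_def] \<xi>] obtain g where g:
        "fhom (adjoin A u) Q g" "\<forall>x\<in>A. g x = f x" by blast
      note adj = adjoin_sring[OF A(1), of u]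
      have "g (a - v * w) = 0"
        using aw v adjoin_subset[OF A(1), of u] by (intro fhomD(4)[OF g(1)] sringD[OF adj]) auto
      moreover have "g (a - v * w) = g a - g v * g w"
        using aw v adjoin_subset[OF A(1), of u] fhom_diff[OF g(1) adj, of a "v * w"] fhomD(3)[OF g(1), of v w]
          sringD(4)[OF adj, of v w] by auto
      ultimately have "g v \<noteq> 0" using g(2) aw fab by auto
      with g show "\<exists>g. fhom (adjoin A u) Q g \<and> (\<forall>x\<in>A. g x = f x) \<and> g v \<noteq> 0" by blast
    qed
  qed
qed

section \<open>Extension of points to finitely generated algebras\<close>

fun adjoins :: "'r::comm_ring_1 set \<Rightarrow> (nat \<Rightarrow> 'r) \<Rightarrow> nat \<Rightarrow> 'r set" where
  "adjoins A x 0 = A"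
| "adjoins A x (Suc j) = adjoin (adjoins A x j) (x j)"

lemma adjoins_sring: "sring A \<Longrightarrow> sring (adjoins A x j)"
  by (induction j) (auto intro: adjoin_sring)

lemma adjoins_mono: "sring A \<Longrightarrow> i \<le> j \<Longrightarrow> adjoins A x i \<subseteq> adjoins A x j"
proof (induction j)
  case (Suc j)
  then show ?case using adjoin_subset[OF adjoins_sring, of A x j] by (auto simp: le_Suc_eq)
qed auto

lemma adjoins_mono_base: "A \<subseteq> A' \<Longrightarrow> adjoins A x j \<subseteq> adjoins A' x j"
  by (induction j) (auto dest: adjoin_mono)

lemma adjoins_gen: "sring A \<Longrightarrow> i < j \<Longrightarrow> x i \<in> adjoins A x j"
  using adjoins_mono[of A "Suc i" j x] adjoin_gen[OF adjoins_sring, of A "x i" x i] by auto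

lemma adjoins_least: "sring B \<Longrightarrow> A \<subseteq> B \<Longrightarrow> (\<And>i. i < j \<Longrightarrow> x i \<in> B) \<Longrightarrow> adjoins A x j \<subseteq> B"
proof (induction j)
  case (Suc j)
  then show ?case by (simp add: adjoin_least)
qed auto

text \<open>The adjoined elements are eliminated from the last to the first, each turning the
  current open condition into one on a smaller ring. The resulting \<open>a\<close> does not depend
  on \<open>f\<close>; \<open>transcendental_values\<close> relies on this.\<close>

lemma fhom_extend_adjoins:
  assumes Q: "prime_on B Q" and A: "sring A" "A \<subseteq> B" 
  shows "(\<And>i. i < j \<Longrightarrow> x i \<in> B) \<Longrightarrow> v \<in> adjoins A x j \<Longrightarrow> v \<notin> Q \<Longrightarrow>
    \<exists>a\<in>A. a \<notin> Q \<and> (\<forall>f :: 'r::comm_ring_1 \<Rightarrow> 'o::{alg_closed_field, field_char_0}. fhom A Q f \<longrightarrow> f a \<noteq> 0 \<longrightarrow>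
    (\<exists>g. fhom (adjoins A x j) Q g \<and> (\<forall>x\<in>A. g x = f x) \<and> g v \<noteq> 0))"
proof (induction j arbitrary: v)
  case 0 then show ?case by auto
next
  case (Suc j)
  have sub: "adjoins A x j \<subseteq> B"
    by (rule adjoins_least) (use prime_onD(1)[OF Q] A Suc.prems(1) in auto)
  note C = fhom_extend_generic[OF Q adjoins_sring[OF A(1)] sub Suc.prems(1)[OF lessI] _ Suc.prems(3), where 'o='o]
  from C Suc.prems(2) obtain v' where v': "v' \<in> adjoins A x j" "v' \<notin> Q"
    "\<And>f :: 'r \<Rightarrow> 'o. fhom (adjoins A x j) Q f \<Longrightarrow> f v' \<noteq> 0 \<Longrightarrow>
      \<exists>g. fhom (adjoins A x (Suc j)) Q g \<and> (\<forall>x\<in>adjoins A x j. g x = f x) \<and> g v \<noteq> 0"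
    by auto
  from Suc.IH[OF _ v'(1,2)] Suc.prems(1) obtain a where a: "a \<in> A" "a \<notin> Q"
    "\<And>f :: 'r \<Rightarrow> 'o. fhom A Q f \<Longrightarrow> f a \<noteq> 0 \<Longrightarrow>
      \<exists>g. fhom (adjoins A x j) Q g \<and> (\<forall>x\<in>A. g x = f x) \<and> g v' \<noteq> 0"
    by (metis less_SucI)
  show ?case
  proof (intro bexI[OF _ a(1)] conjI a(2) allI impI)
    fix f :: "'r \<Rightarrow> 'o" assume "fhom A Q f" "f a \<noteq> 0"
    from a(3)[OF this] obtain g where g: "fhom (adjoins A x j) Q g" "\<forall>x\<in>A. g x = f x" "g v' \<noteq> 0" by blast
    from v'(3)[OF g(1,3)] obtain g' where g': "fhom (adjoins A x (Suc j)) Q g'"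
      "\<forall>x\<in>adjoins A x j. g' x = g x" "g' v \<noteq> 0" by blast
    have "A \<subseteq> adjoins A x j" using adjoins_mono[OF A(1), of 0 j x] by simp
    with g g' show "\<exists>g. fhom (adjoins A x (Suc j)) Q g \<and> (\<forall>x\<in>A. g x = f x) \<and> g v \<noteq> 0"
      by (intro exI[of _ g']) auto
  qed
qed

section \<open>Radical ideals and minimal primes\<close>

definition radical_on :: "'r::comm_ring_1 set \<Rightarrow> 'r set \<Rightarrow> bool" where
  "radical_on B m \<longleftrightarrow> ideal_on B m \<and> (\<forall>x\<in>B. \<forall>n. x ^ n \<in> m \<longrightarrow> x \<in> m)"

text \<open>Minimality is encoded by what it means for a radical ideal: after localisation at
  \<open>Q\<close>, every element of \<open>Q\<close> is zero modulo \<open>m\<close>. A derivation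
  can be applied to \<open>t * x \<in> m\<close>, which is how the clause is used.\<close>

definition min_prime :: "'r::comm_ring_1 set \<Rightarrow> 'r set \<Rightarrow> 'r set \<Rightarrow> bool" where
  "min_prime B m Q \<longleftrightarrow> prime_on B Q \<and> m \<subseteq> Q \<and> (\<forall>x\<in>Q. \<exists>t\<in>B. t \<notin> Q \<and> t * x \<in> m)"

text \<open>The complement of a maximal multiplicative set avoiding a radical ideal is a minimal prime.\<close>

lemma exists_min_prime:
  assumes B: "sring B" and m: "radical_on B m"
    and S: "S \<subseteq> B" "1 \<in> S" "\<And>x y. x \<in> S \<Longrightarrow> y \<in> S \<Longrightarrow> x * y \<in> S" "S \<inter> m = {}"
  shows "\<exists>Q. min_prime B m Q \<and> Q \<inter> S = {}"
proof -
  define FF where "FF = {T. S \<subseteq> T \<and> T \<subseteq> B \<and> (\<forall>x\<in>T. \<forall>y\<in>T. x * y \<in> T) \<and> T \<inter> m = {}}"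
  have "\<exists>T\<in>FF. \<forall>U\<in>FF. T \<subseteq> U \<longrightarrow> U = T"
  proof (rule subset_Zorn_nonempty)
    show "FF \<noteq> {}" using S by (auto simp: FF_def)
    fix \<C> assume C: "\<C> \<noteq> {}" "subset.chain FF \<C>"
    have CF: "\<C> \<subseteq> FF" using C(2) by (rule subset_chain_def[THEN iffD1, THEN conjunct1])
    have Z: "S \<subseteq> Z \<and> Z \<subseteq> B \<and> (\<forall>x\<in>Z. \<forall>y\<in>Z. x * y \<in> Z) \<and> Z \<inter> m = {}" if "Z \<in> \<C>" for Z
      using subsetD[OF CF that] unfolding FF_def by (rule CollectD)
    have mult: "x * y \<in> \<Union>\<C>" if xy: "x \<in> \<Union>\<C>" "y \<in> \<Union>\<C>" for x y
    proof -
      obtain U Y where UY: "U \<in> \<C>" "Y \<in> \<C>" "x \<in> U" "y \<in> Y" using xy by (elim UnionE)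
      have "U \<subseteq> Y \<or> Y \<subseteq> U" using C(2) UY(1,2) by (simp add: subset_chain_def)
      then have "x * y \<in> U \<or> x * y \<in> Y" using UY(3,4) Z[OF UY(1)] Z[OF UY(2)] by auto
      then show ?thesis using UY(1,2) by auto
    qed
    obtain Z0 where Z0: "Z0 \<in> \<C>" using C(1) by auto
    have "S \<subseteq> \<Union>\<C>" using Z[OF Z0] Z0 by auto
    moreover have "\<Union>\<C> \<subseteq> B" using Z by (intro Union_least) simp
    moreover have "\<Union>\<C> \<inter> m = {}"
    proof -
      have False if "x \<in> \<Union>\<C>" "x \<in> m" for x using that Z by (metis UnionE disjoint_iff)
      then show ?thesis by auto
    qed
    ultimately show "\<Union>\<C> \<in> FF" unfolding FF_def by (intro CollectI conjI ballI mult)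
  qed
  then obtain T where T: "T \<in> FF" and max: "\<And>U. U \<in> FF \<Longrightarrow> T \<subseteq> U \<Longrightarrow> U = T" by (elim bexE) simp
  have T': "S \<subseteq> T" "T \<subseteq> B" "\<And>x y. x \<in> T \<Longrightarrow> y \<in> T \<Longrightarrow> x * y \<in> T" "T \<inter> m = {}" using T by (auto simp: FF_def)
  have T1: "1 \<in> T" using T' S by auto
  have Tpow: "t ^ n \<in> T" if "t \<in> T" for t n by (induction n) (use T1 T'(3) that in auto)
  have mi: "ideal_on B m" and rad: "\<And>x n. x \<in> B \<Longrightarrow> x ^ n \<in> m \<Longrightarrow> x \<in> m" using m by (auto simp: radical_on_def)
  note I = ideal_onD[OF mi]
  have key: "\<exists>t\<in>T. t * x \<in> m" if x: "x \<in> B" "x \<notin> T" for x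
  proof -
    \<comment> \<open>The multiplicative set generated by \<open>T\<close> and \<open>x\<close>; by
      maximality of \<open>T\<close> it must meet \<open>m\<close>.\<close>
    define U where "U = {t * x ^ n | t n. t \<in> T}"
    have UI: "t * x ^ n \<in> U" if "t \<in> T" for t n using that unfolding U_def by blast
    have "T \<subseteq> U" using UI[of _ 0] by auto
    have "x \<in> U" using UI[OF T1, of 1] by simp
    have "U \<notin> FF" using max[OF _ \<open>T \<subseteq> U\<close>] \<open>x \<in> U\<close> x by auto
    moreover have "S \<subseteq> U" using \<open>T \<subseteq> U\<close> T'(1) by (rule subset_trans[rotated])
    moreover have "U \<subseteq> B"
    proof
      fix z assume "z \<in> U"
      then obtain t n where "z = t * x ^ n" "t \<in> T" by (auto simp: U_def)
      then show "z \<in> B" using subsetD[OF T'(2)] x(1) by (simp add: sringD(4)[OF B] sring_power[OF B])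
    qed
    moreover have "a * b \<in> U" if ab: "a \<in> U" "b \<in> U" for a b
    proof -
      obtain t n s k where "a = t * x ^ n" "b = s * x ^ k" "t \<in> T" "s \<in> T" using ab by (auto simp: U_def)
      then have "a * b = (t * s) * x ^ (n + k)" by (simp add: power_add algebra_simps)
      then show ?thesis using UI[OF T'(3)[OF \<open>t \<in> T\<close> \<open>s \<in> T\<close>], of "n + k"] by simp
    qed
    ultimately have "U \<inter> m \<noteq> {}" unfolding FF_def by blast
    then obtain t n where tn: "t \<in> T" "t * x ^ n \<in> m" by (auto simp: U_def)
    have "n \<noteq> 0" using tn T'(4) by (intro notI) auto
    then obtain k where k: "n = Suc k" by (cases n) auto
    \<comment> \<open>The exponent of \<open>x\<close> is removed by raising \<open>t\<close> to the
      same power and using that \<open>m\<close> is radical.\<close>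
    have "(t * x) ^ n = t ^ k * (t * x ^ n)" unfolding k by (simp add: power_mult_distrib algebra_simps)
    also have "\<dots> \<in> m" using subsetD[OF T'(2) Tpow[OF tn(1)]] tn(2) by (rule I(5))
    finally have "t * x \<in> m" using subsetD[OF T'(2) tn(1)] x(1) by (intro rad[of "t * x" n] sringD(4)[OF B])
    with tn show ?thesis by blast
  qed
  define Q where "Q = B - T"
  have Qi: "ideal_on B Q" unfolding ideal_on_def
  proof (intro conjI ballI)
    show "Q \<subseteq> B" by (auto simp: Q_def)
    show "0 \<in> Q" using T'(4) I(3) sringD(2)[OF B] by (auto simp: Q_def)
    show "x + y \<in> Q" if xy: "x \<in> Q" "y \<in> Q" for x y
    proof -
      have "x \<in> B" "x \<notin> T" "y \<in> B" "y \<notin> T" using xy by (auto simp: Q_def)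
      then obtain t s where ts: "t \<in> T" "s \<in> T" "t * x \<in> m" "s * y \<in> m" using key by meson
      have "(t * s) * (x + y) = s * (t * x) + t * (s * y)" by (simp add: algebra_simps)
      also have "\<dots> \<in> m"
        by (intro I(4) I(5)[OF _ ts(3)] I(5)[OF _ ts(4)] subsetD[OF T'(2)] ts(1,2))
      finally have *: "(t * s) * (x + y) \<in> m" .
      have "x + y \<notin> T"
      proof
        assume "x + y \<in> T"
        then have "(t * s) * (x + y) \<in> T" by (rule T'(3)[OF T'(3)[OF ts(1,2)]])
        with * T'(4) show False by blast
      qed
      then show ?thesis using \<open>x \<in> B\<close> \<open>y \<in> B\<close> sringD(3)[OF B] by (simp add: Q_def)
    qed
    show "a * x \<in> Q" if ax: "a \<in> B" "x \<in> Q" for a x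
    proof -
      have x: "x \<in> B" "x \<notin> T" using ax by (auto simp: Q_def)
      then obtain t where t: "t \<in> T" "t * x \<in> m" using key by meson
      have "t * (a * x) = a * (t * x)" by (simp add: algebra_simps)
      also have "\<dots> \<in> m" by (rule I(5)[OF ax(1) t(2)])
      finally have *: "t * (a * x) \<in> m" .
      have "a * x \<notin> T"
      proof
        assume "a * x \<in> T"
        then have "t * (a * x) \<in> T" by (rule T'(3)[OF t(1)])
        with * T'(4) show False by blast
      qed
      then show ?thesis using ax x sringD(4)[OF B] by (simp add: Q_def)
    qed
  qed
  have "x \<in> Q \<or> y \<in> Q" if "x \<in> B" "y \<in> B" "x * y \<in> Q" for x y
  proof (rule ccontr)
    assume "\<not> (x \<in> Q \<or> y \<in> Q)"
    then have "x * y \<in> T" using that by (intro T'(3)) (auto simp: Q_def)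
    then show False using that by (simp add: Q_def)
  qed
  then have "prime_on B Q" unfolding prime_on_def using B Qi T1 by (simp add: Q_def)
  moreover have "m \<subseteq> Q" using T'(4) I(1) unfolding Q_def by blast
  moreover have "\<exists>t\<in>B. t \<notin> Q \<and> t * x \<in> m" if x: "x \<in> Q" for x
  proof -
    have "x \<in> B" "x \<notin> T" using x by (auto simp: Q_def)
    then obtain t where "t \<in> T" "t * x \<in> m" using key by meson
    moreover have "t \<in> B" using calculation(1) T'(2) by blast
    ultimately show ?thesis by (auto simp: Q_def)
  qed
  moreover have "Q \<inter> S = {}" using T'(1) unfolding Q_def by blast
  ultimately show ?thesis unfolding min_prime_def by blast
qed

section \<open>Polynomials in countably many variables\<close>

type_synonym 'a mp = "(nat \<Rightarrow>\<^sub>0 nat) \<Rightarrow>\<^sub>0 'a"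

definition Cst :: "'a::comm_ring_1 \<Rightarrow> 'a mp" where
  "Cst a = Poly_Mapping.single 0 a"

definition Var :: "nat \<Rightarrow> 'a::comm_ring_1 mp" where
  "Var j = Poly_Mapping.single (Poly_Mapping.single j 1) 1"

definition rhom :: "('r::comm_ring_1 \<Rightarrow> 's::comm_ring_1) \<Rightarrow> bool" where
  "rhom f \<longleftrightarrow> f 1 = 1 \<and> (\<forall>x y. f (x + y) = f x + f y) \<and> (\<forall>x y. f (x * y) = f x * f y)"

lemma rhomD:
  assumes "rhom f"
  shows "f 1 = 1" "f (x + y) = f x + f y" "f (x * y) = f x * f y" "f 0 = 0" "f (- x) = - f x"
    "f (x - y) = f x - f y" "f (x ^ n) = f x ^ n"
proof -
  have a: "f (x + y) = f x + f y" for x y using assms by (simp add: rhom_def)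
  have z: "f 0 = 0" using a[of 0 0] by simp
  have m: "f (- x) = - f x" for x using a[of x "- x"] z by (simp add: eq_neg_iff_add_eq_0 add.commute)
  show "f 1 = 1" "f (x + y) = f x + f y" "f (x * y) = f x * f y" "f 0 = 0" "f (- x) = - f x"
    using assms z m by (auto simp: rhom_def)
  show "f (x - y) = f x - f y" using a[of x "- y"] m[of y] by simp
  show "f (x ^ n) = f x ^ n" using assms by (induction n) (auto simp: rhom_def)
qed

lemma rhom_sum: "rhom f \<Longrightarrow> f (sum g S) = (\<Sum>i\<in>S. f (g i))"
  by (induction S rule: infinite_finite_induct) (auto simp: rhomD)

lemma rhom_comp: "rhom f \<Longrightarrow> rhom g \<Longrightarrow> rhom (\<lambda>x. f (g x))"
  by (simp add: rhom_def)

lemma Cst_rhom: "rhom Cst"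
  by (simp add: rhom_def Cst_def single_add mult_single)

lemmas Cst_simps = rhomD[OF Cst_rhom]

lemma pm_induct:
  fixes p :: "'k \<Rightarrow>\<^sub>0 'v::comm_monoid_add"
  assumes "\<And>k v. P (Poly_Mapping.single k v)" "\<And>p q. P p \<Longrightarrow> P q \<Longrightarrow> P (p + q)"
  shows "P p"
proof -
  have "P (\<Sum>k\<in>S. Poly_Mapping.single k (f k))" if "finite S" for S and f :: "'k \<Rightarrow> 'v"
    using that
  proof (induction S)
    case empty
    have "Poly_Mapping.single undefined (0::'v) = (0 :: 'k \<Rightarrow>\<^sub>0 'v)" by (rule single_zero)
    then show ?case using assms(1)[of undefined 0] by simp
  qed (use assms in auto)
  moreover have "p = (\<Sum>k\<in>Poly_Mapping.keys p. Poly_Mapping.single k (Poly_Mapping.lookup p k))"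
    by (rule poly_mapping_eqI)
      (auto simp: lookup_sum lookup_single when_def in_keys_iff sum.delta)
  ultimately show ?thesis using finite_keys by metis
qed

lemma mp_induct:
  fixes p :: "'a::comm_ring_1 mp"
  assumes C: "\<And>a. P (Cst a)" and V: "\<And>j. P (Var j)"
    and a: "\<And>p q. P p \<Longrightarrow> P q \<Longrightarrow> P (p + q)" and m: "\<And>p q. P p \<Longrightarrow> P q \<Longrightarrow> P (p * q)"
  shows "P p"
proof (induction p rule: pm_induct)
  case (1 k v)
  have vk: "P (Poly_Mapping.single (Poly_Mapping.single j n) 1)" for j n
  proof (induction n)
    case 0
    have "Poly_Mapping.single (Poly_Mapping.single j 0) 1 = (Cst 1 :: 'a mp)"
      by (simp add: Cst_def)
    then show ?case using C[of 1] by simp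
  next
    case (Suc n)
    have "Poly_Mapping.single (Poly_Mapping.single j (Suc n)) 1 =
        (Var j * Poly_Mapping.single (Poly_Mapping.single j n) 1 :: 'a mp)"
      by (simp add: Var_def mult_single flip: single_add)
    then show ?case using m[OF V Suc] by simp
  qed
  have "P (Poly_Mapping.single k 1)"
  proof (induction k rule: pm_induct)
    case (2 k l)
    have "Poly_Mapping.single (k + l) 1 = (Poly_Mapping.single k 1 * Poly_Mapping.single l 1 :: 'a mp)"
      by (simp add: mult_single)
    then show ?case using m[OF 2] by simp
  qed (rule vk)
  moreover have "Poly_Mapping.single k v = Cst v * Poly_Mapping.single k 1"
    by (simp add: Cst_def mult_single)
  ultimately show ?case using m[OF C[of v]] by simp
qed (rule a)

definition mon :: "(nat \<Rightarrow> 'b::comm_ring_1) \<Rightarrow> (nat \<Rightarrow>\<^sub>0 nat) \<Rightarrow> 'b" where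
  "mon \<xi> k = (\<Prod>j\<in>Poly_Mapping.keys k. \<xi> j ^ Poly_Mapping.lookup k j)"

definition ev :: "('a::comm_ring_1 \<Rightarrow> 'b::comm_ring_1) \<Rightarrow> (nat \<Rightarrow> 'b) \<Rightarrow> 'a mp \<Rightarrow> 'b" where
  "ev \<phi> \<xi> p = (\<Sum>k\<in>Poly_Mapping.keys p. \<phi> (Poly_Mapping.lookup p k) * mon \<xi> k)"

lemma mon_superset:
  "finite F \<Longrightarrow> Poly_Mapping.keys k \<subseteq> F \<Longrightarrow> mon \<xi> k = (\<Prod>j\<in>F. \<xi> j ^ Poly_Mapping.lookup k j)"
  unfolding mon_def by (rule prod.mono_neutral_left) (auto simp: in_keys_iff)

lemma mon_add: "mon \<xi> (k + l) = mon \<xi> k * mon \<xi> l"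
proof -
  define F where "F = Poly_Mapping.keys k \<union> Poly_Mapping.keys l"
  have "finite F" "Poly_Mapping.keys k \<subseteq> F" "Poly_Mapping.keys l \<subseteq> F" "Poly_Mapping.keys (k + l) \<subseteq> F"
    using keys_add[of k l] by (auto simp: F_def)
  then show ?thesis by (simp add: mon_superset[of F] lookup_add power_add prod.distrib)
qed

lemma ev_superset:
  "\<phi> 0 = 0 \<Longrightarrow> finite F \<Longrightarrow> Poly_Mapping.keys p \<subseteq> F \<Longrightarrow> ev \<phi> \<xi> p = (\<Sum>k\<in>F. \<phi> (Poly_Mapping.lookup p k) * mon \<xi> k)"
  unfolding ev_def by (rule sum.mono_neutral_left) (auto simp: in_keys_iff)

context
  fixes \<phi> :: "'a::comm_ring_1 \<Rightarrow> 'b::comm_ring_1" and \<xi> :: "nat \<Rightarrow> 'b"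
  assumes \<phi>: "rhom \<phi>"
begin

lemma ev_add: "ev \<phi> \<xi> (p + q) = ev \<phi> \<xi> p + ev \<phi> \<xi> q"
proof -
  define F where "F = Poly_Mapping.keys p \<union> Poly_Mapping.keys q"
  have "finite F" "Poly_Mapping.keys p \<subseteq> F" "Poly_Mapping.keys q \<subseteq> F" "Poly_Mapping.keys (p + q) \<subseteq> F"
    using keys_add[of p q] by (auto simp: F_def)
  then show ?thesis
    by (simp add: ev_superset[of _ F] rhomD[OF \<phi>] lookup_add algebra_simps sum.distrib)
qed

lemma ev_single: "ev \<phi> \<xi> (Poly_Mapping.single k a) = \<phi> a * mon \<xi> k"
  using ev_superset[of \<phi> "{k}" "Poly_Mapping.single k a" \<xi>] by (auto simp: rhomD[OF \<phi>])

lemma ev_mult: "ev \<phi> \<xi> (p * q) = ev \<phi> \<xi> p * ev \<phi> \<xi> q"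
proof (induction p rule: pm_induct)
  case (1 k v)
  show ?case
  proof (induction q rule: pm_induct)
    case (1 l w)
    then show ?case by (simp add: mult_single ev_single rhomD[OF \<phi>] mon_add)
  qed (simp add: ev_add algebra_simps)
qed (simp add: ev_add algebra_simps)

lemma ev_Cst: "ev \<phi> \<xi> (Cst a) = \<phi> a"
  by (simp add: Cst_def ev_single mon_def)

lemma ev_Var: "ev \<phi> \<xi> (Var j) = \<xi> j"
  by (simp add: Var_def ev_single mon_def rhomD[OF \<phi>])

lemma ev_rhom: "rhom (ev \<phi> \<xi>)"
  using ev_Cst[of 1] by (simp add: rhom_def ev_add ev_mult Cst_simps rhomD[OF \<phi>])

end

lemma rhom_eqI:
  fixes f g :: "'a::comm_ring_1 mp \<Rightarrow> 'b::comm_ring_1"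
  assumes "rhom f" "rhom g" "\<And>a. f (Cst a) = g (Cst a)" "\<And>j. f (Var j) = g (Var j)"
  shows "f p = g p"
  by (induction p rule: mp_induct) (simp_all add: assms rhomD[OF assms(1)] rhomD[OF assms(2)])

section \<open>Derivations as homomorphisms into the dual numbers\<close>

datatype 'r dual = Dual (re: 'r) (ep: 'r)

instantiation dual :: (comm_ring_1) comm_ring_1
begin
definition "0 = Dual 0 0"
definition "1 = Dual 1 0"
definition "x + y = Dual (re x + re y) (ep x + ep y)"
definition "x - y = Dual (re x - re y) (ep x - ep y)"
definition "- x = Dual (- re x) (- ep x)"
definition "x * y = Dual (re x * re y) (ep x * re y + re x * ep y)"
instance
  by standard (auto simp: zero_dual_def one_dual_def plus_dual_def minus_dual_def uminus_dual_def
      times_dual_def algebra_simps)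
end

definition deriv :: "('r::comm_ring_1 \<Rightarrow> 'r) \<Rightarrow> bool" where
  "deriv d \<longleftrightarrow> (\<forall>x y. d (x + y) = d x + d y) \<and> (\<forall>x y. d (x * y) = d x * y + x * d y)"

lemma derivD:
  assumes "deriv d"
  shows "d (x + y) = d x + d y" "d (x * y) = d x * y + x * d y" "d 0 = 0" "d 1 = 0" "d (- x) = - d x"
    "d (x - y) = d x - d y"
proof -
  have a: "d (x + y) = d x + d y" for x y using assms by (simp add: deriv_def)
  have b: "d (x * y) = d x * y + x * d y" for x y using assms by (simp add: deriv_def)
  have z: "d 0 = 0" using a[of 0 0] by simp
  have m: "d (- x) = - d x" for x using a[of x "- x"] z by (simp add: eq_neg_iff_add_eq_0 add.commute)
  show "d (x + y) = d x + d y" "d (x * y) = d x * y + x * d y" "d 0 = 0" "d (- x) = - d x"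
    using a b z m by auto
  show "d 1 = 0" using b[of 1 1] by simp
  show "d (x - y) = d x - d y" using a[of x "- y"] m[of y] by simp
qed

lemma deriv_sum: "deriv d \<Longrightarrow> d (sum g S) = (\<Sum>i\<in>S. d (g i))"
  by (induction S rule: infinite_finite_induct) (auto simp: derivD)

lemma deriv_power: "deriv d \<Longrightarrow> d (x ^ Suc n) = of_nat (Suc n) * x ^ n * d x"
proof (induction n)
  case (Suc n)
  have "d (x ^ Suc (Suc n)) = d x * x ^ Suc n + x * d (x ^ Suc n)"
    using derivD(2)[OF Suc.prems, of x "x ^ Suc n"] by simp
  also have "\<dots> = of_nat (Suc (Suc n)) * x ^ Suc n * d x" by (subst Suc.IH[OF Suc.prems]) (simp add: algebra_simps)
  finally show ?case .
qed simp

text \<open>A derivation is the second component of a ring homomorphism into the dual numbers whose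
  first component is the identity. Hence the derivation with prescribed values on constants and
  variables comes for free from an evaluation.\<close>

definition mder :: "('a \<Rightarrow> 'a mp) \<Rightarrow> (nat \<Rightarrow> 'a mp) \<Rightarrow> 'a::comm_ring_1 mp \<Rightarrow> 'a mp" where
  "mder d0 w p = ep (ev (\<lambda>a. Dual (Cst a) (d0 a)) (\<lambda>j. Dual (Var j) (w j)) p)"

lemma mder:
  assumes "\<And>a b. d0 (a + b) = d0 a + d0 b" "\<And>a b. d0 (a * b) = d0 a * Cst b + Cst a * d0 b"
  shows "deriv (mder d0 w)" "mder d0 w (Cst a) = d0 a" "mder d0 w (Var j) = w j"
proof -
  let ?\<phi> = "\<lambda>a. Dual (Cst a) (d0 a)" and ?\<xi> = "\<lambda>j. Dual (Var j) (w j)"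
  have "d0 1 = 0" using assms(2)[of 1 1] by (simp add: Cst_simps)
  then have h: "rhom ?\<phi>"
    by (simp add: rhom_def one_dual_def plus_dual_def times_dual_def assms Cst_simps)
  note e = rhomD[OF ev_rhom[OF h]]
  have re: "re (ev ?\<phi> ?\<xi> p) = p" for p
    by (induction p rule: mp_induct) (auto simp: ev_Cst[OF h] ev_Var[OF h] e plus_dual_def times_dual_def)
  show "deriv (mder d0 w)"
    by (auto simp: deriv_def mder_def e plus_dual_def times_dual_def re)
  show "mder d0 w (Cst a) = d0 a" "mder d0 w (Var j) = w j"
    by (auto simp: mder_def ev_Cst[OF h] ev_Var[OF h])
qed

lemma deriv_poly:
  fixes p :: "'r::idom poly"
  assumes "deriv d"
  shows "d (poly p u) = poly (map_poly d p) u + poly (pderiv p) u * d u"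
proof (induction p)
  case (pCons a p)
  then show ?case
    by (simp add: map_poly_pCons derivD[OF assms] pderiv_pCons algebra_simps)
qed (simp add: derivD[OF assms])

text \<open>Built by successive adjunction rather than by conditions on monomials, so that the
  extension results for \<open>adjoins\<close> apply directly.\<close>

abbreviation vars_below :: "nat \<Rightarrow> 'a::comm_ring_1 mp set" where
  "vars_below j \<equiv> adjoins (Set.range Cst) Var j"

lemma sring_Cst: "sring (Set.range (Cst :: 'a::comm_ring_1 \<Rightarrow> _))"
  unfolding sring_def
proof (intro conjI ballI)
  show "1 \<in> Set.range (Cst :: 'a \<Rightarrow> _)" using Cst_simps(1) by (metis rangeI)
  fix x y :: "'a mp" assume "x \<in> Set.range Cst" "y \<in> Set.range Cst"
  then show "x + y \<in> Set.range Cst" "x * y \<in> Set.range Cst" "- x \<in> Set.range Cst"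
    by (auto simp flip: Cst_simps)
qed

lemma vars_below_sring: "sring (vars_below j)"
  by (rule adjoins_sring[OF sring_Cst])

lemma vars_below_mono: "i \<le> j \<Longrightarrow> vars_below i \<subseteq> vars_below j"
  by (rule adjoins_mono[OF sring_Cst])

lemma Var_in_vars_below: "i < j \<Longrightarrow> Var i \<in> vars_below j"
  by (rule adjoins_gen[OF sring_Cst])

lemma Cst_in_vars_below: "Cst a \<in> vars_below j"
  using vars_below_mono[of 0 j] by auto

lemma vars_below_induct [consumes 1, case_names Cst Var add mult]:
  assumes p: "p \<in> vars_below j" and C: "\<And>a. P (Cst a)" and V: "\<And>i. i < j \<Longrightarrow> P (Var i)"
    and a: "\<And>p q. p \<in> vars_below j \<Longrightarrow> q \<in> vars_below j \<Longrightarrow> P p \<Longrightarrow> P q \<Longrightarrow> P (p + q)"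
    and m: "\<And>p q. p \<in> vars_below j \<Longrightarrow> q \<in> vars_below j \<Longrightarrow> P p \<Longrightarrow> P q \<Longrightarrow> P (p * q)"
  shows "P p"
proof -
  define S where "S = {p \<in> vars_below j. P p}"
  have uminus: "P (- q)" if "q \<in> vars_below j" "P q" for q
    using m[OF Cst_in_vars_below that(1) C that(2), of "- 1"] by (simp add: Cst_simps)
  have "sring S" unfolding sring_def S_def
    using a m uminus sringD[OF vars_below_sring[of j]] C[of 1] by (auto simp: Cst_simps)
  moreover have "Set.range Cst \<subseteq> S" using C Cst_in_vars_below by (auto simp: S_def)
  moreover have "Var i \<in> S" if "i < j" for i using V Var_in_vars_below that by (auto simp: S_def)
  ultimately have "vars_below j \<subseteq> S" by (intro adjoins_least) auto
  then show ?thesis using p by (auto simp: S_def)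
qed

lemma shift_deriv_below:
  assumes d: "deriv d" "\<And>a. d (Cst a) = Cst (c a)" "\<And>j. d (Var j) = Var (j + N)"
  shows "x \<in> vars_below j \<Longrightarrow> d x \<in> vars_below (j + N)"
proof (induction rule: vars_below_induct)
  case (mult p q)
  then have "p \<in> vars_below (j + N)" "q \<in> vars_below (j + N)" using vars_below_mono[of j "j + N"] by auto
  with mult show ?case by (auto simp: derivD[OF d(1)] intro!: sringD[OF vars_below_sring])
qed (auto simp: d derivD[OF d(1)] intro: Cst_in_vars_below Var_in_vars_below sringD[OF vars_below_sring])

lemma in_some_vars_below: "\<exists>j. p \<in> vars_below j"
proof (induction p rule: mp_induct)
  case (1 a) then show ?case using Cst_in_vars_below by blast
next
  case (2 j) then show ?case using Var_in_vars_below[of j "Suc j"] by blast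
next
  case (3 p q)
  then obtain i j where ij: "p \<in> vars_below i" "q \<in> vars_below j" by blast
  then have "p \<in> vars_below (max i j)" "q \<in> vars_below (max i j)"
    using vars_below_mono[of i "max i j"] vars_below_mono[of j "max i j"] by auto
  then show ?case using sringD(3)[OF vars_below_sring] by blast
next
  case (4 p q)
  then obtain i j where ij: "p \<in> vars_below i" "q \<in> vars_below j" by blast
  then have "p \<in> vars_below (max i j)" "q \<in> vars_below (max i j)"
    using vars_below_mono[of i "max i j"] vars_below_mono[of j "max i j"] by auto
  then show ?case using sringD(4)[OF vars_below_sring] by blast
qed

lemma finite_in_some_vars_below: "finite S \<Longrightarrow> \<exists>j. S \<subseteq> vars_below j"
proof (induction S rule: finite_induct)
  case (insert x S)
  then obtain i j where "S \<subseteq> vars_below i" "x \<in> vars_below j" using in_some_vars_below by blast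
  then have "insert x S \<subseteq> vars_below (max i j)"
    using vars_below_mono[of i "max i j"] vars_below_mono[of j "max i j"] by auto
  then show ?case by blast
qed auto

lemma Cst_of_nat: "Cst (of_nat n) = of_nat n"
  by (induction n) (simp_all add: Cst_simps)

section \<open>Generated ideals\<close>

inductive_set genid :: "'r::comm_ring_1 set \<Rightarrow> 'r set \<Rightarrow> 'r set" for B G where
  zero: "0 \<in> genid B G"
| gen: "g \<in> G \<Longrightarrow> g \<in> genid B G"
| add: "x \<in> genid B G \<Longrightarrow> y \<in> genid B G \<Longrightarrow> x + y \<in> genid B G"
| mult: "a \<in> B \<Longrightarrow> x \<in> genid B G \<Longrightarrow> a * x \<in> genid B G"

lemma genid_ideal:
  assumes "sring B" "G \<subseteq> B"
  shows "ideal_on B (genid B G)"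
proof -
  have "x \<in> B" if "x \<in> genid B G" for x
    using that by induction (use assms in \<open>auto intro: sringD\<close>)
  then show ?thesis by (auto simp: ideal_on_def intro: genid.intros)
qed

lemma genid_rhom:
  assumes "rhom s" "\<And>g. g \<in> G \<Longrightarrow> s g \<in> genid B G" "\<And>a. a \<in> B \<Longrightarrow> s a \<in> B"
  shows "x \<in> genid B G \<Longrightarrow> s x \<in> genid B G"
  by (induction rule: genid.induct) (auto simp: rhomD[OF assms(1)] intro: genid.intros assms)

lemma genid_deriv:
  assumes "deriv d" "\<And>g. g \<in> G \<Longrightarrow> d g \<in> genid B G" "\<And>a. a \<in> B \<Longrightarrow> d a \<in> B"
  shows "x \<in> genid B G \<Longrightarrow> d x \<in> genid B G"
  by (induction rule: genid.induct) (auto simp: derivD[OF assms(1)] intro!: genid.intros(1,3,4) assms)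

lemma genid_kernel:
  assumes "rhom f" "\<And>g. g \<in> G \<Longrightarrow> f g = 0"
  shows "x \<in> genid B G \<Longrightarrow> f x = 0"
  by (induction rule: genid.induct) (auto simp: rhomD[OF assms(1)] assms)

section \<open>Stable ideals\<close>

definition stable :: "('r \<Rightarrow> 'r) set \<Rightarrow> 'r set \<Rightarrow> bool" where
  "stable F I \<longleftrightarrow> (\<forall>f\<in>F. \<forall>x\<in>I. f x \<in> I)"

definition max_stable_ideal :: "('r \<Rightarrow> 'r) set \<Rightarrow> 'r::comm_ring_1 set \<Rightarrow> 'r set \<Rightarrow> bool" where
  "max_stable_ideal F B m \<longleftrightarrow> ideal_on B m \<and> stable F m \<and> 1 \<notin> m \<and>
    (\<forall>I. ideal_on B I \<longrightarrow> stable F I \<longrightarrow> m \<subseteq> I \<longrightarrow> 1 \<notin> I \<longrightarrow> I = m)"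

lemma exists_max_stable_ideal:
  assumes I: "ideal_on B I" "stable F I" "1 \<notin> I"
  shows "\<exists>m. max_stable_ideal F B m \<and> I \<subseteq> m"
proof -
  define II where "II = {J. ideal_on B J \<and> stable F J \<and> 1 \<notin> J \<and> I \<subseteq> J}"
  have "\<exists>M\<in>II. \<forall>J\<in>II. M \<subseteq> J \<longrightarrow> J = M"
  proof (rule subset_Zorn_nonempty)
    show "II \<noteq> {}" using I by (auto simp: II_def)
    fix \<C> assume C: "\<C> \<noteq> {}" "subset.chain II \<C>"
    have Z: "ideal_on B Z" "stable F Z" "1 \<notin> Z" "I \<subseteq> Z" if "Z \<in> \<C>" for Z
      using C(2) that by (auto simp: subset.chain_def II_def)
    obtain Z0 where Z0: "Z0 \<in> \<C>" using C(1) by blast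
    have "ideal_on B (\<Union>\<C>)" unfolding ideal_on_def
    proof (intro conjI ballI)
      show "\<Union>\<C> \<subseteq> B" using ideal_onD(1)[OF Z(1)] by (rule Union_least)
      show "0 \<in> \<Union>\<C>" using Z0 ideal_onD(3)[OF Z(1)] by blast
      show "a * x \<in> \<Union>\<C>" if "a \<in> B" "x \<in> \<Union>\<C>" for a x
        using that ideal_onD(5)[OF Z(1)] by blast
      fix x y assume "x \<in> \<Union>\<C>" "y \<in> \<Union>\<C>"
      then obtain U Y where UY: "U \<in> \<C>" "Y \<in> \<C>" "x \<in> U" "y \<in> Y" by blast
      then have "U \<subseteq> Y \<or> Y \<subseteq> U" using C(2) by (auto simp: subset.chain_def)
      then have "x + y \<in> U \<or> x + y \<in> Y" using UY ideal_onD(4)[OF Z(1)] by blast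
      then show "x + y \<in> \<Union>\<C>" using UY by blast
    qed
    moreover have "stable F (\<Union>\<C>)" using Z(2) unfolding stable_def by blast
    moreover have "1 \<notin> \<Union>\<C>" using Z(3) by blast
    moreover have "I \<subseteq> \<Union>\<C>" using Z(4)[OF Z0] Z0 by blast
    ultimately show "\<Union>\<C> \<in> II" unfolding II_def by simp
  qed
  then obtain M where M: "M \<in> II" "\<And>J. J \<in> II \<Longrightarrow> M \<subseteq> J \<Longrightarrow> J = M" by blast
  then have "J = M" if "ideal_on B J" "stable F J" "M \<subseteq> J" "1 \<notin> J" for J
    using that by (intro M(2)) (auto simp: II_def)
  then show ?thesis using M(1) by (auto simp: II_def max_stable_ideal_def)
qed

section \<open>Derivations and radical ideals\<close>

context
  fixes B m :: "'a::field_char_0 mp set" and d :: "'a mp \<Rightarrow> 'a mp"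
  assumes B: "sring B" "Set.range Cst \<subseteq> B" and m: "ideal_on B m"
    and d: "deriv d" "\<And>x. x \<in> B \<Longrightarrow> d x \<in> B" "\<And>x. x \<in> m \<Longrightarrow> d x \<in> m"
begin

text \<open>The classical argument that in characteristic zero the radical of a differential ideal
  is differential.\<close>

lemma deriv_nilpotent:
  assumes x: "x \<in> B" "x ^ n \<in> m"
  shows "d x ^ (2 * n) \<in> m"
proof -
  note I = ideal_onD[OF m]
  \<comment> \<open>Each step trades one factor \<open>x\<close> for two factors \<open>d x\<close>:
    differentiate and multiply once more by \<open>d x\<close>. The second factor absorbs the term
    in which a power of \<open>d x\<close> is differentiated, turning it into a multiple of the
    previous product.\<close>
  have "x ^ (n - j) * d x ^ (2 * j) \<in> m" if "j \<le> n" for j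
    using that
  proof (induction j)
    case (Suc j)
    define k where "k = n - Suc j"
    define y where "y = d x"
    have nj: "n - j = Suc k" using Suc.prems by (simp add: k_def)
    have yB: "y \<in> B" "d y \<in> B" "y ^ i \<in> B" for i using d x by (auto simp: y_def intro: sring_power[OF B(1)])
    have IH: "x ^ Suc k * y ^ (2 * j) \<in> m" using Suc nj by (simp add: y_def)
    have dy: "y * d (y ^ (2 * j)) = of_nat (2 * j) * y ^ (2 * j) * d y"
    proof (cases j)
      case (Suc i)
      have "d (y ^ (2 * j)) = of_nat (2 * j) * y ^ (2 * i + 1) * d y"
        using deriv_power[OF d(1), of y "2 * i + 1"] Suc by simp
      then show ?thesis using Suc by (simp add: algebra_simps)
    qed (simp add: derivD[OF d(1)])
    have "y * d (x ^ Suc k * y ^ (2 * j)) =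
        of_nat (Suc k) * (x ^ k * y ^ (2 * Suc j)) + of_nat (2 * j) * d y * (x ^ Suc k * y ^ (2 * j))"
    proof -
      have "y * d (x ^ Suc k * y ^ (2 * j)) = y * d (x ^ Suc k) * y ^ (2 * j) + x ^ Suc k * (y * d (y ^ (2 * j)))"
        by (simp add: derivD(2)[OF d(1)] algebra_simps del: power_Suc)
      also have "y * d (x ^ Suc k) * y ^ (2 * j) = of_nat (Suc k) * (x ^ k * y ^ (2 * Suc j))"
        by (subst deriv_power[OF d(1)]) (simp add: y_def algebra_simps)
      also note dy
      finally show ?thesis by (simp add: algebra_simps)
    qed
    moreover have "y * d (x ^ Suc k * y ^ (2 * j)) \<in> m" by (rule I(5)[OF yB(1) d(3)[OF IH]])
    moreover have "of_nat (2 * j) * d y * (x ^ Suc k * y ^ (2 * j)) \<in> m"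
      by (rule I(5)[OF sringD(4)[OF B(1) sring_of_nat[OF B(1)] yB(2)] IH])
    ultimately have "of_nat (Suc k) * (x ^ k * y ^ (2 * Suc j)) \<in> m"
      using ideal_on_cancel[OF m B(1)] by metis
    \<comment> \<open>Division by the exponent \<open>Suc k\<close>, possible because the constants
      form a field of characteristic zero.\<close>
    then have inm: "Cst (inverse (of_nat (Suc k))) * (of_nat (Suc k) * (x ^ k * y ^ (2 * Suc j))) \<in> m"
      by (intro I(5)[of "Cst c" for c]) (use B in auto)
    have one: "Cst (inverse (of_nat (Suc k))) * of_nat (Suc k) = (1 :: 'a mp)"
    proof -
      have "Cst (inverse (of_nat (Suc k))) * of_nat (Suc k) = (Cst (inverse (of_nat (Suc k)) * of_nat (Suc k)) :: 'a mp)"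
        by (simp only: Cst_simps(3) Cst_of_nat)
      also have "inverse (of_nat (Suc k)) * of_nat (Suc k) = (1::'a)" by (simp del: of_nat_Suc)
      finally show ?thesis by (simp add: Cst_simps)
    qed
    have "x ^ k * y ^ (2 * Suc j) \<in> m" using inm by (simp only: mult.assoc[symmetric] one mult_1)
    then show ?case by (simp add: k_def y_def)
  qed (use x in simp)
  from this[of n] show ?thesis by simp
qed

text \<open>The square of \<open>d x * w\<close> is a combination of \<open>x * w\<close> and its
  derivative. Thus whatever annihilates \<open>x\<close> modulo a radical differential ideal also
  annihilates \<open>d x\<close>.\<close>

lemma deriv_annihilator:
  assumes "radical_on B m" "x \<in> B" "w \<in> B" "x * w \<in> m"
  shows "d x * w \<in> m"
proof -
  note I = ideal_onD[OF m]
  have dB: "d x \<in> B" "d w \<in> B" using assms d by auto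
  have "(d x * w) ^ 2 = (d x * w) * d (x * w) - (d x * d w) * (x * w)"
    by (simp add: derivD(2)[OF d(1)] power2_eq_square algebra_simps)
  also have "\<dots> \<in> m"
    using assms(2,3) dB by (intro ideal_on_diff[OF m B(1)] I(5)[OF _ d(3)[OF assms(4)]] I(5)[OF _ assms(4)] sringD(4)[OF B(1)])
  finally show ?thesis using assms dB sringD(4)[OF B(1)] unfolding radical_on_def by blast
qed

end

text \<open>There are \<open>N\<close> differential indeterminates, and
  \<open>Var (v + k * N)\<close> is the \<open>k\<close>-th derivative of \<open>Var v\<close>. So
  \<open>P r\<close> consists of the differential polynomials of order less than \<open>r\<close>,
  and \<open>P 0\<close> is the base field. \<open>SS\<close> and \<open>DD\<close> preserve every
  \<open>P r\<close>, whereas \<open>pd\<close> raises the order by one.\<close>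

locale sd_tower =
  fixes N :: nat and SS DD :: "('a::field_char_0 mp \<Rightarrow> 'a mp) set" and pd :: "'a mp \<Rightarrow> 'a mp"
    and pa :: "'a \<Rightarrow> 'a"
  assumes N: "0 < N"
    and SS: "s \<in> SS \<Longrightarrow> rhom s" "s \<in> SS \<Longrightarrow> bij s"
    and DD: "d \<in> DD \<Longrightarrow> deriv d"
    and below: "f \<in> SS \<union> DD \<Longrightarrow> x \<in> vars_below (r * N) \<Longrightarrow> f x \<in> vars_below (r * N)"
    and comm: "f \<in> SS \<union> DD \<Longrightarrow> g \<in> SS \<union> DD \<Longrightarrow> f (g x) = g (f x)"
    and comm_pd: "f \<in> SS \<union> DD \<Longrightarrow> f (pd x) = pd (f x)"
    and pd: "deriv pd" "pd (Cst a) = Cst (pa a)" "pd (Var j) = Var (j + N)"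
begin

abbreviation "F \<equiv> SS \<union> DD"
abbreviation "P r \<equiv> vars_below (r * N) :: 'a mp set"

lemma below_Cst: "f \<in> F \<Longrightarrow> f (Cst a) \<in> Set.range Cst"
  using below[of f "Cst a" 0] by simp

lemma pd_below: "x \<in> vars_below j \<Longrightarrow> pd x \<in> vars_below (j + N)"
  by (rule shift_deriv_below[OF pd])

text \<open>The radical is again proper and stable, for derivations by
  \<open>deriv_nilpotent\<close>, so maximality makes it equal to \<open>m\<close>.\<close>

lemma max_stable_ideal_radical:
  assumes B: "sring B" "Set.range Cst \<subseteq> B" "stable F B" and m: "max_stable_ideal F B m"
  shows "radical_on B m"
proof -
  have mi: "ideal_on B m" "stable F m" "1 \<notin> m" using m by (auto simp: max_stable_ideal_def)
  note I = ideal_onD[OF mi(1)]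
  define J where "J = {x \<in> B. \<exists>n. x ^ n \<in> m}"
  have "J = m"
  proof -
    have mJ: "m \<subseteq> J" using I(2) by (auto simp: J_def intro: exI[of _ "1::nat"])
    have "ideal_on B J" unfolding ideal_on_def
    proof (intro conjI ballI)
      show "J \<subseteq> B" by (auto simp: J_def)
      show "0 \<in> J" using mJ I(3) by blast
      show "a * x \<in> J" if ax: "a \<in> B" "x \<in> J" for a x
      proof -
        obtain n where "x ^ n \<in> m" using ax by (auto simp: J_def)
        then have "a ^ n * x ^ n \<in> m" using ax sring_power[OF B(1)] by (intro I(5)) auto
        then have "(a * x) ^ n \<in> m" by (simp add: power_mult_distrib)
        then show ?thesis using ax sringD(4)[OF B(1)] by (auto simp: J_def)
      qed
      fix x y assume xy: "x \<in> J" "y \<in> J"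
      then obtain n k where nk: "x ^ n \<in> m" "y ^ k \<in> m" by (auto simp: J_def)
      have xyB: "x \<in> B" "y \<in> B" using xy by (auto simp: J_def)
      have "(x + y) ^ (n + k) = (\<Sum>i\<le>n + k. of_nat ((n + k) choose i) * x ^ i * y ^ (n + k - i))"
        by (rule binomial_ring)
      also have "\<dots> \<in> m"
      proof (rule ideal_on_sum[OF mi(1)])
        fix i
        have c: "of_nat ((n + k) choose i) \<in> B" by (rule sring_of_nat[OF B(1)])
        have "x ^ i * y ^ (n + k - i) \<in> m"
        proof (cases "n \<le> i")
          case True
          then have "x ^ i = x ^ (i - n) * x ^ n" by (simp flip: power_add)
          then have "x ^ i * y ^ (n + k - i) = (x ^ (i - n) * y ^ (n + k - i)) * x ^ n"
            by (simp only: mult_ac)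
          also have "\<dots> \<in> m"
            by (intro I(5)[OF _ nk(1)] sringD(4)[OF B(1)] sring_power[OF B(1)] xyB)
          finally show ?thesis .
        next
          case False
          then have "y ^ (n + k - i) = y ^ (n - i) * y ^ k" by (simp flip: power_add)
          then have "x ^ i * y ^ (n + k - i) = (x ^ i * y ^ (n - i)) * y ^ k"
            by (simp only: mult_ac)
          also have "\<dots> \<in> m"
            by (intro I(5)[OF _ nk(2)] sringD(4)[OF B(1)] sring_power[OF B(1)] xyB)
          finally show ?thesis .
        qed
        then show "of_nat ((n + k) choose i) * x ^ i * y ^ (n + k - i) \<in> m"
          using I(5)[OF c] by (simp add: mult.assoc)
      qed
      finally show "x + y \<in> J" using xyB sringD(3)[OF B(1)] by (auto simp: J_def)
    qed
    moreover have "stable F J" unfolding stable_def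
    proof (intro ballI)
      fix f x assume f: "f \<in> F" and x: "x \<in> J"
      then obtain n where n: "x ^ n \<in> m" by (auto simp: J_def)
      have xB: "x \<in> B" "f x \<in> B" using x f B(3) by (auto simp: J_def stable_def)
      have "\<exists>n. f x ^ n \<in> m"
      proof (cases "f \<in> SS")
        case True
        then have "f (x ^ n) = f x ^ n" using rhomD[OF SS(1)] by blast
        then show ?thesis using mi(2) n f by (metis stable_def)
      next
        case False
        then have d: "deriv f" using f DD by blast
        have "f x ^ (2 * n) \<in> m"
          by (rule deriv_nilpotent[OF B(1,2) mi(1) d _ _ xB(1) n]) (use f B(3) mi(2) in \<open>auto simp: stable_def\<close>)
        then show ?thesis by blast
      qed
      then show "f x \<in> J" using xB by (auto simp: J_def)
    qed
    moreover have "1 \<notin> J" using mi(3) by (auto simp: J_def)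
    ultimately show ?thesis using m mJ unfolding max_stable_ideal_def by blast
  qed
  then show ?thesis using mi(1) by (auto simp: radical_on_def J_def)
qed

lemma P_facts: "sring (P r)" "Set.range Cst \<subseteq> P r" "stable F (P r)" "P r \<subseteq> P (Suc r)"
  using vars_below_sring Cst_in_vars_below below vars_below_mono[of "r * N" "Suc r * N"]
  by (auto simp: stable_def)

lemma prime_on_Cst:
  fixes a :: 'a
  shows "prime_on B Q \<Longrightarrow> Cst a \<in> B \<Longrightarrow> Cst (inverse a) \<in> B \<Longrightarrow> Cst a \<in> Q \<longleftrightarrow> a = 0"
proof
  assume Q: "prime_on B Q" "Cst a \<in> B" "Cst (inverse a) \<in> B" and a: "Cst a \<in> Q"
  show "a = 0"
  proof (rule ccontr)
    assume "a \<noteq> 0"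
    then have "Cst (inverse a) * Cst a = (1 :: 'a mp)" by (simp flip: Cst_simps)
    then show False using Q a ideal_onD(5)[OF prime_onD(2)[OF Q(1)], of "Cst (inverse a)" "Cst a"] prime_onD(3)[OF Q(1)] by auto
  qed
qed (auto simp: Cst_simps ideal_onD(3)[OF prime_onD(2)])

text \<open>The embedding of the base field into its algebraic closure, viewed as a point of the
  constants; its values on other polynomials are irrelevant.\<close>

definition cval :: "'a mp \<Rightarrow> 'a alg_closure" where
  "cval p = to_ac (Poly_Mapping.lookup p 0)"

lemma cval_Cst: "cval (Cst a) = to_ac a"
  by (simp add: cval_def Cst_def)

lemma to_ac_rhom: "rhom to_ac"
  by (simp add: rhom_def)

lemma cval_fhom:
  assumes "prime_on B Q" "Set.range Cst \<subseteq> B"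
  shows "fhom (Set.range Cst) Q cval"
  unfolding fhom_def
proof (intro conjI ballI)
  show "cval 1 = 1" using cval_Cst[of 1] by (simp add: Cst_simps)
  fix x y :: "'a mp" assume "x \<in> Set.range Cst" "y \<in> Set.range Cst"
  then show "cval (x + y) = cval x + cval y" "cval (x * y) = cval x * cval y"
    by (auto simp: cval_Cst simp flip: Cst_simps)
next
  fix x assume "x \<in> Set.range Cst \<inter> Q"
  moreover have "Cst c \<in> B" for c using assms(2) by blast
  ultimately show "cval x = 0" using prime_on_Cst[OF assms(1)] by (auto simp: cval_Cst)
qed

text \<open>The point \<open>cval\<close> is extended along the variables below \<open>j\<close>.
  The open condition it has to satisfy is automatic, because a constant outside \<open>Q\<close> is
  nonzero.\<close>

lemma nullstellensatz:
  assumes Q: "prime_on B Q" and B: "vars_below j \<subseteq> B" and v: "v \<in> vars_below j" "v \<notin> Q"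
  shows "\<exists>g :: 'a mp \<Rightarrow> 'a alg_closure. fhom (vars_below j) Q g \<and> (\<forall>a. g (Cst a) = to_ac a) \<and> g v \<noteq> 0"
proof -
  have B': "Set.range Cst \<subseteq> B" "\<And>i. i < j \<Longrightarrow> Var i \<in> B"
    using B Cst_in_vars_below Var_in_vars_below by blast+
  from fhom_extend_adjoins[OF Q sring_Cst B'(1), of j Var v, OF B'(2) v, where 'o="'a alg_closure"]
  obtain a where a: "a \<in> Set.range Cst" "a \<notin> Q"
    "\<And>f :: 'a mp \<Rightarrow> 'a alg_closure. fhom (Set.range Cst) Q f \<Longrightarrow> f a \<noteq> 0 \<Longrightarrow>
      \<exists>g. fhom (vars_below j) Q g \<and> (\<forall>x\<in>Set.range Cst. g x = f x) \<and> g v \<noteq> 0"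
    by auto
  have "Cst c \<in> B" for c using B'(1) by blast
  then have "cval a \<noteq> 0"
    using a prime_on_Cst[OF Q] by (auto simp: cval_Cst)
  from a(3)[OF cval_fhom[OF Q B'(1)] this] show ?thesis by (auto simp: cval_Cst)
qed

end

section \<open>Prolongation\<close>

context sd_tower
begin

text \<open>Models \<open>z\<close> times an extension of \<open>pa\<close>, where \<open>z\<close>
  is a common denominator; the values \<open>w\<close> on the variables are the numerators.\<close>

definition pder :: "'a mp \<Rightarrow> (nat \<Rightarrow> 'a mp) \<Rightarrow> 'a mp \<Rightarrow> 'a mp" where
  "pder z w = mder (\<lambda>a. z * Cst (pa a)) w"

lemma pa_Cst:
  "Cst (pa (a + b)) = (Cst (pa a) + Cst (pa b) :: 'a mp)"
  "Cst (pa (a * b)) = (Cst (pa a) * Cst b + Cst a * Cst (pa b) :: 'a mp)"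
  using derivD(1,2)[OF pd(1), of "Cst a" "Cst b"] by (simp_all add: pd Cst_simps flip: pd(2))

lemma pder:
  "deriv (pder z w)" "pder z w (Cst a) = z * Cst (pa a)" "pder z w (Var j) = w j"
  unfolding pder_def by (intro mder; simp add: pa_Cst algebra_simps)+

lemma pder_closed:
  assumes "sring B" "\<And>a. Cst a \<in> B" "z \<in> B" "\<And>i. i < j \<Longrightarrow> w i \<in> B" "vars_below j \<subseteq> B"
    "x \<in> vars_below j"
  shows "pder z w x \<in> B"
  using assms(6)
proof (induction rule: vars_below_induct)
  case (mult p q)
  then have "p \<in> B" "q \<in> B" using assms(5) by auto
  with mult show ?case by (auto simp: derivD[OF pder(1)] intro!: sringD[OF assms(1)])
qed (use assms(2-4) in \<open>auto simp: pder derivD[OF pder(1)] intro: sringD[OF assms(1)]\<close>)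

lemma pder_cong:
  assumes "\<And>i. i < j \<Longrightarrow> w' i = c * w i" "x \<in> vars_below j"
  shows "pder (c * z) w' x = c * pder z w x"
  using assms(2)
  by (induction rule: vars_below_induct)
    (simp_all add: pder derivD[OF pder(1)] assms(1) algebra_simps)

text \<open>A derivation preserving \<open>Q\<close> on the variables below \<open>j\<close> is extended to the \<open>j\<close>-th variable
  by solving the derivative of its minimal relation modulo \<open>Q\<close>; multiplying by the separant
  avoids denominators.\<close>

lemma deriv_min_rel:
  fixes A B :: "'a mp set"
  assumes Q: "prime_on B Q" and A: "sring A" "A \<subseteq> B" and u: "u \<in> B" and h: "min_rel A Q u h"
    and D: "deriv D" "\<And>x. x \<in> A \<Longrightarrow> D x \<in> B" "D u \<in> B" "\<And>x. x \<in> A \<Longrightarrow> x \<in> Q \<Longrightarrow> D x \<in> Q"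
    and g: "g \<in> polys_over A" "poly g u \<in> Q"
  shows "poly (pderiv h) u * D (poly g u) - poly (pderiv g) u * D (poly h u) \<in> Q"
proof -
  note B = prime_onD[OF Q]
  note I = ideal_onD[OF B(2)]
  note R = sringD[OF B(1)]
  have hA: "h \<in> polys_over A" "poly h u \<in> Q" using h by (auto simp: min_rel_def)
  define b where "b = lead_coeff h"
  have b: "b \<in> A" "b \<notin> Q" "b \<in> B" using h A(2) by (auto simp: b_def min_rel_def polys_over_def)
  obtain k q r where *: "q \<in> polys_over A" "r \<in> polys_over A" "r \<in> polys_over Q" "smult (b ^ k) g = q * h + r"
    using min_rel_division[OF Q A u h g] by (auto simp: b_def)
  define c where "c = b ^ k"
  have cA: "c \<in> A" unfolding c_def using b by (intro sring_power[OF A(1)])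
  have cB: "c \<in> B" "D c \<in> B" using A(2) D(2) cA by auto
  have polyB: "poly p u \<in> B" if "p \<in> polys_over A" for p
    by (rule poly_in_sring[OF B(1) polys_over_mono[OF A(2) that] u])
  have DpolyB: "D (poly p u) \<in> B" if p: "p \<in> polys_over A" for p
  proof -
    have "map_poly D p \<in> polys_over B" using p D(2) derivD(3)[OF D(1)] 
      by (auto simp: polys_over_def coeff_map_poly)
    then show ?thesis unfolding deriv_poly[OF D(1)]
      by (intro R(3) R(4)[OF polyB[OF polys_over_pderiv[OF A(1) p]] D(3)] poly_in_sring[OF B(1) _ u])
  qed
  have Dr: "D (poly r u) \<in> Q"
  proof -
    have "map_poly D r \<in> polys_over Q" using *(2,3) D(4) derivD(3)[OF D(1)]
      by (auto simp: polys_over_def coeff_map_poly)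
    moreover have "pderiv r \<in> polys_over Q"
      using *(3) I(5)[OF sring_of_nat[OF B(1)]] by (auto simp: polys_over_def coeff_pderiv simp del: of_nat_Suc)
    ultimately show ?thesis unfolding deriv_poly[OF D(1)]
      by (intro I(4) I(6)[OF D(3)] poly_in_ideal[OF B(2,1) _ u])
  qed
  have r'u: "poly (pderiv r) u \<in> Q"
    using *(3) I(5)[OF sring_of_nat[OF B(1)]] 
    by (intro poly_in_ideal[OF B(2,1) _ u]) (auto simp: polys_over_def coeff_pderiv simp del: of_nat_Suc)
  \<comment> \<open>The equation is differentiated twice: formally in the polynomial variable
    (\<open>e2\<close>) and by \<open>D\<close> (\<open>e3\<close>). On eliminating, the products of
    \<open>q\<close>, the separant and \<open>D (poly h u)\<close> cancel, and every remaining term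
    has a factor in \<open>Q\<close>.\<close>
  have e1: "c * poly g u = poly q u * poly h u + poly r u"
    using arg_cong[OF *(4), of "\<lambda>p. poly p u"] by (simp add: c_def)
  have e2: "c * poly (pderiv g) u = poly q u * poly (pderiv h) u + poly (pderiv q) u * poly h u + poly (pderiv r) u"
    using arg_cong[OF *(4), of "\<lambda>p. poly (pderiv p) u"]
    by (simp add: c_def pderiv_smult pderiv_add pderiv_mult algebra_simps)
  have e3: "D c * poly g u + c * D (poly g u) =
      D (poly q u) * poly h u + poly q u * D (poly h u) + D (poly r u)"
    using arg_cong[OF e1, of D] by (simp add: derivD[OF D(1)] algebra_simps)
  define h' where "h' = poly (pderiv h) u"
  have h': "h' \<in> B" unfolding h'_def by (intro polyB polys_over_pderiv[OF A(1)] hA)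
  have "c * (h' * D (poly g u) - poly (pderiv g) u * D (poly h u)) =
      h' * (c * D (poly g u)) - (c * poly (pderiv g) u) * D (poly h u)" by (simp add: algebra_simps)
  also have "c * D (poly g u) = D (poly q u) * poly h u + poly q u * D (poly h u) + D (poly r u) - D c * poly g u"
    using e3 by (simp add: algebra_simps)
  also have "h' * (D (poly q u) * poly h u + poly q u * D (poly h u) + D (poly r u) - D c * poly g u)
      - (c * poly (pderiv g) u) * D (poly h u) =
    (h' * D (poly q u)) * poly h u + h' * D (poly r u) - (h' * D c) * poly g u
      - (poly (pderiv q) u * D (poly h u)) * poly h u - D (poly h u) * poly (pderiv r) u"
    unfolding e2 h'_def by (simp add: algebra_simps)
  also have "\<dots> \<in> Q"
    by (intro ideal_on_diff[OF B(2,1)] I(4) I(5)[OF _ hA(2)] I(5)[OF _ Dr] I(5)[OF _ g(2)] I(5)[OF _ r'u]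
        R(4) h' DpolyB * hA cB polyB polys_over_pderiv[OF A(1)])
  finally have "c * (h' * D (poly g u) - poly (pderiv g) u * D (poly h u)) \<in> Q" .
  moreover have "h' * D (poly g u) - poly (pderiv g) u * D (poly h u) \<in> B"
    by (intro R(6) R(4) h' DpolyB hA g polyB polys_over_pderiv[OF A(1)])
  ultimately show ?thesis unfolding c_def h'_def using prime_on_cancel[OF Q b(3,2)] by blast
qed

text \<open>The derivative of \<open>h\<close> has smaller degree, so as a relation it would be
  trivial, and the degree times the leading coefficient would lie in \<open>Q\<close>. In
  characteristic zero the degree is a unit.\<close>

lemma separant_notin:
  fixes A B :: "'a mp set"
  assumes Q: "prime_on B Q" and A: "sring A" "A \<subseteq> B" and C: "\<And>a. Cst a \<in> B" and h: "min_rel A Q u h"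
  shows "poly (pderiv h) u \<notin> Q"
proof
  assume h': "poly (pderiv h) u \<in> Q"
  have hA: "h \<in> polys_over A" and lc: "lead_coeff h \<notin> Q" using h by (auto simp: min_rel_def)
  have d: "0 < Polynomial.degree h" by (rule min_rel_degree[OF h])
  have "Polynomial.degree (pderiv h) < Polynomial.degree h" using d by (simp add: degree_pderiv)
  then have "pderiv h \<in> polys_over Q"
    using h h' polys_over_pderiv[OF A(1) hA] unfolding min_rel_def by blast
  then have "coeff (pderiv h) (Polynomial.degree h - 1) \<in> Q" by (simp add: polys_over_def)
  then have *: "of_nat (Polynomial.degree h) * lead_coeff h \<in> Q"
    using d by (simp add: coeff_pderiv del: of_nat_Suc)
  have "Cst (of_nat (Polynomial.degree h)) \<notin> Q"
    using prime_on_Cst[OF Q C C] d by simp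
  then show False using * prime_onD(4)[OF Q *] C lc hA A(2) 
    by (metis Cst_of_nat polys_over_coeff subsetD)
qed

text \<open>On \<open>P r\<close> the derivation is \<open>z\<close> times \<open>pd\<close>, which
  is known to map into \<open>Q\<close> there. The \<open>N\<close> variables of the next order are
  then treated one at a time, each algebraic one contributing its separant to
  \<open>z\<close>.\<close>

lemma exists_derivation:
  assumes Q: "prime_on (P (Suc r)) Q"
    and pdQ: "\<And>x. x \<in> Q \<Longrightarrow> x \<in> P r \<Longrightarrow> pd x \<in> Q"
  shows "i \<le> N \<Longrightarrow> \<exists>z w. z \<in> P (Suc r) \<and> z \<notin> Q \<and> (\<forall>j. w j \<in> P (Suc r)) \<and>
    (\<forall>j<r * N. w j = z * Var (j + N)) \<and> (\<forall>x\<in>vars_below (r * N + i). x \<in> Q \<longrightarrow> pder z w x \<in> Q)"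
proof (induction i)
  case 0
  let ?w = "\<lambda>j. if j < r * N then Var (j + N) else 0"
  have "pder 1 ?w x = pd x" if "x \<in> P r" for x
    using that by (induction rule: vars_below_induct) (simp_all add: pder pd derivD[OF pder(1)] derivD[OF pd(1)])
  moreover have "Var (j + N) \<in> P (Suc r)" if "j < r * N" for j using that by (intro Var_in_vars_below) simp
  ultimately show ?case using prime_onD(3)[OF Q] sringD(1,2)[OF vars_below_sring[of "N + r * N"]] pdQ
    by (intro exI[of _ 1] exI[of _ ?w]) auto
next
  case (Suc i)
  define B where "B = P (Suc r)"
  define j where "j = r * N + i"
  define A where "A = (vars_below j :: 'a mp set)"
  define u where "u = (Var j :: 'a mp)"
  note QB = Q[folded B_def]
  note Bp = prime_onD[OF QB]
  have jN: "j < Suc r * N" using Suc.prems by (simp add: j_def)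
  have A: "sring A" "A \<subseteq> B" unfolding A_def B_def using jN by (auto intro!: vars_below_sring vars_below_mono)
  have u: "u \<in> B" using jN by (simp add: u_def B_def Var_in_vars_below)
  have C: "Cst a \<in> B" for a by (simp add: B_def Cst_in_vars_below)
  have adj: "vars_below (r * N + Suc i) = adjoin A u" by (simp add: A_def u_def j_def)
  from Suc.IH[OF Suc_leD[OF Suc.prems]] obtain z w where "z \<in> B \<and> z \<notin> Q \<and> (\<forall>j. w j \<in> B) \<and>
    (\<forall>j<r * N. w j = z * Var (j + N)) \<and> (\<forall>x\<in>A. x \<in> Q \<longrightarrow> pder z w x \<in> Q)"
    unfolding A_def B_def j_def by (elim exE)
  then have IH: "z \<in> B" "z \<notin> Q" "\<And>j. w j \<in> B" "\<And>j. j < r * N \<Longrightarrow> w j = z * Var (j + N)"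
    "\<And>x. x \<in> A \<Longrightarrow> x \<in> Q \<Longrightarrow> pder z w x \<in> Q" by auto
  define D where "D = pder z w"
  have D: "deriv D" "\<And>x. x \<in> A \<Longrightarrow> D x \<in> B" "D u \<in> B" "\<And>x. x \<in> A \<Longrightarrow> x \<in> Q \<Longrightarrow> D x \<in> Q"
    unfolding D_def using pder(1) IH(5) pder_closed[OF Bp(1) C IH(1) IH(3), where j=j] A(2)
    by (auto simp: u_def pder IH(3) A_def)
  show ?case
  proof (cases "\<forall>p\<in>polys_over A. poly p u \<in> Q \<longrightarrow> p \<in> polys_over Q")
    case True
    \<comment> \<open>A free variable does not constrain its derivative: all relations have
      coefficients in \<open>Q\<close>, so the value \<open>w j\<close> already present may
      stay.\<close>
    have "D x \<in> Q" if x: "x \<in> adjoin A u" "x \<in> Q" for x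
    proof -
      obtain p where p: "p \<in> polys_over A" "x = poly p u" using x by (auto simp: adjoin_def)
      have pQ: "p \<in> polys_over Q" using True p x by blast
      have "map_poly D p \<in> polys_over Q" using pQ p D(4) derivD(3)[OF D(1)]
        by (auto simp: polys_over_def coeff_map_poly)
      moreover have "pderiv p \<in> polys_over Q"
        using pQ ideal_onD(5)[OF Bp(2) sring_of_nat[OF Bp(1)]]
        by (auto simp: polys_over_def coeff_pderiv simp del: of_nat_Suc)
      ultimately show ?thesis unfolding p(2) deriv_poly[OF D(1)]
        by (intro ideal_onD(4)[OF Bp(2)] ideal_onD(6)[OF Bp(2) D(3)] poly_in_ideal[OF Bp(2,1) _ u])
    qed
    then show ?thesis unfolding adj using IH by (intro exI[of _ z] exI[of _ w]) (auto simp: D_def B_def)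
  next
    case False
    then obtain h where h: "min_rel A Q u h" using exists_min_rel[OF QB A u] by blast
    have hA: "h \<in> polys_over A" using h by (auto simp: min_rel_def)
    define c where "c = poly (pderiv h) u"
    have c: "c \<in> B" "c \<notin> Q" unfolding c_def
      using separant_notin[OF QB A C h] polys_over_pderiv[OF A(1) hA] polys_over_mono[OF A(2)]
        poly_in_sring[OF Bp(1) _ u] by blast+
    define e where "e = poly (map_poly D h) u"
    have e: "e \<in> B" unfolding e_def using hA D(2) derivD(3)[OF D(1)] 
      by (intro poly_in_sring[OF Bp(1) _ u]) (auto simp: polys_over_def coeff_map_poly)
    \<comment> \<open>After rescaling by \<open>c\<close>, differentiating the minimal relation
      leaves \<open>c * e\<close> plus \<open>c\<close> times the value at \<open>u\<close>; the
      value \<open>- e\<close> cancels this. Later variables get 0 as a placeholder.\<close>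
    define w' where "w' k = (if k < j then c * w k else if k = j then - e else 0)" for k
    have w': "w' k \<in> B" for k using c e IH(3) sringD[OF Bp(1)] by (auto simp: w'_def)
    have D'A: "pder (c * z) w' x = c * D x" if "x \<in> A" for x
      unfolding D_def using that by (intro pder_cong[where j=j]) (auto simp: w'_def A_def)
    have "pder (c * z) w' x \<in> Q" if x: "x \<in> adjoin A u" "x \<in> Q" for x
    proof -
      obtain g where g: "g \<in> polys_over A" "x = poly g u" using x by (auto simp: adjoin_def)
      have "map_poly (pder (c * z) w') g = smult c (map_poly D g)"
        using g D'A by (intro poly_eqI) (auto simp: coeff_map_poly derivD[OF pder(1)] derivD[OF D(1)] polys_over_def)
      then have "pder (c * z) w' x = c * poly (map_poly D g) u - poly (pderiv g) u * e"
        by (simp add: g(2) deriv_poly[OF pder(1)]) (simp add: u_def pder w'_def)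
      also have "\<dots> = c * D (poly g u) - poly (pderiv g) u * D (poly h u)"
        unfolding deriv_poly[OF D(1)] by (simp add: c_def e_def algebra_simps)
      also have "\<dots> \<in> Q" unfolding c_def using g x by (intro deriv_min_rel[OF QB A u h D]) auto
      finally show ?thesis .
    qed
    moreover have "c * z \<notin> Q" using Bp(4) c IH by blast
    moreover have "c * z \<in> B" using sringD(4)[OF Bp(1) c(1) IH(1)] .
    moreover have "w' k = (c * z) * Var (k + N)" if "k < r * N" for k
      using that IH(4)[OF that] by (simp add: w'_def j_def)
    ultimately show ?thesis unfolding adj B_def[symmetric] using w' by blast
  qed
qed

lemma prolong_proper:
  assumes m0: "radical_on (P r) m0" "1 \<notin> m0" and m1: "radical_on (P (Suc r)) m1" "1 \<notin> m1"
    and int: "m1 \<inter> P r = m0" and pdm: "\<And>x. x \<in> m0 \<Longrightarrow> pd x \<in> m1"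
  shows "1 \<notin> genid (P (Suc (Suc r))) (m1 \<union> pd ` m1)"
proof -
  define A B where "A = P r" and "B = P (Suc r)"
  have AB: "sring A" "sring B" "A \<subseteq> B" unfolding A_def B_def by (rule P_facts)+
  have pdA: "pd x \<in> B" if "x \<in> A" for x using pd_below[of x "r * N"] that by (simp add: A_def B_def add.commute)
  obtain Q0 where Q0: "min_prime A m0 Q0"
    using exists_min_prime[OF AB(1) m0(1)[folded A_def], of "{1}"] m0(2) sringD(1)[OF AB(1)] by auto
  have Q0p: "prime_on A Q0" "m0 \<subseteq> Q0" using Q0 by (auto simp: min_prime_def)
  \<comment> \<open>Avoiding all of \<open>A - Q0\<close> makes \<open>Q\<close> contract into
    \<open>Q0\<close>, so that the multipliers witnessing minimality of \<open>Q0\<close> remain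
    outside \<open>Q\<close>.\<close>
  have "\<exists>Q. min_prime B m1 Q \<and> Q \<inter> (A - Q0) = {}"
  proof (rule exists_min_prime[OF AB(2) m1(1)[folded B_def]])
    show "A - Q0 \<subseteq> B" using AB by blast
    show "1 \<in> A - Q0" using prime_onD[OF Q0p(1)] sringD(1) by blast
    show "x * y \<in> A - Q0" if "x \<in> A - Q0" "y \<in> A - Q0" for x y
      using that prime_onD(4)[OF Q0p(1), of x y] sringD(4)[OF AB(1)] by blast
    show "(A - Q0) \<inter> m1 = {}" using int Q0p(2) by (auto simp: A_def)
  qed
  then obtain Q where Q: "prime_on B Q" "m1 \<subseteq> Q" "Q \<inter> (A - Q0) = {}" by (auto simp: min_prime_def)
  note Bp = prime_onD[OF Q(1)]
  \<comment> \<open>Differentiate \<open>t * x \<in> m0\<close> and cancel \<open>t\<close>: closure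
    of the ideals under \<open>pd\<close> passes to the primes.\<close>
  have pdQ: "pd x \<in> Q" if x: "x \<in> Q" "x \<in> A" for x
  proof -
    have "x \<in> Q0" using x Q(3) by blast
    then obtain t where t: "t \<in> A" "t \<notin> Q0" "t * x \<in> m0" using Q0 by (auto simp: min_prime_def)
    have tB: "t \<in> B" "t \<notin> Q" using t AB Q(3) by blast+
    have "pd t * x + t * pd x \<in> Q" using pdm[OF t(3)] Q(2) by (auto simp: derivD[OF pd(1)])
    moreover have "pd t * x \<in> Q" by (rule ideal_onD(5)[OF Bp(2) pdA[OF t(1)] x(1)])
    ultimately have "t * pd x \<in> Q" using ideal_on_cancel[OF Bp(2,1), of "t * pd x" "pd t * x"] by (simp add: add.commute)
    then show ?thesis using Bp(4) tB pdA[OF x(2)] by blast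
  qed
  have "\<exists>z w. z \<in> P (Suc r) \<and> z \<notin> Q \<and> (\<forall>j. w j \<in> P (Suc r)) \<and>
    (\<forall>j<r * N. w j = z * Var (j + N)) \<and> (\<forall>x\<in>vars_below (r * N + N). x \<in> Q \<longrightarrow> pder z w x \<in> Q)"
    by (rule exists_derivation[OF Q(1)[unfolded B_def]]) (use pdQ in \<open>simp_all add: A_def\<close>)
  moreover have "r * N + N = Suc r * N" by simp
  ultimately obtain z w where "z \<in> B \<and> z \<notin> Q \<and> (\<forall>j. w j \<in> B) \<and> (\<forall>j<r * N. w j = z * Var (j + N)) \<and>
    (\<forall>x\<in>B. x \<in> Q \<longrightarrow> pder z w x \<in> Q)"
    unfolding B_def by (elim exE) metis
  then have D: "z \<in> B" "z \<notin> Q" "\<And>j. w j \<in> B" "\<And>j. j < r * N \<Longrightarrow> w j = z * Var (j + N)"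
    "\<And>x. x \<in> B \<Longrightarrow> x \<in> Q \<Longrightarrow> pder z w x \<in> Q" by auto
  obtain g :: "'a mp \<Rightarrow> 'a alg_closure" where g: "fhom B Q g" "\<And>a. g (Cst a) = to_ac a" "g z \<noteq> 0"
    using nullstellensatz[OF Q(1), of "Suc r * N" z] D by (auto simp: B_def)
  \<comment> \<open>A variable of the new order is the derivative of \<open>Var (j - N)\<close> and
    receives the value of the extended derivation there, divided by the common denominator.\<close>
  define \<xi> where "\<xi> j = (if j < Suc r * N then g (Var j) else g (w (j - N)) / g z)" for j
  define \<psi> where "\<psi> = ev to_ac \<xi>"
  note \<psi> = ev_rhom[OF to_ac_rhom, of \<xi>, folded \<psi>_def] ev_Cst[OF to_ac_rhom, of \<xi>, folded \<psi>_def]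
    ev_Var[OF to_ac_rhom, of \<xi>, folded \<psi>_def]
  have \<psi>g: "\<psi> x = g x" if "x \<in> B" for x
    using that unfolding B_def
  proof (induction rule: vars_below_induct)
    case (Var i) then show ?case by (simp add: \<psi> \<xi>_def)
  qed (simp_all add: \<psi> g rhomD[OF \<psi>(1)] fhomD[OF g(1)[unfolded B_def]])
  have DB: "pder z w x \<in> B" if "x \<in> B" for x
    using pder_closed[OF Bp(1) _ D(1) D(3), of "Suc r * N" x] that
    by (auto simp: B_def Cst_in_vars_below)
  \<comment> \<open>This identity is what \<open>\<xi>\<close> was designed for: since the
    derivation preserves \<open>Q\<close>, it makes \<open>\<psi>\<close> vanish on the derivatives
    of \<open>m1\<close>.\<close>
  have \<psi>pd: "\<psi> (pd x) * g z = g (pder z w x)" if "x \<in> B" for x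
    using that unfolding B_def
  proof (induction rule: vars_below_induct)
    case (Cst a)
    have "g (z * Cst (pa a)) = g z * to_ac (pa a)"
      using fhomD(3)[OF g(1) D(1), of "Cst (pa a)"] g(2) by (simp add: B_def Cst_in_vars_below)
    then show ?case by (simp add: \<psi> pd pder)
  next
    case (Var j)
    show ?case
    proof (cases "j < r * N")
      case True
      then have "Var (j + N) \<in> B" by (simp add: B_def Var_in_vars_below)
      then show ?thesis using True by (simp add: pd pder \<psi> \<xi>_def D(4) fhomD(3)[OF g(1) D(1)])
    next
      case False
      then show ?thesis using g(3) by (simp add: pd pder \<psi> \<xi>_def)
    qed
  next
    case (add p q)
    then have "p \<in> B" "q \<in> B" by (auto simp: B_def)
    then have "g (pder z w (p + q)) = g (pder z w p) + g (pder z w q)"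
      using DB by (simp add: derivD[OF pder(1)] fhomD(2)[OF g(1)])
    moreover have "\<psi> (pd (p + q)) = \<psi> (pd p) + \<psi> (pd q)"
      by (simp add: derivD[OF pd(1)] rhomD[OF \<psi>(1)])
    ultimately show ?case using add by (simp add: algebra_simps)
  next
    case (mult p q)
    then have pq: "p \<in> B" "q \<in> B" by (auto simp: B_def)
    have "g (pder z w (p * q)) = g (pder z w p) * g q + g p * g (pder z w q)"
      using pq DB sringD(4)[OF Bp(1)] by (simp add: derivD[OF pder(1)] fhomD[OF g(1)])
    moreover have "\<psi> (pd (p * q)) = \<psi> (pd p) * g q + g p * \<psi> (pd q)"
      using pq by (simp add: derivD[OF pd(1)] rhomD[OF \<psi>(1)] \<psi>g)
    ultimately show ?case using mult by (simp add: algebra_simps)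
  qed
  have "\<psi> x = 0" if x: "x \<in> m1 \<union> pd ` m1" for x
  proof -
    have *: "\<psi> y = 0 \<and> \<psi> (pd y) = 0" if y: "y \<in> m1" for y
    proof -
      have yB: "y \<in> B" "y \<in> Q" using y Q(2) ideal_onD(2)[OF Bp(2)] by auto
      have "\<psi> (pd y) * g z = 0"
        unfolding \<psi>pd[OF yB(1)] by (rule fhomD(4)[OF g(1) DB[OF yB(1)] D(5)[OF yB]])
      then show ?thesis using g(3) \<psi>g[OF yB(1)] fhomD(4)[OF g(1) yB] by simp
    qed
    then show ?thesis using x by auto
  qed
  then show ?thesis using genid_kernel[OF \<psi>(1), of "m1 \<union> pd ` m1" 1] rhomD(1)[OF \<psi>(1)] by auto
qed

end

section \<open>From one order to the next, and the union over all orders\<close>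

lemma ideal_on_Int:
  assumes I: "ideal_on B I" and A: "sring A" "A \<subseteq> B"
  shows "ideal_on A (I \<inter> A)"
  unfolding ideal_on_def
proof (intro conjI ballI)
  show "0 \<in> I \<inter> A" using ideal_onD(3)[OF I] sringD(2)[OF A(1)] by simp
  show "x + y \<in> I \<inter> A" if "x \<in> I \<inter> A" "y \<in> I \<inter> A" for x y
    using that ideal_onD(4)[OF I] sringD(3)[OF A(1)] by simp
  show "a * x \<in> I \<inter> A" if "a \<in> A" "x \<in> I \<inter> A" for a x
    using that ideal_onD(5)[OF I subsetD[OF A(2)]] sringD(4)[OF A(1)] by simp
qed simp

lemma stable_Int: "stable F I \<Longrightarrow> stable F A \<Longrightarrow> stable F (I \<inter> A)"
  by (simp add: stable_def)

context sd_tower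
begin

lemma radical_on_Int:
  assumes "radical_on B m" "sring A" "A \<subseteq> B"
  shows "radical_on A (m \<inter> A)"
proof -
  have "ideal_on A (m \<inter> A)" using assms by (intro ideal_on_Int[of B]) (simp_all add: radical_on_def)
  moreover have "x \<in> m \<inter> A" if "x \<in> A" "x ^ n \<in> m \<inter> A" for x n
    using that assms by (auto simp: radical_on_def)
  ultimately show ?thesis unfolding radical_on_def by blast
qed

text \<open>The hypothesis on \<open>pd\<close> concerns elements of \<open>P r\<close> only; the
  derivatives of the remaining elements of \<open>M\<close> leave \<open>P (Suc r)\<close> and are
  adjoined as new relations of the next order.\<close>

lemma exists_next:
  assumes M: "max_stable_ideal F (P (Suc r)) M" and pdM: "\<And>x. x \<in> M \<Longrightarrow> x \<in> P r \<Longrightarrow> pd x \<in> M"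
  shows "\<exists>M'. max_stable_ideal F (P (Suc (Suc r))) M' \<and> M' \<inter> P (Suc r) = M \<and> (\<forall>x\<in>M. pd x \<in> M')"
proof -
  define B B' where "B = P (Suc r)" and "B' = P (Suc (Suc r))"
  have B: "sring B" "Set.range Cst \<subseteq> B" "stable F B" "B \<subseteq> B'" and B': "sring B'" "stable F B'"
    unfolding B_def B'_def by (rule P_facts)+
  have Mm: "ideal_on B M" "stable F M" "1 \<notin> M"
    and Mmax: "\<And>I. ideal_on B I \<Longrightarrow> stable F I \<Longrightarrow> M \<subseteq> I \<Longrightarrow> 1 \<notin> I \<Longrightarrow> I = M"
    using M unfolding max_stable_ideal_def B_def by blast+
  have rad: "radical_on B M" by (rule max_stable_ideal_radical[OF B(1-3) M[folded B_def]])
  have rad0: "radical_on (P r) (M \<inter> P r)" using radical_on_Int[OF rad P_facts(1)] P_facts(4) by (simp add: B_def)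
  define G where "G = genid B' (M \<union> pd ` M)"
  have MB: "M \<union> pd ` M \<subseteq> B'"
  proof -
    have "pd x \<in> B'" if "x \<in> M" for x
    proof -
      have "x \<in> vars_below (Suc r * N)" using that ideal_onD(2)[OF Mm(1)] by (simp add: B_def)
      from pd_below[OF this] show ?thesis by (simp add: B'_def add_ac)
    qed
    then show ?thesis using ideal_onD(1)[OF Mm(1)] B(4) by blast
  qed
  have G: "ideal_on B' G" unfolding G_def by (rule genid_ideal[OF B'(1) MB])
  have "1 \<notin> G" unfolding G_def B'_def
    by (rule prolong_proper[OF rad0 _ rad[unfolded B_def] Mm(3) refl]) (use Mm(3) pdM in auto)
  moreover have "stable F G" unfolding stable_def
  proof (intro ballI)
    fix f x assume f: "f \<in> F" and x: "x \<in> G"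
    have gens: "f g \<in> genid B' (M \<union> pd ` M)" if "g \<in> M \<union> pd ` M" for g
      using that Mm(2) f comm_pd[OF f] by (auto simp: stable_def intro!: genid.gen)
    have fB: "f a \<in> B'" if "a \<in> B'" for a using B'(2) f that by (auto simp: stable_def)
    show "f x \<in> G"
    proof (cases "f \<in> SS")
      case True
      then show ?thesis using genid_rhom[OF SS(1)[OF True] gens fB] x by (simp add: G_def)
    next
      case False
      then have "deriv f" using f DD by blast
      from genid_deriv[OF this gens fB] show ?thesis using x by (simp add: G_def)
    qed
  qed
  ultimately obtain M' where M': "max_stable_ideal F B' M'" "G \<subseteq> M'"
    using exists_max_stable_ideal[OF G] by blast
  have m': "ideal_on B' M'" "stable F M'" "1 \<notin> M'" using M' by (auto simp: max_stable_ideal_def)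
  have sub: "M \<subseteq> M'" "pd ` M \<subseteq> M'" using M'(2) unfolding G_def by (auto intro: genid.gen)
  have "M' \<inter> B = M"
  proof (rule Mmax)
    show "ideal_on B (M' \<inter> B)" by (rule ideal_on_Int[OF m'(1) B(1,4)])
    show "stable F (M' \<inter> B)" by (rule stable_Int[OF m'(2) B(3)])
    show "M \<subseteq> M' \<inter> B" using sub ideal_onD(1)[OF Mm(1)] by blast
  qed (use m' in auto)
  then show ?thesis using M' sub unfolding B_def B'_def by blast
qed

lemma exists_tower:
  assumes I0: "ideal_on (P 1) I0" "stable F I0" "1 \<notin> I0"
  shows "\<exists>m. max_stable_ideal F UNIV m \<and> I0 \<subseteq> m \<and> (\<forall>x\<in>m. pd x \<in> m) \<and>
    (\<forall>r. max_stable_ideal F (P (Suc r)) (m \<inter> P (Suc r)))"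
proof -
  define Inv where "Inv r M \<longleftrightarrow> max_stable_ideal F (P (Suc r)) M \<and> (r = 0 \<longrightarrow> I0 \<subseteq> M) \<and> (\<forall>x\<in>M \<inter> P r. pd x \<in> M)" for r M
  have "\<exists>f. \<forall>n. Inv n (f n) \<and> (f (Suc n) \<inter> P (Suc n) = f n \<and> (\<forall>x\<in>f n. pd x \<in> f (Suc n)))"
  proof (rule dependent_nat_choice)
    obtain M where M: "max_stable_ideal F (P 1) M" "I0 \<subseteq> M" using exists_max_stable_ideal[OF I0] by blast
    have m: "ideal_on (P 1) M" "1 \<notin> M" using M by (auto simp: max_stable_ideal_def)
    \<comment> \<open>The invariant starts trivially: \<open>P 0\<close> is the base field and meets
      a proper ideal only in 0.\<close>
    have "pd x \<in> M" if x: "x \<in> M" "x \<in> P 0" for x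
    proof -
      obtain a where a: "x = Cst a" using x by auto
      have "a = 0"
      proof (rule ccontr)
        assume "a \<noteq> 0"
        then have "Cst (inverse a) * x = 1" unfolding a by (simp flip: Cst_simps)
        moreover have "Cst (inverse a) * x \<in> M" by (rule ideal_onD(5)[OF m(1) Cst_in_vars_below x(1)])
        ultimately show False using m(2) by simp
      qed
      then show ?thesis using x by (simp add: a Cst_simps derivD[OF pd(1)])
    qed
    then show "\<exists>x. Inv 0 x" using M unfolding Inv_def by auto
    fix M n assume M: "Inv n M"
    then obtain M' where M': "max_stable_ideal F (P (Suc (Suc n))) M'" "M' \<inter> P (Suc n) = M" "\<forall>x\<in>M. pd x \<in> M'"
      using exists_next[of n M] unfolding Inv_def by blast
    then show "\<exists>y. Inv (Suc n) y \<and> y \<inter> P (Suc n) = M \<and> (\<forall>x\<in>M. pd x \<in> y)"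
      unfolding Inv_def by blast
  qed
  then obtain M where Inv: "\<And>n. Inv n (M n)" and int: "\<And>n. M (Suc n) \<inter> P (Suc n) = M n"
    and pdM: "\<And>n x. x \<in> M n \<Longrightarrow> pd x \<in> M (Suc n)" by blast
  have Mx: "max_stable_ideal F (P (Suc r)) (M r)" for r using Inv by (simp add: Inv_def)
  then have Mi: "ideal_on (P (Suc r)) (M r)" "stable F (M r)" "1 \<notin> M r" for r
    unfolding max_stable_ideal_def by blast+
  have mono: "M i \<subseteq> M j" if "i \<le> j" for i j
    using that by (induction rule: dec_induct) (use int in blast)+
  have Pmono: "P i \<subseteq> P j" if "i \<le> j" for i j using that by (intro vars_below_mono) simp
  define m where "m = (\<Union>r. M r)"
  have mint: "m \<inter> P (Suc r) = M r" for r
  proof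
    show "M r \<subseteq> m \<inter> P (Suc r)" using ideal_onD(1)[OF Mi(1)] by (auto simp: m_def)
    \<comment> \<open>Later stages add nothing in order \<open>r\<close>, as each contracts to the
      one before it.\<close>
    have "M j \<inter> P (Suc r) \<subseteq> M r" for j
    proof (cases "j \<le> r")
      case False
      then have "r \<le> j" by simp
      then show ?thesis
      proof (induction rule: dec_induct)
        case (step k)
        have "M (Suc k) \<inter> P (Suc r) \<subseteq> M (Suc k) \<inter> P (Suc k)" using Pmono[of "Suc r" "Suc k"] step by blast
        then show ?case using int[of k] step by blast
      qed simp
    qed (use mono[of j r] in blast)
    then show "m \<inter> P (Suc r) \<subseteq> M r" by (auto simp: m_def)
  qed
  have ex: "\<exists>r. x \<in> P (Suc r)" for x
  proof -
    obtain j where "x \<in> vars_below j" using in_some_vars_below by blast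
    moreover have "j \<le> Suc j * N" using N by (cases N) auto
    ultimately show ?thesis using vars_below_mono[of j "Suc j * N"] by blast
  qed
  have mi: "ideal_on UNIV m" unfolding ideal_on_def
  proof (intro conjI ballI)
    show "0 \<in> m" using ideal_onD(3)[OF Mi(1)] by (auto simp: m_def)
    show "x + y \<in> m" if xy: "x \<in> m" "y \<in> m" for x y
    proof -
      obtain i j where "x \<in> M i" "y \<in> M j" using xy by (auto simp: m_def)
      then have "x \<in> M (max i j)" "y \<in> M (max i j)" using mono[of i "max i j"] mono[of j "max i j"] by auto
      then show ?thesis using ideal_onD(4)[OF Mi(1)] by (auto simp: m_def)
    qed
    show "a * x \<in> m" if ax: "x \<in> m" for a x
    proof -
      obtain i j where ij: "x \<in> M i" "a \<in> P (Suc j)" using ax ex[of a] by (auto simp: m_def)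
      then have "x \<in> M (max i j)" "a \<in> P (Suc (max i j))"
        using mono[of i "max i j"] Pmono[of "Suc j" "Suc (max i j)"] by auto
      then show ?thesis using ideal_onD(5)[OF Mi(1)] unfolding m_def by blast
    qed
  qed auto
  \<comment> \<open>Maximality is tested level by level: a proper stable ideal above the union meets
    \<open>P (Suc r)\<close> in a proper stable ideal containing the maximal
    \<open>M r\<close>.\<close>
  have "I = m" if I: "ideal_on UNIV I" "stable F I" "m \<subseteq> I" "1 \<notin> I" for I
  proof -
    have "I \<inter> P (Suc r) = M r" for r
    proof -
      have "ideal_on (P (Suc r)) (I \<inter> P (Suc r))" by (rule ideal_on_Int[OF I(1) P_facts(1) subset_UNIV])
      moreover have "stable F (I \<inter> P (Suc r))" by (rule stable_Int[OF I(2) P_facts(3)])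
      moreover have "M r \<subseteq> I \<inter> P (Suc r)" using I(3) mint[of r] by blast
      moreover have "1 \<notin> I \<inter> P (Suc r)" using I(4) by blast
      ultimately show ?thesis using Mx[of r] unfolding max_stable_ideal_def by blast
    qed
    then show ?thesis using ex mint by blast
  qed
  moreover have "stable F m" using Mi(2) unfolding stable_def m_def by blast
  moreover have "1 \<notin> m" using Mi(3) by (auto simp: m_def)
  ultimately have "max_stable_ideal F UNIV m" using mi unfolding max_stable_ideal_def by blast
  moreover have "I0 \<subseteq> m" using Inv[of 0] by (auto simp: Inv_def m_def)
  moreover have "\<forall>x\<in>m. pd x \<in> m" using pdM by (auto simp: m_def)
  ultimately show ?thesis using mint Mx by auto
qed

end

section \<open>Constants of the quotient\<close>

text \<open>The assumption \<open>m_below\<close> keeps inverses of constants inside a finitely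
  generated ring, where points are available. The last assumption says that the automorphisms are
  onto on the base field, which is needed to pull back linear combinations.\<close>

locale sd_quotient = sd_tower +
  fixes m
  assumes m: "max_stable_ideal F UNIV m" and pd_m: "x \<in> m \<Longrightarrow> pd x \<in> m"
    and m_below: "max_stable_ideal F (P (Suc r)) (m \<inter> P (Suc r))"
    and SS_Cst: "s \<in> SS \<Longrightarrow> \<exists>b. s (Cst b) = Cst a"
begin

lemma m_ideal: "ideal_on UNIV m" "stable F m" "1 \<notin> m"
  using m by (auto simp: max_stable_ideal_def)

lemmas mI = ideal_onD[OF m_ideal(1)] ideal_on_diff[OF m_ideal(1) sring_UNIV]
  ideal_on_uminus[OF m_ideal(1) sring_UNIV] ideal_on_cancel[OF m_ideal(1) sring_UNIV]

lemma m_max: "ideal_on UNIV I \<Longrightarrow> stable F I \<Longrightarrow> m \<subseteq> I \<Longrightarrow> 1 \<notin> I \<Longrightarrow> I = m"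
  using m unfolding max_stable_ideal_def by blast

lemma m_radical: "radical_on UNIV m"
  by (rule max_stable_ideal_radical[OF _ _ _ m]) (auto simp: sring_UNIV stable_def)

lemma m_radicalD: "x ^ n \<in> m \<Longrightarrow> x \<in> m"
  using m_radical unfolding radical_on_def by blast

lemma m_stable: "f \<in> F \<Longrightarrow> x \<in> m \<Longrightarrow> f x \<in> m"
  using m_ideal(2) unfolding stable_def by blast

lemma in_some_P: "\<exists>r. x \<in> P (Suc r)"
proof -
  obtain j where "x \<in> vars_below j" using in_some_vars_below by blast
  moreover have "j \<le> Suc j * N" using N by (cases N) auto
  ultimately show ?thesis using vars_below_mono[of j "Suc j * N"] by blast
qed

definition const :: "'a mp \<Rightarrow> bool" where
  "const c \<longleftrightarrow> (\<forall>s\<in>SS. s c - c \<in> m) \<and> (\<forall>d\<in>DD. d c \<in> m)"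

text \<open>The multiples of a constant modulo \<open>m\<close> form a stable ideal, because an
  operator applied to \<open>b * c\<close> acts on \<open>b\<close> alone up to elements of
  \<open>m\<close>. Maximality within \<open>P (Suc r)\<close> yields an inverse of the same
  order.\<close>

lemma const_unit:
  assumes c: "const c" "c \<in> P (Suc r)" "c \<notin> m"
  shows "\<exists>b\<in>P (Suc r). b * c - 1 \<in> m"
proof -
  define B where "B = P (Suc r)"
  have B: "sring B" "stable F B" unfolding B_def by (rule P_facts)+
  note R = sringD[OF B(1)]
  have mB: "ideal_on B (m \<inter> B)" "stable F (m \<inter> B)"
    and max: "\<And>I. ideal_on B I \<Longrightarrow> stable F I \<Longrightarrow> m \<inter> B \<subseteq> I \<Longrightarrow> 1 \<notin> I \<Longrightarrow> I = m \<inter> B"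
    using m_below[of r] unfolding max_stable_ideal_def B_def by blast+
  have cB: "c \<in> B" using c by (simp add: B_def)
  define I where "I = {x \<in> B. \<exists>b\<in>B. x - b * c \<in> m}"
  have "ideal_on B I" unfolding ideal_on_def
  proof (intro conjI ballI)
    show "0 \<in> I" using R(2) mI(3) by (auto simp: I_def intro!: bexI[of _ 0])
    show "x + y \<in> I" if xy: "x \<in> I" "y \<in> I" for x y
    proof -
      obtain a b where ab: "a \<in> B" "b \<in> B" "x - a * c \<in> m" "y - b * c \<in> m" using xy by (auto simp: I_def)
      have "(x + y) - (a + b) * c = (x - a * c) + (y - b * c)" by (simp add: algebra_simps)
      also have "\<dots> \<in> m" by (rule mI(4)[OF ab(3,4)])
      finally show ?thesis using ab xy R(3) by (auto simp: I_def)
    qed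
    show "a * x \<in> I" if ax: "a \<in> B" "x \<in> I" for a x
    proof -
      obtain b where b: "b \<in> B" "x - b * c \<in> m" using ax by (auto simp: I_def)
      have "a * x - (a * b) * c = a * (x - b * c)" by (simp add: algebra_simps)
      also have "\<dots> \<in> m" by (rule mI(5)[OF UNIV_I b(2)])
      finally show ?thesis using ax b R(4) by (auto simp: I_def)
    qed
  qed (auto simp: I_def)
  moreover have "stable F I" unfolding stable_def
  proof (intro ballI)
    fix f x assume f: "f \<in> F" and x: "x \<in> I"
    obtain b where b: "b \<in> B" "x - b * c \<in> m" using x by (auto simp: I_def)
    have fB: "f x \<in> B" "f b \<in> B" using B(2) f x b by (auto simp: stable_def I_def)
    have fm: "f (x - b * c) \<in> m" by (rule m_stable[OF f b(2)])
    have "f x - f b * c \<in> m"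
    proof (cases "f \<in> SS")
      case True
      note h = rhomD[OF SS(1)[OF True]]
      have "f x - f b * c = f (x - b * c) + f b * (f c - c)" by (simp add: h algebra_simps)
      also have "\<dots> \<in> m" using c(1) True by (intro mI(4)[OF fm] mI(5)) (auto simp: const_def)
      finally show ?thesis .
    next
      case False
      then have d: "f \<in> DD" "deriv f" using f DD by auto
      have "f x - f b * c = f (x - b * c) + b * f c" by (simp add: derivD[OF d(2)] algebra_simps)
      also have "\<dots> \<in> m" using c(1) d(1) by (intro mI(4)[OF fm] mI(5)) (auto simp: const_def)
      finally show ?thesis .
    qed
    then show "f x \<in> I" using fB by (auto simp: I_def)
  qed
  moreover have "m \<inter> B \<subseteq> I" using R(2) by (auto simp: I_def intro!: bexI[of _ 0])
  moreover have "c \<in> I" using cB R(1) mI(3) by (auto simp: I_def intro!: bexI[of _ 1])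
  ultimately have "1 \<in> I" using max[of I] c(3) by blast
  then obtain b where b: "b \<in> B" "1 - b * c \<in> m" by (auto simp: I_def)
  then show ?thesis using mI(8)[OF b(2)] by (auto simp: B_def)
qed

section \<open>Values at points and algebraicity of constants\<close>

definition algebraic_mod :: "'a mp set \<Rightarrow> 'a mp \<Rightarrow> bool" where
  "algebraic_mod Q x \<longleftrightarrow> (\<exists>p\<in>polys_over (Set.range Cst). poly p x \<in> Q \<and> p \<notin> polys_over Q)"

abbreviation point :: "nat \<Rightarrow> 'a mp set \<Rightarrow> ('a mp \<Rightarrow> 'a alg_closure) \<Rightarrow> bool" where
  "point j Q g \<equiv> fhom (vars_below j) Q g \<and> (\<forall>a. g (Cst a) = to_ac a)"

lemma map_poly_cval_nonzero:
  assumes Q: "prime_on UNIV Q" and p: "p \<in> polys_over (Set.range Cst)" "p \<notin> polys_over Q"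
  shows "map_poly cval p \<noteq> 0"
proof -
  obtain i where i: "coeff p i \<notin> Q" using p(2) by (auto simp: polys_over_def)
  obtain a where a: "coeff p i = Cst a" using p(1) by (force simp: polys_over_def)
  have "a \<noteq> 0" using i ideal_onD(3)[OF prime_onD(2)[OF Q]] by (auto simp: a Cst_simps)
  then have "coeff (map_poly cval p) i \<noteq> 0" using cval_Cst[of 0] by (simp add: coeff_map_poly a cval_Cst Cst_simps)
  then show ?thesis by auto
qed

text \<open>Adjoining \<open>x\<close> before the variables makes its value \<open>l\<close> free. A
  point of \<open>adjoin K x\<close> then extends to the variables unless \<open>l\<close> is a root
  of the nonzero polynomial behind the open condition.\<close>

lemma transcendental_values:
  assumes Q: "prime_on UNIV Q" and x: "\<not> algebraic_mod Q x"
  shows "finite {l. \<not> (\<exists>g. point j Q g \<and> g x = l)}"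
proof -
  define K where "K = Set.range (Cst :: 'a \<Rightarrow> _)"
  have K: "sring K" unfolding K_def by (rule sring_Cst)
  define A where "A = adjoin K x"
  have A: "sring A" "K \<subseteq> A" unfolding A_def using adjoin_sring[OF K] adjoin_subset[OF K] by auto
  \<comment> \<open>The element 1 is chosen because only existence of an extension matters, not a
    nonzero value somewhere.\<close>
  have "1 \<in> adjoins A Var j" "1 \<notin> Q" using sringD(1)[OF adjoins_sring[OF A(1)]] prime_onD[OF Q] by auto
  from fhom_extend_adjoins[OF Q A(1) subset_UNIV UNIV_I this, where 'o="'a alg_closure"]
  obtain a where a: "a \<in> A" "a \<notin> Q" "\<And>f :: 'a mp \<Rightarrow> 'a alg_closure. fhom A Q f \<Longrightarrow> f a \<noteq> 0 \<Longrightarrow>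
      \<exists>g. fhom (adjoins A Var j) Q g \<and> (\<forall>x\<in>A. g x = f x)" by blast
  obtain p where p: "p \<in> polys_over K" "a = poly p x" using a(1) by (auto simp: A_def adjoin_def)
  have pQ: "p \<notin> polys_over Q"
    using poly_in_ideal[OF prime_onD(2,1)[OF Q], of p x] a(2) p(2) by auto
  have nz: "map_poly cval p \<noteq> 0" using map_poly_cval_nonzero[OF Q] p(1) pQ by (auto simp: K_def)
  have cv: "fhom K Q cval" unfolding K_def by (rule cval_fhom[OF Q]) simp
  have "\<exists>g. point j Q g \<and> g x = l" if l: "poly (map_poly cval p) l \<noteq> 0" for l
  proof -
    have "poly (map_poly cval q) l = 0" if q: "q \<in> polys_over K" "poly q x \<in> Q" for q
    proof -
      have "q \<in> polys_over Q" using x q unfolding algebraic_mod_def K_def by blast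
      then show ?thesis using map_poly_fhom(5)[OF K cv] q by simp
    qed
    from fhom_extend[OF K cv ideal_onD(3)[OF prime_onD(2)[OF Q]] this] obtain f where
      f: "fhom A Q f" "\<forall>y\<in>K. f y = cval y" "f x = l" "\<forall>p\<in>polys_over K. f (poly p x) = poly (map_poly cval p) l"
      unfolding A_def by blast
    have "f a \<noteq> 0" using f(4) p l by simp
    from a(3)[OF f(1) this] obtain g where g: "fhom (adjoins A Var j) Q g" "\<forall>y\<in>A. g y = f y" by blast
    have "fhom (vars_below j) Q g" using fhom_mono[OF g(1) adjoins_mono_base[OF A(2)]] by (simp add: K_def)
    moreover have "g (Cst b) = to_ac b" for b
    proof -
      have "Cst b \<in> K" by (simp add: K_def)
      then show ?thesis using g(2) f(2) A(2) by (simp add: subset_iff cval_Cst)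
    qed
    moreover have "g x = l" using g(2) f(3) adjoin_gen[OF K] by (simp add: A_def)
    ultimately show ?thesis by blast
  qed
  then have "{l. \<not> (\<exists>g. point j Q g \<and> g x = l)} \<subseteq> {l. poly (map_poly cval p) l = 0}" by blast
  then show ?thesis using poly_roots_finite[OF nz] by (rule finite_subset)
qed

lemma algebraic_values:
  assumes Q: "prime_on UNIV Q" and x: "algebraic_mod Q x" "x \<in> vars_below j"
  shows "finite {g x | g. point j Q g}"
proof -
  obtain p where p: "p \<in> polys_over (Set.range Cst)" "poly p x \<in> Q" "p \<notin> polys_over Q"
    using x unfolding algebraic_mod_def by blast
  have "poly (map_poly cval p) (g x) = 0" if g: "point j Q g" for g
  proof -
    have "Set.range Cst \<subseteq> vars_below j" using Cst_in_vars_below by blast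
    then have pj: "p \<in> polys_over (vars_below j)" using p(1) by (rule polys_over_mono)
    have "g 0 = 0" using g fhom_0[OF _ vars_below_sring] by blast
    moreover have "cval 0 = 0" using cval_Cst[of 0] by (simp add: Cst_simps)
    moreover have "g (coeff p i) = cval (coeff p i)" for i
    proof -
      obtain a where "coeff p i = Cst a" using p(1) by (force simp: polys_over_def)
      then show ?thesis using g by (simp add: cval_Cst)
    qed
    ultimately have "map_poly g p = map_poly cval p" by (intro poly_eqI) (simp add: coeff_map_poly)
    then have "poly (map_poly cval p) (g x) = g (poly p x)"
      using poly_map_poly_fhom[OF vars_below_sring conjunct1[OF g] pj x(2)] by simp
    also have "\<dots> = 0" using fhomD(4)[OF conjunct1[OF g] poly_in_sring[OF vars_below_sring pj x(2)] p(2)] .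
    finally show ?thesis .
  qed
  then have "{g x | g. point j Q g} \<subseteq> {l. poly (map_poly cval p) l = 0}" by blast
  then show ?thesis using poly_roots_finite[OF map_poly_cval_nonzero[OF Q p(1,3)]] by (rule finite_subset)
qed

lemma const_diff_of_nat:
  assumes c: "const c"
  shows "const (c - of_nat k)"
  unfolding const_def
proof (intro conjI ballI)
  fix s assume s: "s \<in> SS"
  have "s (of_nat k) = of_nat k"
    by (induction k) (simp_all add: rhomD[OF SS(1)[OF s]])
  then show "s (c - of_nat k) - (c - of_nat k) \<in> m"
    using c s by (simp add: const_def rhomD[OF SS(1)[OF s]])
next
  fix d assume d: "d \<in> DD"
  have "d (of_nat k) = 0"
    by (induction k) (simp_all add: derivD[OF DD(1)[OF d]])
  then show "d (c - of_nat k) \<in> m"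
    using c d by (simp add: const_def derivD[OF DD(1)[OF d]])
qed

text \<open>If \<open>c\<close> were transcendental, almost every value could be assigned to it by a point of the
  finitely generated algebra \<open>P (Suc r)\<close>, but \<open>c - k\<close> is a unit for all integers \<open>k\<close>.\<close>

lemma const_algebraic:
  assumes Q: "prime_on UNIV Q" "m \<subseteq> Q" and c: "const c"
  shows "algebraic_mod Q c"
proof (rule ccontr)
  assume nc: "\<not> algebraic_mod Q c"
  obtain r where r: "c \<in> P (Suc r)" using in_some_P by blast
  define B where "B = P (Suc r)"
  have B: "sring B" unfolding B_def by (rule P_facts)
  define S where "S = {l. \<not> (\<exists>g. point (Suc r * N) Q g \<and> g c = l)}"
  have "finite S" unfolding S_def by (rule transcendental_values[OF Q(1) nc])
  moreover have "infinite (Set.range (of_nat :: nat \<Rightarrow> 'a alg_closure))"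
    by (rule range_inj_infinite) (simp add: inj_on_def)
  ultimately have "\<not> Set.range (of_nat :: nat \<Rightarrow> 'a alg_closure) \<subseteq> S" using finite_subset by blast
  then obtain k where "(of_nat k :: 'a alg_closure) \<notin> S" by blast
  then have "\<exists>g. point (Suc r * N) Q g \<and> g c = of_nat k" unfolding S_def by (simp only: mem_Collect_eq not_not)
  then obtain g where g: "point (Suc r * N) Q g" "g c = of_nat k" by blast
  define x where "x = c - of_nat k"
  have kB: "of_nat k \<in> B" "x \<in> B" unfolding x_def using sring_of_nat[OF B] sringD(6)[OF B] r by (auto simp: B_def)
  have gB: "fhom B Q g" using g by (simp add: B_def)
  have gk: "g (of_nat k) = of_nat k" using g(1) by (simp flip: Cst_of_nat)
  then have gx: "g x = 0" using fhom_diff[OF gB B, of c "of_nat k"] g(2) r kB by (simp add: x_def B_def)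
  \<comment> \<open>Otherwise \<open>c\<close> would be algebraic after all, as a root of a monic
    linear polynomial.\<close>
  have "x \<notin> m"
  proof
    assume "x \<in> m"
    then have xQ: "x \<in> Q" using Q(2) by blast
    have "[:- of_nat k, 1:] \<in> polys_over (Set.range Cst)"
      by (intro polys_over_closed(1,8)[OF sring_Cst] sringD(1,5)[OF sring_Cst] sring_of_nat[OF sring_Cst])
    moreover have "[:- of_nat k, 1:] \<notin> polys_over Q"
      using polys_over_coeff[of "[:- of_nat k, 1:]" Q 1] prime_onD(3)[OF Q(1)] by auto
    ultimately show False using nc xQ unfolding algebraic_mod_def x_def by (force simp: algebra_simps)
  qed
  then obtain b where b: "b \<in> B" "b * x - 1 \<in> m"
    using const_unit[OF const_diff_of_nat[OF c], of k r] kB by (auto simp: x_def B_def)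
  have bxB: "b * x \<in> B" "1 \<in> B" using sringD[OF B] b kB by auto
  have "g (b * x - 1) = 0"
    by (rule fhomD(4)[OF gB sringD(6)[OF B bxB]]) (use b Q in auto)
  then show False using fhom_diff[OF gB B bxB] fhomD(3)[OF gB b(1) kB(2)] fhomD(1)[OF gB] gx by simp
qed

text \<open>The span of the constants over the base field. Dependence is bounded for this span
  first, since the linear combinations formed in \<open>dep_add\<close> stay in it but need not be
  constants.\<close>

inductive_set W where
  "const c \<Longrightarrow> Cst a * c \<in> W"
| "v \<in> W \<Longrightarrow> w \<in> W \<Longrightarrow> v + w \<in> W"

text \<open>Having finitely many values at points is visibly inherited by sums, unlike algebraicity.
  \<open>W_algebraic\<close> translates back: a transcendental element would take almost all values
  in an infinite field.\<close>

lemma W_values: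
  assumes Q: "prime_on UNIV Q" "m \<subseteq> Q"
  shows "w \<in> W \<Longrightarrow> \<exists>i. \<forall>j\<ge>i. w \<in> vars_below j \<and> finite {g w | g. point j Q g}"
proof (induction rule: W.induct)
  case (1 c a)
  obtain i where i: "c \<in> vars_below i" using in_some_vars_below by blast
  have "Cst a * c \<in> vars_below j \<and> finite {g (Cst a * c) | g. point j Q g}" if j: "i \<le> j" for j
  proof
    have cj: "c \<in> vars_below j" using vars_below_mono[OF j] i by auto
    show "Cst a * c \<in> vars_below j" by (rule sringD(4)[OF vars_below_sring Cst_in_vars_below cj])
    have "g (Cst a * c) = to_ac a * g c" if "point j Q g" for g
      using fhomD(3)[OF conjunct1[OF that] Cst_in_vars_below cj] that by simp
    then have "{g (Cst a * c) | g. point j Q g} \<subseteq> (\<lambda>l. to_ac a * l) ` {g c | g. point j Q g}" by blast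
    then show "finite {g (Cst a * c) | g. point j Q g}"
      using algebraic_values[OF Q(1) const_algebraic[OF Q 1] cj] by (meson finite_imageI finite_subset)
  qed
  then show ?case by blast
next
  case (2 v w)
  then obtain i1 i2 where i: "\<forall>j\<ge>i1. v \<in> vars_below j \<and> finite {g v | g. point j Q g}"
    "\<forall>j\<ge>i2. w \<in> vars_below j \<and> finite {g w | g. point j Q g}" by blast
  have "v + w \<in> vars_below j \<and> finite {g (v + w) | g. point j Q g}" if j: "max i1 i2 \<le> j" for j
  proof
    have vw: "v \<in> vars_below j" "w \<in> vars_below j" "finite {g v | g. point j Q g}" "finite {g w | g. point j Q g}"
      using i j by auto
    show "v + w \<in> vars_below j" by (rule sringD(3)[OF vars_below_sring vw(1,2)])
    have add: "g (v + w) = g v + g w" if "point j Q g" for g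
      using fhomD(2)[OF conjunct1[OF that] vw(1,2)] .
    have "{g (v + w) | g. point j Q g} \<subseteq> (\<lambda>(k, l). k + l) ` ({g v | g. point j Q g} \<times> {g w | g. point j Q g})"
      (is "?L \<subseteq> ?R")
    proof
      fix l assume "l \<in> ?L"
      then obtain g where g: "point j Q g" "l = g (v + w)" by blast
      then have "l = g v + g w" using add[OF g(1)] by simp
      then show "l \<in> ?R" using g(1) by (intro image_eqI[of _ _ "(g v, g w)"]) auto
    qed
    then show "finite {g (v + w) | g. point j Q g}" using vw(3,4) by (meson finite_imageI finite_SigmaI finite_subset)
  qed
  then show ?case by blast
qed

lemma W_algebraic:
  assumes Q: "prime_on UNIV Q" "m \<subseteq> Q" and w: "w \<in> W"
  shows "algebraic_mod Q w"
proof (rule ccontr)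
  assume nw: "\<not> algebraic_mod Q w"
  obtain j where "finite {g w | g. point j Q g}" using W_values[OF Q w] by blast
  from finite_UnI[OF this transcendental_values[OF Q(1) nw, of j]]
  have "finite (UNIV :: 'a alg_closure set)" by (rule finite_subset[rotated]) auto
  then show False using infinite_UNIV_char_0 by contradiction
qed

text \<open>An element algebraic over the base field modulo \<open>Q\<close> and not in
  \<open>Q\<close> has a minimal relation with nonzero constant term, which is incompatible with the
  value 0. So points are injective on \<open>W\<close> modulo \<open>Q\<close>.\<close>

lemma W_kernel:
  assumes Q: "prime_on UNIV Q" "m \<subseteq> Q" and w: "w \<in> W" "w \<in> vars_below j" and g: "point j Q g" "g w = 0"
  shows "w \<in> Q"
proof (rule ccontr)
  assume wQ: "w \<notin> Q"
  let ?K = "Set.range (Cst :: 'a \<Rightarrow> _)"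
  note B = prime_onD[OF Q(1)]
  obtain h where h: "min_rel ?K Q w h"
    using W_algebraic[OF Q w(1)] exists_min_rel[OF Q(1) sring_Cst subset_UNIV UNIV_I] unfolding algebraic_mod_def by blast
  have hK: "h \<in> polys_over ?K" "poly h w \<in> Q" using h by (auto simp: min_rel_def)
  obtain c q where cq: "h = pCons c q" by (cases h)
  obtain a where a: "c = Cst a" using polys_over_coeff[OF hK(1), of 0] by (auto simp: cq)
  have qK: "q \<in> polys_over ?K" using polys_over_coeff[OF hK(1), of "Suc i" for i] by (auto simp: cq polys_over_def)
  \<comment> \<open>A zero constant term would allow cancelling \<open>w\<close>, leaving
    \<open>q\<close> as a relation of smaller degree.\<close>
  have "a \<noteq> 0"
  proof
    assume "a = 0"
    then have "w * poly q w \<in> Q" using hK(2) by (simp add: cq a Cst_simps)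
    then have "poly q w \<in> Q" using B(4)[of w "poly q w"] wQ by blast
    moreover have "Polynomial.degree q < Polynomial.degree h" using min_rel_degree[OF h] by (auto simp: cq split: if_splits)
    ultimately have "q \<in> polys_over Q" using h qK unfolding min_rel_def by blast
    moreover have "lead_coeff h = lead_coeff q" using min_rel_degree[OF h] by (auto simp: cq split: if_splits)
    ultimately show False using h by (auto simp: min_rel_def polys_over_def)
  qed
  have sub: "?K \<subseteq> vars_below j" using Cst_in_vars_below by blast
  have qj: "poly q w \<in> vars_below j" by (rule poly_in_sring[OF vars_below_sring polys_over_mono[OF sub qK] w(2)])
  have wq: "w * poly q w \<in> vars_below j" by (rule sringD(4)[OF vars_below_sring w(2) qj])
  have "g (poly h w) = to_ac a + g w * g (poly q w)"
    using fhomD(2)[OF conjunct1[OF g(1)] Cst_in_vars_below wq, of a]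
      fhomD(3)[OF conjunct1[OF g(1)] w(2) qj] g(1) by (simp add: cq a)
  moreover have "g (poly h w) = 0"
    by (rule fhomD(4)[OF conjunct1[OF g(1)] poly_in_sring[OF vars_below_sring polys_over_mono[OF sub hK(1)] w(2)] hK(2)])
  ultimately show False using g(2) \<open>a \<noteq> 0\<close> by simp
qed

end

section \<open>Free and linear variables modulo a minimal prime, and its annihilator\<close>

locale sd_quotient_prime = sd_quotient +
  fixes Q
  assumes Q: "min_prime UNIV m Q"
begin

lemma Q_prime: "prime_on UNIV Q" and m_Q: "m \<subseteq> Q" and Q_ann: "x \<in> Q \<Longrightarrow> \<exists>t. t \<notin> Q \<and> t * x \<in> m"
  using Q by (auto simp: min_prime_def)

lemmas QI = ideal_onD[OF prime_onD(2)[OF Q_prime]]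

lemma Q_mult: "x \<notin> Q \<Longrightarrow> y \<notin> Q \<Longrightarrow> x * y \<notin> Q"
  using prime_onD(4)[OF Q_prime] by blast

lemma pd_annihilator: "t * x \<in> m \<Longrightarrow> t * pd x \<in> m"
  using deriv_annihilator[OF sring_UNIV subset_UNIV m_ideal(1) pd(1) UNIV_I pd_m m_radical UNIV_I UNIV_I, of x t]
  by (simp add: mult.commute)

definition rel :: "nat \<Rightarrow> 'a mp poly \<Rightarrow> bool" where
  "rel j h \<longleftrightarrow> min_rel (vars_below j) Q (Var j) h"

text \<open>\<open>Var j\<close> is transcendental modulo \<open>Q\<close> over the preceding
  variables.\<close>

definition free :: "nat \<Rightarrow> bool" where
  "free j \<longleftrightarrow> (\<forall>p\<in>polys_over (vars_below j). poly p (Var j) \<in> Q \<longrightarrow> p \<in> polys_over Q)"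

lemma free_or_rel: "free j \<or> (\<exists>h. rel j h)"
  unfolding free_def rel_def using exists_min_rel[OF Q_prime vars_below_sring subset_UNIV UNIV_I] by blast

text \<open>The relation is required modulo \<open>m\<close>, not just modulo \<open>Q\<close>. This
  keeps the annihilator from acquiring new factors as \<open>j\<close> grows.\<close>

definition linear :: "'a mp \<Rightarrow> nat \<Rightarrow> bool" where
  "linear s j \<longleftrightarrow> (\<exists>w\<in>vars_below j. s * Var j + w \<in> m)"

text \<open>Differentiating an algebraic relation for \<open>Var j\<close> yields linear relations, all with the same
  leading coefficient, for the higher derivatives of \<open>Var j\<close>.\<close>

lemma linear_derivatives:
  assumes h: "rel j h"
  shows "\<exists>J s. s \<notin> Q \<and> s \<in> vars_below J \<and> (\<forall>k\<ge>J. k mod N = j mod N \<longrightarrow> linear s k)"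
proof -
  define u where "u = (Var j :: 'a mp)"
  define S where "S = poly (pderiv h) u"
  have h': "min_rel (vars_below j) Q u h" using h by (simp add: rel_def u_def)
  have hA: "h \<in> polys_over (vars_below j)" "poly h u \<in> Q" using h' by (auto simp: min_rel_def)
  have SQ: "S \<notin> Q" unfolding S_def
    by (rule separant_notin[OF Q_prime vars_below_sring subset_UNIV UNIV_I h'])
  have uj: "u \<in> vars_below (Suc j)" by (simp add: u_def Var_in_vars_below del: adjoins.simps)
  have jm: "vars_below j \<subseteq> vars_below (Suc j)" by (rule vars_below_mono) simp
  have Sj: "S \<in> vars_below (Suc j)" unfolding S_def
    by (intro poly_in_sring[OF vars_below_sring _ uj] polys_over_pderiv[OF vars_below_sring] polys_over_mono[OF jm hA(1)])
  obtain t where t: "t \<notin> Q" "t * poly h u \<in> m" using Q_ann hA(2) by blast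
  \<comment> \<open>By \<open>pd_annihilator\<close> the relation is differentiated behind the
    factor \<open>t\<close>, which stays unchanged; and since the relation is already linear in its
    top variable, the separant \<open>S\<close> remains the leading coefficient.\<close>
  have step: "\<exists>w\<in>vars_below (j + Suc i * N). t * (S * Var (j + Suc i * N) + w) \<in> m" for i
  proof (induction i)
    case 0
    define w where "w = poly (map_poly pd h) u"
    have "pd c \<in> vars_below (j + N)" if "c \<in> vars_below j" for c using pd_below that by blast
    then have "map_poly pd h \<in> polys_over (vars_below (j + N))"
      using hA(1) derivD(3)[OF pd(1)] by (auto simp: polys_over_def coeff_map_poly)
    moreover have "u \<in> vars_below (j + N)" using N by (simp add: u_def Var_in_vars_below)
    ultimately have "w \<in> vars_below (j + N)" unfolding w_def by (intro poly_in_sring[OF vars_below_sring])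
    moreover have "pd (poly h u) = S * Var (j + N) + w"
      unfolding deriv_poly[OF pd(1)] by (simp add: w_def S_def u_def pd)
    ultimately show ?case using pd_annihilator[OF t(2)] by auto
  next
    case (Suc i)
    then obtain w where w: "w \<in> vars_below (j + Suc i * N)" "t * (S * Var (j + Suc i * N) + w) \<in> m" by blast
    define V where "V = (Var (j + Suc i * N) :: 'a mp)"
    define w' where "w' = pd S * V + pd w"
    have e: "j + Suc (Suc i) * N = j + Suc i * N + N" by simp
    have "pd (S * V + w) = S * Var (j + Suc (Suc i) * N) + w'"
      by (simp add: V_def w'_def derivD[OF pd(1)] pd algebra_simps)
    moreover have "w' \<in> vars_below (j + Suc (Suc i) * N)"
    proof -
      have "pd S \<in> vars_below (Suc j + N)" by (rule pd_below[OF Sj])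
      moreover have "Suc j + N \<le> j + Suc (Suc i) * N" using N by simp
      ultimately have "pd S \<in> vars_below (j + Suc (Suc i) * N)" using vars_below_mono by blast
      moreover have "V \<in> vars_below (j + Suc (Suc i) * N)" unfolding V_def
        using N by (intro Var_in_vars_below) simp
      moreover have "pd w \<in> vars_below (j + Suc (Suc i) * N)" unfolding e by (rule pd_below[OF w(1)])
      ultimately show ?thesis unfolding w'_def by (intro sringD(3,4)[OF vars_below_sring])
    qed
    ultimately show ?case using pd_annihilator[OF w(2)] unfolding V_def by metis
  qed
  obtain J0 where J0: "{t, S} \<subseteq> vars_below J0" using finite_in_some_vars_below[of "{t, S}"] by auto
  define J where "J = max J0 (j + N)"
  have tS: "t \<in> vars_below k" "S \<in> vars_below k" if "J \<le> k" for k
    using J0 vars_below_mono[of J0 k] that by (auto simp: J_def)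
  have "linear (t * S) k" if k: "J \<le> k" "k mod N = j mod N" for k
  proof -
    have kj: "j + N \<le> k" using k(1) by (simp add: J_def)
    then have "N dvd k - j" using k(2) by (metis add_leD1 mod_eq_dvd_iff_nat)
    then obtain i where i: "k - j = N * i" by (auto simp: dvd_def)
    have "i \<noteq> 0" using i kj N by (cases "i = 0") auto
    then obtain i' where i': "i = Suc i'" by (cases i) auto
    have kk: "k = j + Suc i' * N" using i kj by (simp add: i' mult.commute)
    obtain w where w: "w \<in> vars_below k" "t * (S * Var k + w) \<in> m" using step[of i'] unfolding kk by blast
    then have "t * S * Var k + t * w \<in> m" by (simp add: algebra_simps)
    moreover have "t * w \<in> vars_below k" by (rule sringD(4)[OF vars_below_sring tS(1)[OF k(1)] w(1)])
    ultimately show ?thesis unfolding linear_def by blast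
  qed
  moreover have "t * S \<in> vars_below J" by (rule sringD(4)[OF vars_below_sring tS[OF order_refl]])
  ultimately show ?thesis using Q_mult[OF t(1) SQ] by blast
qed

lemma linear_multiple:
  assumes "linear s k" "r \<in> vars_below k"
  shows "linear (s * r) k"
proof -
  obtain w where w: "w \<in> vars_below k" "s * Var k + w \<in> m" using assms by (auto simp: linear_def)
  have "s * r * Var k + r * w = r * (s * Var k + w)" by (simp add: algebra_simps)
  also have "\<dots> \<in> m" by (rule mI(5)[OF UNIV_I w(2)])
  finally show ?thesis unfolding linear_def using sringD(4)[OF vars_below_sring assms(2) w(1)] by blast
qed

text \<open>The indices in one residue class modulo \<open>N\<close> are the derivatives of one
  generator. Either all of them are free, or one algebraic index makes all large ones linear. The
  product over the finitely many classes of their leading coefficients serves all of them at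
  once.\<close>

lemma tail:
  "\<exists>J s. s \<notin> Q \<and> s \<in> vars_below J \<and> (\<forall>k\<ge>J. free k \<or> linear s k)"
proof -
  have "\<exists>J s. s \<notin> Q \<and> s \<in> vars_below J \<and> (\<forall>k\<ge>J. k mod N < a \<longrightarrow> free k \<or> linear s k)" for a
  proof (induction a)
    case 0
    then show ?case using prime_onD(3)[OF Q_prime] sringD(1)[OF vars_below_sring] by blast
  next
    case (Suc a)
    then obtain J s where Js: "s \<notin> Q" "s \<in> vars_below J" "\<forall>k\<ge>J. k mod N < a \<longrightarrow> free k \<or> linear s k" by blast
    show ?case
    proof (cases "\<exists>j. j mod N = a \<and> \<not> free j")
      case True
      then obtain j h where j: "j mod N = a" "rel j h" using free_or_rel by blast
      from linear_derivatives[OF j(2)] obtain J' s' where Js': "s' \<notin> Q" "s' \<in> vars_below J'"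
        "\<forall>k\<ge>J'. k mod N = j mod N \<longrightarrow> linear s' k" by blast
      have below: "s \<in> vars_below k" "s' \<in> vars_below k" if "max J J' \<le> k" for k
        using Js(2) Js'(2) vars_below_mono[of J k] vars_below_mono[of J' k] that by auto
      have "free k \<or> linear (s * s') k" if k: "max J J' \<le> k" "k mod N < Suc a" for k
      proof (cases "k mod N = a")
        case True
        then have "linear s' k" using Js'(3) k j by simp
        from linear_multiple[OF this below(1)[OF k(1)]] show ?thesis by (simp add: mult.commute)
      next
        case False
        then have "k mod N < a" using k by simp
        then have "free k \<or> linear s k" using Js(3) k by simp
        then show ?thesis using linear_multiple[OF _ below(2)[OF k(1)]] by blast
      qed
      moreover have "s * s' \<in> vars_below (max J J')"
        by (rule sringD(4)[OF vars_below_sring below[OF order_refl]])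
      ultimately show ?thesis using Q_mult[OF Js(1) Js'(1)] by blast
    next
      case False
      then show ?thesis using Js less_SucE by metis
    qed
  qed
  from this[of N] show ?thesis using N by simp
qed

text \<open>The power \<open>Suc k\<close> of the claimed element is a multiple of the given one,
  and \<open>m\<close> is radical. Pseudo-division therefore costs the annihilator a single factor
  \<open>c\<close>, whatever the exponent.\<close>

lemma m_cancel_power: "(s * c) * x \<in> m \<Longrightarrow> c ^ k * y = x \<Longrightarrow> s * c * y \<in> m"
proof -
  assume a: "(s * c) * x \<in> m" and x: "c ^ k * y = x"
  have "(s * c * y) ^ Suc k = (s ^ k * y ^ k) * (s * c * x)" unfolding x[symmetric]
    by (simp add: power_mult_distrib algebra_simps)
  also have "\<dots> \<in> m" by (rule mI(5)[OF UNIV_I a])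
  finally show ?thesis by (rule m_radicalD)
qed

text \<open>An element of \<open>Q\<close> has all its coefficients in \<open>Q\<close> when the top
  variable is free, so the old annihilator still works.\<close>

lemma annihilator_free:
  assumes "free j" "\<And>x. x \<in> vars_below j \<Longrightarrow> x \<in> Q \<Longrightarrow> s * x \<in> m"
    "x \<in> vars_below (Suc j)" "x \<in> Q"
  shows "s * x \<in> m"
proof -
  obtain p where p: "p \<in> polys_over (vars_below j)" "x = poly p (Var j)"
    using assms(3) by (auto simp: adjoin_def)
  then have "p \<in> polys_over Q" using assms(1,4) by (auto simp: free_def)
  then have "smult s p \<in> polys_over m" using assms(2) p(1) by (auto simp: polys_over_def)
  from poly_in_ideal[OF m_ideal(1) sring_UNIV this UNIV_I] show ?thesis by (simp add: p(2))
qed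

text \<open>An algebraic variable adds two factors: \<open>t\<close>, which puts the minimal
  relation into \<open>m\<close>, and the leading coefficient, which pays for pseudo-division by
  that relation.\<close>

lemma annihilator_rel:
  assumes h: "min_rel (vars_below j) Q (Var j) h" "t * poly h (Var j) \<in> m"
    and s: "\<And>x. x \<in> vars_below j \<Longrightarrow> x \<in> Q \<Longrightarrow> s * x \<in> m"
    and x: "x \<in> vars_below (Suc j)" "x \<in> Q"
  shows "s * t * lead_coeff h * x \<in> m"
proof -
  obtain g where g: "g \<in> polys_over (vars_below j)" "x = poly g (Var j)"
    using x(1) by (auto simp: adjoin_def)
  define b where "b = lead_coeff h"
  obtain k q r where *: "r \<in> polys_over (vars_below j)" "r \<in> polys_over Q" "smult (b ^ k) g = q * h + r"
    using min_rel_division[OF Q_prime vars_below_sring subset_UNIV UNIV_I h(1) g(1)] x(2) g(2) unfolding b_def by blast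
  have "smult s r \<in> polys_over m" using s *(1,2) by (auto simp: polys_over_def)
  from poly_in_ideal[OF m_ideal(1) sring_UNIV this UNIV_I, of "Var j"]
  have r: "s * poly r (Var j) \<in> m" by simp
  have "b ^ k * x = poly q (Var j) * poly h (Var j) + poly r (Var j)"
    using arg_cong[OF *(3), of "\<lambda>p. poly p (Var j)"] by (simp add: g(2))
  then have "s * t * b * (b ^ k * x) = (s * b * poly q (Var j)) * (t * poly h (Var j)) + (t * b) * (s * poly r (Var j))"
    by (simp add: algebra_simps)
  also have "\<dots> \<in> m" by (rule mI(4)[OF mI(5)[OF UNIV_I h(2)] mI(5)[OF UNIV_I r]])
  finally show ?thesis using m_cancel_power[of "s * t" b "b ^ k * x" k x] by (simp add: b_def)
qed

lemma finite_annihilator: "\<exists>s. s \<notin> Q \<and> (\<forall>x\<in>vars_below j. x \<in> Q \<longrightarrow> s * x \<in> m)"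
proof (induction j)
  case 0
  have "x = 0" if "x \<in> Set.range Cst" "x \<in> Q" for x
    using prime_on_Cst[OF Q_prime UNIV_I UNIV_I] that by (auto simp: Cst_simps)
  then have "\<forall>x\<in>vars_below 0. x \<in> Q \<longrightarrow> 1 * x \<in> m" using mI(3) by (metis adjoins.simps(1) mult_zero_right)
  then show ?case using prime_onD(3)[OF Q_prime] by blast
next
  case (Suc j)
  then obtain s where s: "s \<notin> Q" "\<And>x. x \<in> vars_below j \<Longrightarrow> x \<in> Q \<Longrightarrow> s * x \<in> m" by blast
  show ?case
  proof (cases "free j")
    case True
    then show ?thesis using s annihilator_free[OF True s(2)] by blast
  next
    case False
    then obtain h where h: "min_rel (vars_below j) Q (Var j) h" using free_or_rel unfolding rel_def by blast
    then have "poly h (Var j) \<in> Q" "lead_coeff h \<notin> Q" by (auto simp: min_rel_def)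
    then obtain t where t: "t \<notin> Q" "t * poly h (Var j) \<in> m" using Q_ann by blast
    show ?thesis using annihilator_rel[OF h t(2) s(2)] Q_mult[OF Q_mult[OF s(1) t(1)] \<open>lead_coeff h \<notin> Q\<close>] by blast
  qed
qed

text \<open>Smaller degree means constant here, and a constant relation lies in \<open>Q\<close> by
  itself.\<close>

lemma linear_min_rel:
  assumes "s \<notin> Q" "s \<in> vars_below j" "w \<in> vars_below j" "s * Var j + w \<in> m"
  shows "min_rel (vars_below j) Q (Var j) [:w, s:]" "lead_coeff [:w, s:] = s"
proof -
  have s0: "s \<noteq> 0" using assms(1) QI(3) by auto
  then show lc: "lead_coeff [:w, s:] = s" by simp
  show "min_rel (vars_below j) Q (Var j) [:w, s:]" unfolding min_rel_def lc
  proof (intro conjI ballI impI)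
    show "[:w, s:] \<in> polys_over (vars_below j)"
      using assms by (intro polys_over_closed[OF vars_below_sring])
    show "poly [:w, s:] (Var j) \<in> Q" using assms(4) m_Q by (auto simp: algebra_simps)
    fix r assume "Polynomial.degree r < Polynomial.degree [:w, s:]" "poly r (Var j) \<in> Q"
    then obtain c where "r = [:c:]" "c \<in> Q" using s0 by (auto elim: degree_eq_zeroE)
    then show "r \<in> polys_over Q" using QI(3) by (auto simp: polys_over_def coeff_pCons split: nat.splits)
  qed (rule assms(1))
qed

text \<open>Finitely many variables contribute finitely many factors to \<open>s0\<close>. From
  \<open>J\<close> on nothing new is added, so one element works for all orders.\<close>

lemma annihilator: "\<exists>s. s \<notin> Q \<and> (\<forall>x\<in>Q. s * x \<in> m)"
proof -
  obtain J s1 where s1: "s1 \<notin> Q" "s1 \<in> vars_below J" "\<And>k. J \<le> k \<Longrightarrow> free k \<or> linear s1 k" using tail by blast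
  obtain s0 where s0: "s0 \<notin> Q" "\<And>x. x \<in> vars_below J \<Longrightarrow> x \<in> Q \<Longrightarrow> s0 * x \<in> m"
    using finite_annihilator by blast
  define s where "s = s0 * s1"
  have claim: "\<forall>x\<in>vars_below j. x \<in> Q \<longrightarrow> s * x \<in> m" if "J \<le> j" for j
    using that
  proof (induction rule: dec_induct)
    case base
    have "s1 * (s0 * x) \<in> m" if "x \<in> vars_below J" "x \<in> Q" for x
      by (rule mI(5)[OF UNIV_I s0(2)[OF that]])
    then show ?case by (simp add: s_def mult_ac)
  next
    case (step j)
    show ?case
    proof (intro ballI impI)
      fix x assume x: "x \<in> vars_below (Suc j)" "x \<in> Q"
      show "s * x \<in> m"
      proof (cases "free j")
        case True
        then show ?thesis using annihilator_free[OF True _ x] step.IH by blast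
      next
        case False
        then obtain w where w: "w \<in> vars_below j" "s1 * Var j + w \<in> m"
          using s1(3)[OF step.hyps(1)] by (auto simp: linear_def)
        have s1j: "s1 \<in> vars_below j" using s1(2) vars_below_mono[OF step.hyps(1)] by blast
        note h = linear_min_rel[OF s1(1) s1j w]
        \<comment> \<open>The linear relation lies in \<open>m\<close> already, so
          \<open>t = 1\<close>; its leading coefficient \<open>s1\<close> is a factor of
          \<open>s\<close>, and the repeated factor disappears by radicality.\<close>
        have "s * 1 * lead_coeff [:w, s1:] * x \<in> m"
          by (rule annihilator_rel[OF h(1) _ _ x]) (use w step.IH in \<open>auto simp: algebra_simps\<close>)
        then have "s0 * s1 * (s1 * x) \<in> m" by (simp only: h(2) s_def mult_1_right mult.assoc)
        then show ?thesis using m_cancel_power[of s0 s1 "s1 * x" 1 x] by (simp add: s_def)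
      qed
    qed
  qed
  have "s * x \<in> m" if "x \<in> Q" for x
  proof -
    obtain i where "x \<in> vars_below i" using in_some_vars_below by blast
    then have "x \<in> vars_below (max i J)" using vars_below_mono[of i "max i J"] by auto
    then show ?thesis using claim[of "max i J"] that by simp
  qed
  moreover have "s \<notin> Q" unfolding s_def by (rule Q_mult[OF s0(1) s1(1)])
  ultimately show ?thesis by blast
qed

end

text \<open>Subrings of an algebraic extension of the base field are fields.\<close>

lemma alg_closure_inverse_in:
  fixes E :: "'a::field alg_closure set"
  assumes E: "sring E" "Set.range to_ac \<subseteq> E" and y: "y \<in> E" "y \<noteq> 0"
  shows "inverse y \<in> E"
proof -
  obtain p where "p \<noteq> 0 \<and> poly (map_poly to_ac p) y = 0" using alg_closure_algebraic[of y] by blast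
  then obtain p where p: "p \<noteq> 0" "poly (map_poly to_ac p) y = 0"
    and min: "\<And>q. q \<noteq> 0 \<Longrightarrow> poly (map_poly to_ac q) y = 0 \<Longrightarrow> Polynomial.degree p \<le> Polynomial.degree q"
    using ex_has_least_nat[of "\<lambda>p. p \<noteq> 0 \<and> poly (map_poly to_ac p) y = 0" p Polynomial.degree] by auto
  obtain c q where cq: "p = pCons c q" by (cases p)
  have e: "to_ac c + y * poly (map_poly to_ac q) y = 0" using p(2) by (simp add: cq map_poly_pCons)
  have "c \<noteq> 0"
  proof
    assume c: "c = 0"
    then have "poly (map_poly to_ac q) y = 0" "q \<noteq> 0" using e y p cq by auto
    then show False using min[of q] cq by auto
  qed
  have "inverse y = - (to_ac (inverse c) * poly (map_poly to_ac q) y)"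
  proof -
    have "y * poly (map_poly to_ac q) y = - to_ac c" using e by (simp add: eq_neg_iff_add_eq_0 add.commute)
    then have "y * (- (to_ac (inverse c) * poly (map_poly to_ac q) y)) = 1"
      using \<open>c \<noteq> 0\<close> by (simp add: mult.left_commute[of y])
    then show ?thesis using y(2) by (metis inverse_unique)
  qed
  moreover have "map_poly to_ac q \<in> polys_over E" using E(2) by (auto simp: polys_over_def coeff_map_poly)
  moreover have "to_ac (inverse c) \<in> E" using E(2) by blast
  ultimately show ?thesis using y(1)
    by (simp only:) (intro sringD(4,5)[OF E(1)] poly_in_sring[OF E(1)])
qed

section \<open>Finite extensions inside the algebraic closure\<close>

global_interpretation acv: vector_space "\<lambda>a x. to_ac a * x :: 'a::field alg_closure"
  by unfold_locales (auto simp: algebra_simps)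

text \<open>Only ring closure is demanded; inverses come from
  \<open>alg_closure_inverse_in\<close>.\<close>

definition findim :: "'a::field alg_closure set \<Rightarrow> bool" where
  "findim E \<longleftrightarrow> sring E \<and> Set.range to_ac \<subseteq> E \<and> (\<exists>B. finite B \<and> E \<subseteq> acv.span B)"

text \<open>The products of a spanning set of \<open>E\<close> with the powers of \<open>x\<close>
  below the degree of \<open>p\<close> span. Since only spanning matters, any nonzero polynomial
  with root \<open>x\<close> serves, minimal or not.\<close>

lemma findim_adjoin:
  fixes E :: "'a::field alg_closure set"
  assumes E: "findim E"
  shows "findim (adjoin E x)"
proof -
  have s: "sring E" "Set.range to_ac \<subseteq> E" using E by (auto simp: findim_def)
  obtain B where B: "finite B" "E \<subseteq> acv.span B" using E unfolding findim_def by blast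
  obtain p where "p \<noteq> 0 \<and> poly (map_poly to_ac p) x = 0" using alg_closure_algebraic[of x] by blast
  then have p: "p \<noteq> 0" "poly (map_poly to_ac p) x = 0" by auto
  define d where "d = Polynomial.degree p"
  define T where "T = acv.span ((\<lambda>i. x ^ i) ` {..<d})"
  have d0: "(\<Sum>i\<le>d. to_ac (coeff p i) * x ^ i) = 0"
    using p(2) by (simp add: poly_altdef d_def coeff_map_poly degree_map_poly)
  have "{..d} = insert d {..<d}" by auto
  then have "to_ac (coeff p d) * x ^ d = - (\<Sum>i<d. to_ac (coeff p i) * x ^ i)"
    using d0 by (simp add: eq_neg_iff_add_eq_0)
  moreover have "(\<Sum>i<d. to_ac (coeff p i) * x ^ i) \<in> T" unfolding T_def
    by (intro acv.span_sum acv.span_scale acv.span_base) auto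
  ultimately have "to_ac (coeff p d) * x ^ d \<in> T" unfolding T_def by (simp add: acv.span_neg)
  then have "to_ac (inverse (coeff p d)) * (to_ac (coeff p d) * x ^ d) \<in> T"
    unfolding T_def by (rule acv.span_scale)
  moreover have "coeff p d \<noteq> 0" using p(1) by (simp add: d_def)
  ultimately have xd: "x ^ d \<in> T" by (simp flip: mult.assoc)
  have T_x: "x * y \<in> T" if "y \<in> T" for y
    using that unfolding T_def
  proof (induction rule: acv.span_induct_alt)
    case (step c y z)
    then obtain i where i: "y = x ^ i" "i < d" by auto
    have "x * y \<in> T"
    proof (cases "Suc i = d")
      case True then show ?thesis using xd by (simp add: i(1) flip: power_Suc)
    next
      case False
      then have "x ^ Suc i \<in> T" unfolding T_def using i(2)
        by (intro acv.span_base image_eqI[of _ _ "Suc i"]) auto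
      then show ?thesis by (simp add: i(1))
    qed
    then have "to_ac c * (x * y) + x * z \<in> acv.span ((\<lambda>i. x ^ i) ` {..<d})"
      using step unfolding T_def by (intro acv.span_add acv.span_scale)
    then show ?case by (simp add: algebra_simps)
  qed (simp add: acv.span_zero)
  \<comment> \<open>Positivity puts \<open>x ^ 0\<close> among the spanning powers, which starts the
    induction over all powers.\<close>
  have "0 < d"
  proof (rule ccontr)
    assume "\<not> 0 < d"
    then obtain c where "p = [:c:]" using degree_eq_zeroE[of p] by (auto simp: d_def)
    then show False using p by (simp add: map_poly_pCons)
  qed
  then have "1 \<in> T" unfolding T_def by (intro acv.span_base) (auto intro!: image_eqI[of _ _ 0])
  then have xn: "x ^ n \<in> T" for n by (induction n) (use T_x in auto)
  define B' where "B' = (\<lambda>(b, i). b * x ^ i) ` (B \<times> {..<d})"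
  have bt: "b * y \<in> acv.span B'" if "b \<in> B" "y \<in> T" for b y
    using that(2) unfolding T_def
  proof (induction rule: acv.span_induct_alt)
    case (step c y z)
    then have "b * y \<in> B'" using that(1) by (auto simp: B'_def)
    then have "to_ac c * (b * y) + b * z \<in> acv.span B'"
      using step(2) by (intro acv.span_add[OF acv.span_scale[OF acv.span_base]])
    then show ?case by (simp add: algebra_simps)
  qed (simp add: acv.span_zero)
  have et: "e * y \<in> acv.span B'" if "e \<in> E" "y \<in> T" for e y
  proof -
    have "e \<in> acv.span B" using that B by blast
    then show ?thesis
    proof (induction rule: acv.span_induct_alt)
      case (step c b z)
      then have "to_ac c * (b * y) + z * y \<in> acv.span B'" using that bt by (intro acv.span_add acv.span_scale)
      then show ?case by (simp add: algebra_simps)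
    qed (simp add: acv.span_zero)
  qed
  have "adjoin E x \<subseteq> acv.span B'"
  proof
    fix z assume "z \<in> adjoin E x"
    then obtain q where q: "q \<in> polys_over E" "z = poly q x" by (auto simp: adjoin_def)
    show "z \<in> acv.span B'" unfolding q(2) poly_altdef using q(1) xn
      by (intro acv.span_sum et) (auto simp: polys_over_def)
  qed
  moreover have "finite B'" using B(1) by (simp add: B'_def)
  moreover have "sring (adjoin E x)" "Set.range to_ac \<subseteq> adjoin E x"
    using adjoin_sring[OF s(1)] subset_trans[OF s(2) adjoin_subset[OF s(1)]] by simp_all
  ultimately show ?thesis unfolding findim_def by blast
qed

lemma findim_base: "findim (Set.range (to_ac :: 'a::field \<Rightarrow> _))"
  unfolding findim_def
proof (intro conjI)
  show "sring (Set.range (to_ac :: 'a \<Rightarrow> _))" unfolding sring_def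
    by (auto simp flip: to_ac_add to_ac_mult to_ac_minus to_ac_1)
  have "to_ac a \<in> acv.span {1}" for a :: 'a
    using acv.span_scale[OF acv.span_base[of 1 "{1}"], of a] by simp
  then show "\<exists>B. finite B \<and> Set.range (to_ac :: 'a \<Rightarrow> _) \<subseteq> acv.span B"
    by (intro exI[of _ "{1}"]) auto
qed simp

lemma findim_exists:
  fixes f :: "nat \<Rightarrow> 'a::field alg_closure"
  shows "\<exists>E. findim E \<and> (\<forall>i<n. f i \<in> E)"
proof (induction n)
  case 0 then show ?case using findim_base by auto
next
  case (Suc n)
  then obtain E where E: "findim E" "\<forall>i<n. f i \<in> E" by blast
  then have "sring E" by (simp add: findim_def)
  from adjoin_subset[OF this, of "f n"] adjoin_gen[OF this, of "f n"]
  have "\<forall>i<Suc n. f i \<in> adjoin E (f n)" using E(2) by (auto simp: less_Suc_eq)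
  then show ?case using findim_adjoin[OF E(1), of "f n"] by blast
qed

lemma findim_dependent:
  fixes E :: "'a::field alg_closure set"
  assumes "findim E"
  shows "\<exists>M::nat. \<forall>v. (\<forall>i<M. v i \<in> E) \<longrightarrow> (\<exists>a. (\<exists>i<M. a i \<noteq> 0) \<and> (\<Sum>i<M. to_ac (a i) * v i) = 0)"
proof -
  obtain B where B: "finite B" "E \<subseteq> acv.span B" using assms unfolding findim_def by blast
  define M where "M = Suc (card B)"
  have dep: "\<exists>a. (\<exists>i<M. a i \<noteq> 0) \<and> (\<Sum>i<M. to_ac (a i) * v i) = 0" if v: "\<forall>i<M. v i \<in> E" for v
  proof (cases "inj_on v {..<M}")
    case True
    have sub: "v ` {..<M} \<subseteq> acv.span B" using v B(2) by auto
    have "card (v ` {..<M}) = M" using True by (simp add: card_image)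
    then have "acv.dependent (v ` {..<M})"
      using acv.independent_span_bound[OF B(1) _ sub] by (auto simp: M_def)
    then obtain u x where u: "x \<in> v ` {..<M}" "u x \<noteq> 0" "(\<Sum>x\<in>v ` {..<M}. to_ac (u x) * x) = 0"
      by (auto simp: acv.dependent_finite)
    then obtain i where "i < M" "u (v i) \<noteq> 0" by auto
    moreover have "(\<Sum>i<M. to_ac (u (v i)) * v i) = 0" using u(3) by (simp add: sum.reindex[OF True])
    ultimately show ?thesis by (intro exI[of _ "\<lambda>i. u (v i)"]) auto
  next
    case False
    then obtain i j where ij: "i < M" "j < M" "i \<noteq> j" "v i = v j" by (auto simp: inj_on_def)
    \<comment> \<open>Dependence of a set does not see repetitions; when two members of the family
      coincide, their difference is the relation.\<close>
    define a where "a k = (if k = i then 1 else if k = j then - 1 else 0 :: 'a)" for k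
    have "(\<Sum>k<M. to_ac (a k) * v k) = (\<Sum>k\<in>{i, j}. to_ac (a k) * v k)"
      using ij by (intro sum.mono_neutral_right) (auto simp: a_def)
    also have "\<dots> = 0" using ij by (simp add: a_def)
    finally show ?thesis using ij(1) by (intro exI[of _ a]) (auto simp: a_def)
  qed
  show ?thesis
  proof (rule exI[of _ M], intro allI impI)
    fix v assume "\<forall>i<M. v i \<in> E"
    then show "\<exists>a. (\<exists>i<M. a i \<noteq> 0) \<and> (\<Sum>i<M. to_ac (a i) * v i) = 0" by (rule dep)
  qed
qed

section \<open>Bounded dependence of constants\<close>

context sd_quotient
begin

text \<open>The preimage of \<open>m\<close> under \<open>s\<close> is a proper stable ideal
  containing \<open>m\<close>, hence \<open>m\<close> itself. So \<open>s\<close> stays injective on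
  the quotient.\<close>

lemma SS_reflect:
  assumes s: "s \<in> SS" and y: "s y \<in> m"
  shows "y \<in> m"
proof -
  note h = rhomD[OF SS(1)[OF s]]
  define I where "I = {y. s y \<in> m}"
  have "I = m"
  proof (rule m_max)
    show "ideal_on UNIV I" unfolding ideal_on_def I_def
      using mI(3) by (auto simp: h intro: mI(4) mI(5)[OF UNIV_I])
    show "stable F I" unfolding stable_def I_def
    proof (intro ballI CollectI)
      fix f x assume f: "f \<in> F" and x: "x \<in> {y. s y \<in> m}"
      have "s (f x) = f (s x)" by (rule comm) (use s f in auto)
      then show "s (f x) \<in> m" using m_stable[OF f] x by simp
    qed
    show "m \<subseteq> I" using m_stable[of s] s by (auto simp: I_def)
    show "1 \<notin> I" using m_ideal(3) by (simp add: I_def h)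
  qed
  then show ?thesis using y by (auto simp: I_def)
qed

lemma const_1: "const 1"
  using SS DD mI(3) by (auto simp: const_def rhomD derivD)

lemma const_SS_preimage:
  assumes s: "s \<in> SS" and c: "const (s c)"
  shows "const c"
  unfolding const_def
proof (intro conjI ballI)
  note h = rhomD[OF SS(1)[OF s]]
  fix f assume f: "f \<in> SS"
  have "s (f c) = f (s c)" by (rule comm) (use s f in auto)
  then have "s (f c - c) = f (s c) - s c" by (simp add: h)
  also have "\<dots> \<in> m" using c f by (simp add: const_def)
  finally show "f c - c \<in> m" by (rule SS_reflect[OF s])
next
  fix d assume d: "d \<in> DD"
  have "s (d c) = d (s c)" by (rule comm) (use s d in auto)
  also have "\<dots> \<in> m" using c d by (simp add: const_def)
  finally show "d c \<in> m" by (rule SS_reflect[OF s])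
qed

lemma W_0: "0 \<in> W"
  using W.intros(1)[OF const_1, of 0] by (simp add: Cst_simps)

lemma W_scale: "w \<in> W \<Longrightarrow> Cst a * w \<in> W"
proof (induction rule: W.induct)
  case (1 c b)
  then show ?case using W.intros(1)[of c "a * b"] by (simp add: Cst_simps mult.assoc)
qed (auto simp: distrib_left intro: W.intros)

lemma W_sum: "(\<And>i. i \<in> S \<Longrightarrow> w i \<in> W) \<Longrightarrow> (\<Sum>i\<in>S. Cst (a i) * w i) \<in> W"
  by (induction S rule: infinite_finite_induct) (auto intro: W_0 W_scale W.intros)

text \<open>The scalar is lifted inside the base field and the constant inside the polynomial ring;
  its lift is again constant because \<open>s\<close> reflects \<open>m\<close>.\<close>

lemma W_SS_preimage: "w \<in> W \<Longrightarrow> s \<in> SS \<Longrightarrow> \<exists>v\<in>W. s v = w"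
proof (induction rule: W.induct)
  fix c a assume s: "s \<in> SS" and c: "const c"
  note h = rhomD[OF SS(1)[OF s]]
  obtain b where b: "s (Cst b) = Cst a" using SS_Cst[OF s] by blast
  obtain c' where c': "s c' = c" using SS(2)[OF s] by (metis bij_pointE)
  have "Cst b * c' \<in> W" using const_SS_preimage[OF s] c c' by (intro W.intros) simp
  then show "\<exists>v\<in>W. s v = Cst a * c" using b c' by (intro bexI[of _ "Cst b * c'"]) (auto simp: h)
next
  fix v w assume s: "s \<in> SS" and IH: "s \<in> SS \<Longrightarrow> \<exists>x\<in>W. s x = v" "s \<in> SS \<Longrightarrow> \<exists>x\<in>W. s x = w"
  obtain x y where "x \<in> W" "y \<in> W" "s x = v" "s y = w" using IH[OF s] by blast
  then show "\<exists>x\<in>W. s x = v + w" 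
    by (intro bexI[of _ "x + y"]) (auto simp: rhomD[OF SS(1)[OF s]] intro: W.intros)
qed

text \<open>The elements \<open>x\<close> with \<open>dep x M\<close> for some \<open>M\<close> form a stable ideal: the operators in \<open>SS\<close> map
  the span \<open>W\<close> of the constants onto itself, and for \<open>d \<in> DD\<close>, since \<open>m\<close> is radical, \<open>d x\<close> annihilates
  modulo \<open>m\<close> whatever \<open>x\<close> does.\<close>

definition dep :: "'a mp \<Rightarrow> nat \<Rightarrow> bool" where
  "dep x M \<longleftrightarrow> (\<forall>w. (\<forall>i<M. w i \<in> W) \<longrightarrow>
     (\<exists>a. (\<exists>i<M. a i \<noteq> 0) \<and> x * (\<Sum>i<M. Cst (a i) * w i) \<in> m))"

lemma depD:
  assumes "dep x M" "\<forall>i<M. w i \<in> W"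
  shows "\<exists>a. (\<exists>i<M. a i \<noteq> 0) \<and> x * (\<Sum>i<M. Cst (a i) * w i) \<in> m"
  using assms(1)[unfolded dep_def, THEN spec, THEN mp, OF assms(2)] .

text \<open>\<open>I\<close> will be either the prime \<open>Q\<close>, with \<open>x\<close> an
  annihilator of it, or the annihilator modulo \<open>m\<close> of an element dividing or
  differentiating to the one in question.\<close>

lemma depI:
  assumes "\<forall>w. (\<forall>i<M. w i \<in> W) \<longrightarrow> (\<exists>a. (\<exists>i<M. a i \<noteq> 0) \<and> (\<Sum>i<M. Cst (a i) * w i) \<in> I)"
    "\<And>z. z \<in> I \<Longrightarrow> x * z \<in> m"
  shows "dep x M"
  unfolding dep_def
proof (intro allI impI)
  fix w assume "\<forall>i<M. w i \<in> W"
  from assms(1)[THEN spec, THEN mp, OF this] obtain a where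
    a: "(\<exists>i<M. a i \<noteq> 0) \<and> (\<Sum>i<M. Cst (a i) * w i) \<in> I" by (elim exE)
  show "\<exists>a. (\<exists>i<M. a i \<noteq> 0) \<and> x * (\<Sum>i<M. Cst (a i) * w i) \<in> m"
    by (rule exI[of _ a], rule conjI[OF conjunct1[OF a] assms(2)[OF conjunct2[OF a]]])
qed

lemma sum_blocks:
  fixes g :: "nat \<Rightarrow> 'b::comm_monoid_add"
  shows "(\<Sum>j<n * k. g j) = (\<Sum>b<n. \<Sum>i<k. g (b * k + i))"
proof -
  have "(\<Sum>i<k. g (b * k + i)) = sum g {b * k..<b * k + k}" for b
    by (rule sum.reindex_bij_witness[of _ "\<lambda>i. i - b * k" "\<lambda>i. b * k + i"]) auto
  then show ?thesis by (simp add: sum.nat_group)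
qed

text \<open>Cut the \<open>n * k\<close> elements into \<open>n\<close> blocks of length
  \<open>k\<close>. Each block has a nontrivial combination killed by \<open>x\<close>; these
  combinations lie in \<open>W\<close> again, and one nontrivial combination of them is killed by
  \<open>y\<close> as well.\<close>

lemma dep_add:
  assumes x: "dep x k" and y: "dep y n"
  shows "dep (x + y) (n * k)"
  unfolding dep_def
proof (intro allI impI)
  fix w assume w: "\<forall>i<n * k. w i \<in> W"
  have idx: "b * k + i < n * k" if "b < n" "i < k" for b i
  proof -
    have "b * k + i < Suc b * k" using that by simp
    also have "\<dots> \<le> n * k" using that by (intro mult_right_mono) auto
    finally show ?thesis .
  qed
  have "\<forall>b. \<exists>a. b < n \<longrightarrow> (\<exists>i<k. a i \<noteq> 0) \<and> x * (\<Sum>i<k. Cst (a i) * w (b * k + i)) \<in> m"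
  proof
    fix b
    show "\<exists>a. b < n \<longrightarrow> (\<exists>i<k. a i \<noteq> 0) \<and> x * (\<Sum>i<k. Cst (a i) * w (b * k + i)) \<in> m"
    proof (cases "b < n")
      case True
      then have "\<forall>i<k. w (b * k + i) \<in> W" using w idx by simp
      from x[unfolded dep_def, THEN spec, THEN mp, OF this] show ?thesis by (elim exE) (rule exI, rule impI)
    qed simp
  qed
  from choice[OF this] obtain a where a': "\<forall>b. b < n \<longrightarrow> (\<exists>i<k. a b i \<noteq> 0) \<and>
    x * (\<Sum>i<k. Cst (a b i) * w (b * k + i)) \<in> m" by (elim exE)
  then have a: "\<And>b. b < n \<Longrightarrow> (\<exists>i<k. a b i \<noteq> 0)"
    "\<And>b. b < n \<Longrightarrow> x * (\<Sum>i<k. Cst (a b i) * w (b * k + i)) \<in> m" by simp_all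
  define v where "v b = (\<Sum>i<k. Cst (a b i) * w (b * k + i))" for b
  have "v b \<in> W" if "b < n" for b unfolding v_def using w idx[OF that] by (intro W_sum) auto
  then have "\<forall>b<n. v b \<in> W" by simp
  from depD[OF y this] obtain e b0 where e: "b0 < n" "e b0 \<noteq> 0" "y * (\<Sum>b<n. Cst (e b) * v b) \<in> m"
    by auto
  obtain i0 where i0: "i0 < k" "a b0 i0 \<noteq> 0" using a(1)[OF e(1)] by blast
  \<comment> \<open>The coefficients of the composed combination, indexed by block and position; a
    product of two nonzero field elements keeps it nontrivial.\<close>
  define f where "f j = e (j div k) * a (j div k) (j mod k)" for j
  have f: "f (b * k + i) = e b * a b i" if "i < k" for b i using that by (simp add: f_def)
  have "f (b0 * k + i0) \<noteq> 0" using f[OF i0(1)] e(2) i0(2) by simp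
  moreover have S: "(\<Sum>j<n * k. Cst (f j) * w j) = (\<Sum>b<n. Cst (e b) * v b)"
    unfolding sum_blocks v_def sum_distrib_left by (intro sum.cong refl) (simp add: f Cst_simps mult.assoc)
  moreover have "x * (\<Sum>b<n. Cst (e b) * v b) \<in> m"
  proof -
    have "x * (\<Sum>b<n. Cst (e b) * v b) = (\<Sum>b<n. Cst (e b) * (x * v b))"
      unfolding sum_distrib_left by (intro sum.cong refl) (simp add: mult_ac)
    also have "\<dots> \<in> m" using a(2)[folded v_def]
      by (intro ideal_on_sum[OF m_ideal(1)] mI(5)[OF UNIV_I, of "x * v b" for b]) simp
    finally show ?thesis .
  qed
  then have "(x + y) * (\<Sum>b<n. Cst (e b) * v b) \<in> m" using mI(4)[OF _ e(3)] by (simp add: distrib_right)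
  ultimately show "\<exists>a. (\<exists>i<n * k. a i \<noteq> 0) \<and> (x + y) * (\<Sum>i<n * k. Cst (a i) * w i) \<in> m"
    using idx[OF e(1) i0(1)] by (intro exI[of _ f]) auto
qed

lemma dep_mult:
  assumes "dep x k"
  shows "dep (y * x) k"
proof (rule depI[where I="{z. x * z \<in> m}"])
  show "y * x * z \<in> m" if "z \<in> {z. x * z \<in> m}" for z
    using mI(5)[OF UNIV_I, of "x * z" y] that by (simp add: mult.assoc)
qed (use assms in \<open>simp add: dep_def\<close>)

text \<open>Pull the elements of \<open>W\<close> back along \<open>s\<close>, use the relation for
  \<open>x\<close>, and push it forward; injectivity of \<open>s\<close> keeps the coefficients from
  vanishing.\<close>

lemma dep_SS:
  assumes s: "s \<in> SS" and x: "dep x k"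
  shows "dep (s x) k"
  unfolding dep_def
proof (intro allI impI)
  note h = rhomD[OF SS(1)[OF s]]
  fix w assume w: "\<forall>i<k. w i \<in> W"
  have "\<forall>i. \<exists>v. i < k \<longrightarrow> v \<in> W \<and> s v = w i" using W_SS_preimage[OF _ s] w by blast
  from choice[OF this] obtain v where "\<forall>i. i < k \<longrightarrow> v i \<in> W \<and> s (v i) = w i" by (elim exE)
  then have v: "\<And>i. i < k \<Longrightarrow> v i \<in> W" "\<And>i. i < k \<Longrightarrow> s (v i) = w i" by simp_all
  have "\<forall>i<k. v i \<in> W" using v(1) by simp
  from depD[OF x this] obtain a i where a: "i < k" "a i \<noteq> 0" "x * (\<Sum>i<k. Cst (a i) * v i) \<in> m"
    by auto
  have "\<forall>i. \<exists>b. s (Cst (a i)) = Cst b" using below_Cst[of s] s by blast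
  then obtain b where b: "\<And>i. s (Cst (a i)) = Cst (b i)" by metis
  have "b i \<noteq> 0"
  proof
    assume "b i = 0"
    then have "s (Cst (a i)) = s 0" by (simp add: b h Cst_simps)
    then have "Cst (a i) = Cst 0" using SS(2)[OF s] by (simp add: bij_is_inj inj_eq Cst_simps)
    then show False using a(2) by (metis cval_Cst to_ac_eq_iff)
  qed
  moreover have "s (x * (\<Sum>i<k. Cst (a i) * v i)) = s x * (\<Sum>i<k. Cst (b i) * w i)"
    by (simp add: h rhom_sum[OF SS(1)[OF s]] b v(2))
  then have "s x * (\<Sum>i<k. Cst (b i) * w i) \<in> m" using m_stable[OF _ a(3), of s] s by simp
  ultimately show "\<exists>a. (\<exists>i<k. a i \<noteq> 0) \<and> s x * (\<Sum>i<k. Cst (a i) * w i) \<in> m"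
    using a(1) by (intro exI[of _ b]) auto
qed

lemma dep_DD:
  assumes d: "d \<in> DD" and x: "dep x k"
  shows "dep (d x) k"
proof -
  have *: "d x * w \<in> m" if "x * w \<in> m" for w
    by (rule deriv_annihilator[OF sring_UNIV subset_UNIV m_ideal(1) DD[OF d] UNIV_I _ m_radical UNIV_I UNIV_I that])
      (use m_stable d in auto)
  show ?thesis
    by (rule depI[where I="{z. x * z \<in> m}"]) (use x * in \<open>simp_all add: dep_def\<close>)
qed

text \<open>The stable ideal of elements with some bound contains \<open>m\<close>, and strictly so
  because of \<open>s\<close>; by maximality it contains 1. The bound may grow on the way, only its
  existence is kept.\<close>

lemma dep_1:
  assumes s: "dep s k" "s \<notin> m"
  shows "\<exists>M. dep 1 M"
proof -
  define I where "I = {x. \<exists>M. dep x M}"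
  have zero: "x \<in> I" if "x \<in> m" for x
  proof -
    have "dep x 1" unfolding dep_def
      by (intro allI impI exI[of _ "\<lambda>_. 1"]) (simp add: Cst_simps mI(6)[OF UNIV_I that])
    then show ?thesis by (auto simp: I_def)
  qed
  have "1 \<in> I"
  proof (rule ccontr)
    assume "1 \<notin> I"
    have "I = m"
    proof (rule m_max)
      show "ideal_on UNIV I" unfolding ideal_on_def
      proof (intro conjI ballI)
        show "0 \<in> I" by (rule zero[OF mI(3)])
        show "x + y \<in> I" if "x \<in> I" "y \<in> I" for x y using that dep_add unfolding I_def by blast
        show "a * x \<in> I" if "x \<in> I" for a x using that dep_mult unfolding I_def by blast
      qed simp
      show "stable F I" unfolding stable_def I_def using dep_SS dep_DD by blast
    qed (use zero \<open>1 \<notin> I\<close> in auto)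
    then show False using s by (auto simp: I_def)
  qed
  then show ?thesis by (simp add: I_def)
qed

definition kconst :: "'a \<Rightarrow> bool" where
  "kconst a \<longleftrightarrow> (\<forall>s\<in>SS. s (Cst a) = Cst a) \<and> (\<forall>d\<in>DD. d (Cst a) = 0)"

lemma Cst_eq_iff: "Cst a = Cst b \<longleftrightarrow> a = (b :: 'a)"
  by (metis cval_Cst to_ac_eq_iff)

text \<open>Constants are linearly disjoint from the base field: the coefficients of a shortest
  normalised relation are themselves constant.\<close>

lemma const_dependent:
  fixes M :: nat
  assumes c: "\<And>i. i < M \<Longrightarrow> const (c i)"
    and a: "\<exists>i<M. a i \<noteq> 0" "(\<Sum>i<M. Cst (a i) * c i) \<in> m"
  shows "\<exists>a. (\<forall>i<M. kconst (a i)) \<and> (\<exists>i<M. a i \<noteq> 0) \<and> (\<Sum>i<M. Cst (a i) * c i) \<in> m"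
proof -
  let ?R = "\<lambda>a. (\<exists>i<M. a i \<noteq> 0) \<and> (\<Sum>i<M. Cst (a i) * c i) \<in> m"
  let ?S = "\<lambda>a. {i. i < M \<and> a i \<noteq> (0::'a)}"
  obtain b where b: "?R b" and min: "\<And>e. ?R e \<Longrightarrow> card (?S b) \<le> card (?S e)"
    using ex_has_least_nat[of ?R a "\<lambda>a. card (?S a)"] a by auto
  obtain i0 where i0: "i0 < M" "b i0 \<noteq> 0" using b by blast
  \<comment> \<open>Normalising one coefficient to 1 makes it invariant under automorphisms and
    killed by derivations.\<close>
  define f where "f i = b i / b i0" for i
  have f0: "f i0 = 1" "\<And>i. f i \<noteq> 0 \<longleftrightarrow> b i \<noteq> 0" using i0 by (auto simp: f_def)
  have "(\<Sum>i<M. Cst (f i) * c i) = Cst (inverse (b i0)) * (\<Sum>i<M. Cst (b i) * c i)"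
    unfolding sum_distrib_left by (intro sum.cong refl) (simp add: f_def field_simps flip: Cst_simps mult.assoc)
  then have fm: "(\<Sum>i<M. Cst (f i) * c i) \<in> m" using mI(5)[OF UNIV_I conjunct2[OF b]] by simp
  \<comment> \<open>A relation supported in the support of \<open>b\<close> and vanishing at
    \<open>i0\<close> has strictly smaller support, so minimality makes it trivial.\<close>
  have small: "e i = 0" if e: "(\<Sum>i<M. Cst (e i) * c i) \<in> m" "e i0 = 0" "\<And>i. b i = 0 \<Longrightarrow> e i = 0" and i: "i < M" for e i
  proof (rule ccontr)
    assume "e i \<noteq> 0"
    then have "?R e" using e i by blast
    moreover have "?S e \<subset> ?S b" using e(2,3) i0 by auto
    then have "card (?S e) < card (?S b)" by (intro psubset_card_mono) auto
    ultimately show False using min[of e] by simp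
  qed
  have "kconst (f i)" if i: "i < M" for i
    unfolding kconst_def
  proof (intro conjI ballI)
    fix s assume s: "s \<in> SS"
    note h = rhomD[OF SS(1)[OF s]]
    have "\<forall>i. \<exists>e. s (Cst (f i)) = Cst e" using below_Cst[of s] s by blast
    then obtain e where e: "\<And>i. s (Cst (f i)) = Cst (e i)" by metis
    have e0: "e i = 0" if "b i = 0" for i
      using e[of i] that f0(2)[of i] by (simp add: Cst_simps h) (metis Cst_eq_iff Cst_simps(4))
    have e1: "e i0 = 1" using e[of i0] f0(1) by (simp add: Cst_simps h) (metis Cst_eq_iff Cst_simps(1))
    \<comment> \<open>The relation transformed by \<open>s\<close>, minus the original one,
      corrected by the defects \<open>s (c i) - c i\<close>, which lie in \<open>m\<close>; its
      coefficient at \<open>i0\<close> is \<open>1 - 1\<close>.\<close>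
    have "(\<Sum>i<M. Cst (e i - f i) * c i) =
      s (\<Sum>i<M. Cst (f i) * c i) - (\<Sum>i<M. Cst (f i) * c i) - (\<Sum>i<M. Cst (e i) * (s (c i) - c i))"
      by (simp add: rhom_sum[OF SS(1)[OF s]] h e Cst_simps algebra_simps sum_subtractf)
    also have "\<dots> \<in> m"
    proof (intro mI(7))
      show "s (\<Sum>i<M. Cst (f i) * c i) \<in> m" using m_stable[OF _ fm] s by blast
      show "(\<Sum>i<M. Cst (e i) * (s (c i) - c i)) \<in> m"
        using c s by (intro ideal_on_sum[OF m_ideal(1)] mI(5)[OF UNIV_I]) (simp add: const_def)
    qed (rule fm)
    finally have "e i - f i = 0"
      by (rule small[where e="\<lambda>i. e i - f i"]) (use i e0 e1 f0 in auto)
    then show "s (Cst (f i)) = Cst (f i)" by (simp add: e)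
  next
    fix d assume d: "d \<in> DD"
    note h = derivD[OF DD[OF d]]
    have "\<forall>i. \<exists>e. d (Cst (f i)) = Cst e" using below_Cst[of d] d by blast
    then obtain e where e: "\<And>i. d (Cst (f i)) = Cst (e i)" by metis
    have e0: "e i = 0" if "b i = 0" for i
      using e[of i] that f0(2)[of i] by (simp add: Cst_simps h) (metis Cst_eq_iff Cst_simps(4))
    have e1: "e i0 = 0" using e[of i0] f0(1) by (simp add: Cst_simps h) (metis Cst_eq_iff Cst_simps(4))
    have "(\<Sum>i<M. Cst (e i) * c i) = d (\<Sum>i<M. Cst (f i) * c i) - (\<Sum>i<M. Cst (f i) * d (c i))"
      by (simp add: deriv_sum[OF DD[OF d]] h e algebra_simps sum.distrib)
    also have "\<dots> \<in> m"
    proof (intro mI(7))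
      show "d (\<Sum>i<M. Cst (f i) * c i) \<in> m" using m_stable[OF _ fm] d by blast
      show "(\<Sum>i<M. Cst (f i) * d (c i)) \<in> m"
        using c d by (intro ideal_on_sum[OF m_ideal(1)] mI(5)[OF UNIV_I]) (auto simp: const_def)
    qed
    finally have "e i = 0"
      by (rule small[where e=e]) (use i e0 e1 in auto)
    then show "d (Cst (f i)) = 0" by (simp add: e Cst_simps)
  qed
  moreover have "\<exists>i<M. f i \<noteq> 0" using i0 f0 by auto
  ultimately show ?thesis using fm by blast
qed

end

section \<open>Points over one finite extension\<close>

context sd_quotient_prime
begin

lemma point_values:
  assumes E: "sring E" "Set.range to_ac \<subseteq> E" and g: "point j Q g" "\<And>i. i < j \<Longrightarrow> g (Var i) \<in> E"
    and x: "x \<in> vars_below j"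
  shows "g x \<in> E"
  using x
proof (induction rule: vars_below_induct)
  case (Cst a) then show ?case using g(1) E(2) by auto
next
  case (Var i) then show ?case by (rule g(2))
next
  case (add p q)
  then show ?case using fhomD(2)[OF conjunct1[OF g(1)]] sringD(3)[OF E(1)] by auto
next
  case (mult p q)
  then show ?case using fhomD(3)[OF conjunct1[OF g(1)]] sringD(4)[OF E(1)] by auto
qed

text \<open>\<open>E\<close> is generated by the values of a point on the variables below
  \<open>J\<close> with \<open>s\<close> nonzero. Further values do not leave \<open>E\<close>: a
  free variable is sent to 0, and a linear one is solved for by dividing by the value of
  \<open>s\<close>, as \<open>E\<close> is closed under inverses.\<close>

lemma points_in_finite_extension:
  "\<exists>E J. findim E \<and> (\<forall>j\<ge>J. \<exists>g. point j Q g \<and> (\<forall>x\<in>vars_below j. g x \<in> E))"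
proof -
  obtain J s where s: "s \<notin> Q" "s \<in> vars_below J" "\<And>k. J \<le> k \<Longrightarrow> free k \<or> linear s k" using tail by blast
  obtain g0 :: "'a mp \<Rightarrow> 'a alg_closure" where g0: "point J Q g0" "g0 s \<noteq> 0"
    using nullstellensatz[OF Q_prime subset_UNIV s(2,1)] by blast
  obtain E where E: "findim E" "\<And>i. i < J \<Longrightarrow> g0 (Var i) \<in> E" using findim_exists[of J "\<lambda>i. g0 (Var i)"] by blast
  have E': "sring E" "Set.range to_ac \<subseteq> E" using E(1) by (auto simp: findim_def)
  have "\<exists>g. point j Q g \<and> g s \<noteq> 0 \<and> (\<forall>i<j. g (Var i) \<in> E)" if "J \<le> j" for j
    using that
  proof (induction rule: dec_induct)
    case base
    then show ?case using g0 E by blast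
  next
    case (step j)
    then obtain f where f: "point j Q f" "f s \<noteq> 0" "\<And>i. i < j \<Longrightarrow> f (Var i) \<in> E" by blast
    note fh = conjunct1[OF f(1)]
    have sj: "s \<in> vars_below j" using s(2) vars_below_mono[OF step.hyps(1)] by blast
    note val = point_values[OF E' f(1) f(3)]
    have "\<exists>g \<xi>. fhom (vars_below (Suc j)) Q g \<and> (\<forall>x\<in>vars_below j. g x = f x) \<and> g (Var j) = \<xi> \<and> \<xi> \<in> E"
    proof (cases "free j")
      case True
      have "poly (map_poly f p) 0 = 0" if p: "p \<in> polys_over (vars_below j)" "poly p (Var j) \<in> Q" for p
      proof -
        have "p \<in> polys_over Q" using True p by (auto simp: free_def)
        then show ?thesis using map_poly_fhom(5)[OF vars_below_sring fh] p by simp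
      qed
      from fhom_extend[OF vars_below_sring fh QI(3) this] sringD(2)[OF E'(1)]
      show ?thesis unfolding adjoins.simps by blast
    next
      case False
      then obtain w where w: "w \<in> vars_below j" "s * Var j + w \<in> m" using s(3)[OF step.hyps(1)] by (auto simp: linear_def)
      note h = linear_min_rel[OF s(1) sj w]
      define \<xi> where "\<xi> = - (f w * inverse (f s))"
      have f0: "f 0 = 0" by (rule fhom_0[OF fh vars_below_sring])
      have "poly (map_poly f [:w, s:]) \<xi> = 0" using f(2) by (simp add: map_poly_pCons f0 \<xi>_def)
      moreover have "f (lead_coeff [:w, s:]) \<noteq> 0" unfolding h(2) by (rule f(2))
      moreover have "\<xi> \<in> E" unfolding \<xi>_def
        by (intro sringD(4,5)[OF E'(1)] alg_closure_inverse_in[OF E'] val w(1) sj f(2))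
      ultimately show ?thesis
        using fhom_extend_root[OF Q_prime vars_below_sring subset_UNIV UNIV_I h(1) fh]
        unfolding adjoins.simps by blast
    qed
    then obtain g \<xi> where g: "fhom (vars_below (Suc j)) Q g" "\<And>x. x \<in> vars_below j \<Longrightarrow> g x = f x"
      "g (Var j) = \<xi>" "\<xi> \<in> E" by blast
    have "point (Suc j) Q g" using g(1,2) f(1) Cst_in_vars_below by metis
    moreover have "g s \<noteq> 0" using g(2)[OF sj] f(2) by simp
    moreover have "\<forall>i<Suc j. g (Var i) \<in> E"
      using g(2)[OF Var_in_vars_below] f(3) g(3,4) by (auto simp: less_Suc_eq)
    ultimately show ?case by blast
  qed
  then have "\<exists>g. point j Q g \<and> (\<forall>x\<in>vars_below j. g x \<in> E)" if "J \<le> j" for j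
    using point_values[OF E'] that by metis
  then show ?thesis using E(1) by blast
qed

text \<open>A point with values in \<open>E\<close> carries the elements of \<open>W\<close> to
  vectors of a finite-dimensional space, and by \<open>W_kernel\<close> a relation between the
  values holds modulo \<open>Q\<close>. The number \<open>M\<close> is uniform since
  \<open>E\<close> does not depend on the order.\<close>

lemma W_dependent_mod_Q:
  "\<exists>M::nat. \<forall>w. (\<forall>i<M. w i \<in> W) \<longrightarrow> (\<exists>a. (\<exists>i<M. a i \<noteq> 0) \<and> (\<Sum>i<M. Cst (a i) * w i) \<in> Q)"
proof -
  obtain E J where E: "findim E" "\<And>j. J \<le> j \<Longrightarrow> \<exists>g. point j Q g \<and> (\<forall>x\<in>vars_below j. g x \<in> E)"
    using points_in_finite_extension by blast
  obtain M :: nat where M: "\<forall>v. (\<forall>i<M. v i \<in> E) \<longrightarrow> (\<exists>a. (\<exists>i<M. a i \<noteq> 0) \<and> (\<Sum>i<M. to_ac (a i) * v i) = 0)"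
    using findim_dependent[OF E(1)] by (elim exE)
  have "\<exists>a. (\<exists>i<M. a i \<noteq> 0) \<and> (\<Sum>i<M. Cst (a i) * w i) \<in> Q" if w: "\<forall>i<M. w i \<in> W" for w
  proof -
    obtain j0 where j0: "w ` {..<M} \<subseteq> vars_below j0" using finite_in_some_vars_below[of "w ` {..<M}"] by auto
    define j where "j = max j0 J"
    have wj: "w i \<in> vars_below j" if "i < M" for i
      using j0 that vars_below_mono[of j0 j] by (auto simp: j_def)
    obtain g where g: "point j Q g" "\<And>x. x \<in> vars_below j \<Longrightarrow> g x \<in> E" using E(2)[of j] by (auto simp: j_def)
    have "\<forall>i<M. g (w i) \<in> E" using g(2)[OF wj] by simp
    from M[THEN spec, THEN mp, OF this]
    obtain a where "(\<exists>i<M. a i \<noteq> 0) \<and> (\<Sum>i<M. to_ac (a i) * g (w i)) = 0" by (elim exE)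
    then have a: "\<exists>i<M. a i \<noteq> 0" "(\<Sum>i<M. to_ac (a i) * g (w i)) = 0" by simp_all
    define x where "x = (\<Sum>i<M. Cst (a i) * w i)"
    have cw: "Cst (a i) * w i \<in> vars_below j" if "i < M" for i
      by (rule sringD(4)[OF vars_below_sring Cst_in_vars_below wj[OF that]])
    have "x \<in> W" unfolding x_def using w by (intro W_sum) auto
    moreover have "x \<in> vars_below j" unfolding x_def using cw by (intro sring_sum[OF vars_below_sring]) auto
    moreover have "g x = 0"
    proof -
      have "g x = (\<Sum>i<M. g (Cst (a i) * w i))" unfolding x_def
        by (rule fhom_sum[OF conjunct1[OF g(1)] vars_below_sring]) (use cw in auto)
      also have "\<dots> = (\<Sum>i<M. to_ac (a i) * g (w i))"
        using fhomD(3)[OF conjunct1[OF g(1)] Cst_in_vars_below wj] g(1) by (intro sum.cong) auto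
      finally show ?thesis using a(2) by simp
    qed
    ultimately have "x \<in> Q" using W_kernel[OF Q_prime m_Q _ _ g(1)] by blast
    then show ?thesis using a(1) unfolding x_def by blast
  qed
  then show ?thesis by (intro exI[of _ M] allI impI)
qed

lemma exists_dep_1: "\<exists>M. dep 1 M"
proof -
  obtain s where s: "s \<notin> Q" "\<And>x. x \<in> Q \<Longrightarrow> s * x \<in> m" using annihilator by blast
  obtain M :: nat where "\<forall>w. (\<forall>i<M. w i \<in> W) \<longrightarrow> (\<exists>a. (\<exists>i<M. a i \<noteq> 0) \<and> (\<Sum>i<M. Cst (a i) * w i) \<in> Q)"
    using W_dependent_mod_Q by (elim exE)
  from depI[OF this s(2)] have "dep s M" .
  moreover have "s \<notin> m" using s(1) m_Q by blast
  ultimately show ?thesis by (rule dep_1)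
qed

end

context sd_quotient
begin

lemma const_finite_dimension:
  "\<exists>M::nat. \<forall>c. (\<forall>i<M. const (c i)) \<longrightarrow>
    (\<exists>a. (\<forall>i<M. kconst (a i)) \<and> (\<exists>i<M. a i \<noteq> 0) \<and> (\<Sum>i<M. Cst (a i) * c i) \<in> m)"
proof -
  obtain Q where Q: "min_prime UNIV m Q"
    using exists_min_prime[OF sring_UNIV m_radical, of "{1}"] m_ideal(3) by auto
  interpret sd_quotient_prime N SS DD pd pa m Q by unfold_locales (rule Q)
  obtain M where M: "dep 1 M" using exists_dep_1 by blast
  have "\<exists>a. (\<forall>i<M. kconst (a i)) \<and> (\<exists>i<M. a i \<noteq> 0) \<and> (\<Sum>i<M. Cst (a i) * c i) \<in> m"
    if c: "\<forall>i<M. const (c i)" for c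
  proof -
    have "\<forall>i<M. c i \<in> W" using W.intros(1)[of "c i" 1 for i] c by (simp add: Cst_simps)
    from depD[OF M this] obtain a where a: "(\<exists>i<M. a i \<noteq> 0) \<and> 1 * (\<Sum>i<M. Cst (a i) * c i) \<in> m"
      by (elim exE)
    show ?thesis by (rule const_dependent[of M c a]) (use a c in simp_all)
  qed
  then show ?thesis by (intro exI[of _ M] allI impI)
qed

end

section \<open>The universal ring of a linear system\<close>

text \<open>Matrices are functions vanishing outside \<open>{..<n} \<times> {..<n}\<close>, so that matrix identities hold
  without index conditions.\<close>

type_synonym 'b fmat = "nat \<Rightarrow> nat \<Rightarrow> 'b"

definition fmul :: "nat \<Rightarrow> 'b::comm_ring_1 fmat \<Rightarrow> 'b fmat \<Rightarrow> 'b fmat" where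
  "fmul n f g i j = (\<Sum>k<n. f i k * g k j)"

definition fone :: "nat \<Rightarrow> 'b::comm_ring_1 fmat" where
  "fone n i j = (if i = j \<and> i < n then 1 else 0)"

definition fmap :: "('b \<Rightarrow> 'c) \<Rightarrow> 'b fmat \<Rightarrow> 'c fmat" where
  "fmap h f i j = h (f i j)"

definition fsupp :: "nat \<Rightarrow> 'b::zero fmat \<Rightarrow> bool" where
  "fsupp n f \<longleftrightarrow> (\<forall>i j. \<not> (i < n \<and> j < n) \<longrightarrow> f i j = 0)"

lemma fmul_assoc: "fmul n (fmul n f g) h = fmul n f (fmul n g h)"
proof (intro ext)
  fix i j
  have "fmul n (fmul n f g) h i j = (\<Sum>k<n. \<Sum>l<n. f i l * g l k * h k j)"
    by (simp add: fmul_def sum_distrib_right)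
  also have "\<dots> = (\<Sum>l<n. \<Sum>k<n. f i l * g l k * h k j)" by (rule sum.swap)
  also have "\<dots> = fmul n f (fmul n g h) i j" by (simp add: fmul_def sum_distrib_left mult.assoc)
  finally show "fmul n (fmul n f g) h i j = fmul n f (fmul n g h) i j" .
qed

lemma fmul_fone:
  assumes "fsupp n f"
  shows "fmul n (fone n) f = f" "fmul n f (fone n) = f"
proof -
  show "fmul n (fone n) f = f"
  proof (intro ext)
    fix i j
    have "fmul n (fone n) f i j = (\<Sum>k<n. if k = i then f i j else 0)"
      unfolding fmul_def by (intro sum.cong) (auto simp: fone_def)
    then show "fmul n (fone n) f i j = f i j" using assms by (auto simp: fsupp_def)
  qed
  show "fmul n f (fone n) = f"
  proof (intro ext)
    fix i j
    have "fmul n f (fone n) i j = (\<Sum>k<n. if k = j then f i j else 0)"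
      unfolding fmul_def by (intro sum.cong) (auto simp: fone_def)
    then show "fmul n f (fone n) i j = f i j" using assms by (auto simp: fsupp_def)
  qed
qed

lemma fsupp_fmul: "fsupp n f \<Longrightarrow> fsupp n g \<Longrightarrow> fsupp n (fmul n f g)"
  unfolding fsupp_def fmul_def by (intro allI impI sum.neutral) auto

lemma fsupp_fmap: "fsupp n f \<Longrightarrow> h 0 = 0 \<Longrightarrow> fsupp n (fmap h f)"
  by (simp add: fsupp_def fmap_def)

lemma fsupp_fone: "fsupp n (fone n)"
  by (auto simp: fsupp_def fone_def)

lemma fmap_id: "fmap (\<lambda>x. x) f = f"
  by (intro ext) (simp add: fmap_def)

lemma fmap_fmul: "rhom h \<Longrightarrow> fmap h (fmul n f g) = fmul n (fmap h f) (fmap h g)"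
  by (intro ext) (simp add: fmap_def fmul_def rhom_sum rhomD)

lemma fmap_fone: "rhom h \<Longrightarrow> fmap h (fone n) = fone n"
  by (intro ext) (simp add: fmap_def fone_def rhomD)

lemma deriv_fmul: "deriv d \<Longrightarrow> d (fmul n f g i j) = fmul n (fmap d f) g i j + fmul n f (fmap d g) i j"
  by (simp add: fmap_def fmul_def deriv_sum derivD sum.distrib)

lemma fmul_add: "fmul n (\<lambda>i j. f i j + g i j) h i j = fmul n f h i j + fmul n g h i j"
  "fmul n h (\<lambda>i j. f i j + g i j) i j = fmul n h f i j + fmul n h g i j"
  by (simp_all add: fmul_def algebra_simps sum.distrib)

lemma fmul_diff: "fmul n (\<lambda>i j. f i j - g i j) h i j = fmul n f h i j - fmul n g h i j"
  "fmul n h (\<lambda>i j. f i j - g i j) i j = fmul n h f i j - fmul n h g i j"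
  by (simp_all add: fmul_def algebra_simps sum_subtractf)

lemma fmul_minus: "fmul n (\<lambda>i j. - f i j) h i j = - fmul n f h i j"
  "fmul n h (\<lambda>i j. - f i j) i j = - fmul n h f i j"
  by (simp_all add: fmul_def sum_negf)

section \<open>Operators on the differential polynomial ring\<close>

locale var_space =
  fixes n :: nat and pa :: "'a::field_char_0 \<Rightarrow> 'a"
  assumes pa: "deriv pa"
begin

text \<open>\<open>Var (v + k * N)\<close> is the \<open>k\<close>-th derivative of the generator \<open>Var v\<close>. The generators are the
  entries of the matrix \<open>xv\<close>, those of its intended inverse \<open>yv\<close>, and a dummy, which keeps their
  number positive when \<open>n = 0\<close>.\<close>

definition N :: nat where "N = 2 * (n * n) + 1"

definition xv :: "'a mp fmat" where
  "xv i j = (if i < n \<and> j < n then Var (i * n + j) else 0)"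

definition yv :: "'a mp fmat" where
  "yv i j = (if i < n \<and> j < n then Var (n * n + (i * n + j)) else 0)"

definition dummy :: "'a mp" where "dummy = Var (2 * (n * n))"

definition pd :: "'a mp \<Rightarrow> 'a mp" where
  "pd = mder (\<lambda>x. Cst (pa x)) (\<lambda>v. Var (v + N))"

definition spread :: "'b fmat \<Rightarrow> 'b fmat \<Rightarrow> 'b \<Rightarrow> nat \<Rightarrow> 'b" where
  "spread U V d v = (if v < n * n then U (v div n) (v mod n)
     else if v < 2 * (n * n) then V ((v - n * n) div n) ((v - n * n) mod n) else d)"

text \<open>The extension of \<open>\<phi>\<close> with \<open>X\<close> going to
  \<open>\<alpha> X\<close> and \<open>Y\<close> to \<open>Y \<beta>\<close>, where \<open>Y\<close>
  stands for the inverse of \<open>X\<close> and \<beta> will be the inverse of \<alpha>.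
  Commutation with \<open>pd\<close> forces the values on derivatives.\<close>

definition lin :: "('a \<Rightarrow> 'a) \<Rightarrow> 'a fmat \<Rightarrow> 'a fmat \<Rightarrow> 'a mp \<Rightarrow> 'a mp" where
  "lin \<phi> \<alpha> \<beta> = ev (\<lambda>x. Cst (\<phi> x))
     (\<lambda>v. (pd ^^ (v div N)) (spread (fmul n (fmap Cst \<alpha>) xv) (fmul n yv (fmap Cst \<beta>)) dummy (v mod N)))"

text \<open>The sign and the side of \<beta> in the second argument are those of the derivative of
  an inverse matrix.\<close>

definition dlin :: "('a \<Rightarrow> 'a) \<Rightarrow> 'a fmat \<Rightarrow> 'a mp \<Rightarrow> 'a mp" where
  "dlin d \<beta> = mder (\<lambda>x. Cst (d x))
     (\<lambda>v. (pd ^^ (v div N)) (spread (fmul n (fmap Cst \<beta>) xv) (\<lambda>i j. - fmul n yv (fmap Cst \<beta>) i j) 0 (v mod N)))"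

lemma entry_less: "i < n \<Longrightarrow> j < n \<Longrightarrow> i * n + j < n * n"
proof -
  assume "i < n" "j < n"
  then have "i * n + j < Suc i * n" by simp
  also have "\<dots> \<le> n * n" using \<open>i < n\<close> by (intro mult_right_mono) auto
  finally show ?thesis .
qed

lemma N_pos: "0 < N" by (simp add: N_def)

lemma spread_entry:
  "i < n \<Longrightarrow> j < n \<Longrightarrow> spread U V d (i * n + j) = U i j"
  "i < n \<Longrightarrow> j < n \<Longrightarrow> spread U V d (n * n + (i * n + j)) = V i j"
  "spread U V d (2 * (n * n)) = d"
  using entry_less[of i j] by (auto simp: spread_def)

lemma generator_cases:
  assumes "v < N"
  obtains i j where "i < n" "j < n" "v = i * n + j"
  | i j where "i < n" "j < n" "v = n * n + (i * n + j)"
  | "v = 2 * (n * n)"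
proof -
  consider "v < n * n" | "n * n \<le> v" "v - n * n < n * n" | "v = 2 * (n * n)"
  proof -
    have "v < n * n \<or> (n * n \<le> v \<and> v - n * n < n * n) \<or> v = 2 * (n * n)"
      using assms unfolding N_def by linarith
    then show thesis using that by blast
  qed
  then show thesis
  proof cases
    case 1
    then have "0 < n" by (cases n) auto
    with 1 show thesis by (intro that(1)[of "v div n" "v mod n"]) (auto simp: less_mult_imp_div_less)
  next
    case 2
    then have "0 < n" by (cases n) auto
    with 2 show thesis
      by (intro that(2)[of "(v - n * n) div n" "(v - n * n) mod n"]) (auto simp: less_mult_imp_div_less)
  qed (rule that(3))
qed

lemma pd: "deriv pd" "pd (Cst x) = Cst (pa x)" "pd (Var v) = Var (v + N)"
  unfolding pd_def by (intro mder; simp add: derivD[OF pa] Cst_simps)+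

lemma pd_power_Var: "(pd ^^ k) (Var v) = Var (v + k * N)"
  by (induction k) (auto simp: pd algebra_simps)

lemma Var_decomp: "Var v = (pd ^^ (v div N)) (Var (v mod N))"
  by (simp add: pd_power_Var)

lemma power_comm: "(\<And>x. f (pd x) = pd (f x)) \<Longrightarrow> f ((pd ^^ k) x) = (pd ^^ k) (f x)"
  by (induction k) auto

lemma lin:
  assumes "rhom \<phi>"
  shows "rhom (lin \<phi> \<alpha> \<beta>)" "lin \<phi> \<alpha> \<beta> (Cst x) = Cst (\<phi> x)"
    "lin \<phi> \<alpha> \<beta> (Var v) =
      (pd ^^ (v div N)) (spread (fmul n (fmap Cst \<alpha>) xv) (fmul n yv (fmap Cst \<beta>)) dummy (v mod N))"
proof -
  have h: "rhom (\<lambda>x. Cst (\<phi> x))" by (rule rhom_comp[OF Cst_rhom assms])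
  show "rhom (lin \<phi> \<alpha> \<beta>)" unfolding lin_def by (rule ev_rhom[OF h])
  show "lin \<phi> \<alpha> \<beta> (Cst x) = Cst (\<phi> x)" unfolding lin_def by (rule ev_Cst[OF h])
  show "lin \<phi> \<alpha> \<beta> (Var v) =
      (pd ^^ (v div N)) (spread (fmul n (fmap Cst \<alpha>) xv) (fmul n yv (fmap Cst \<beta>)) dummy (v mod N))"
    unfolding lin_def by (rule ev_Var[OF h])
qed

lemma dlin:
  assumes "deriv d"
  shows "deriv (dlin d \<beta>)" "dlin d \<beta> (Cst x) = Cst (d x)"
    "dlin d \<beta> (Var v) =
      (pd ^^ (v div N)) (spread (fmul n (fmap Cst \<beta>) xv) (\<lambda>i j. - fmul n yv (fmap Cst \<beta>) i j) 0 (v mod N))"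
  unfolding dlin_def by (intro mder; simp add: derivD[OF assms] Cst_simps)+

text \<open>One predicate for automorphisms and derivations, so that a single lemma treats all
  pairs. Agreement of the two composites passes to products because the mixed Leibniz terms of two
  derivations are symmetric.\<close>

definition endo :: "('a mp \<Rightarrow> 'a mp) \<Rightarrow> bool" where
  "endo f \<longleftrightarrow> rhom f \<or> deriv f"

lemma endo_comm:
  assumes "endo f" "endo g" "\<And>x. f (g (Cst x)) = g (f (Cst x))" "\<And>v. f (g (Var v)) = g (f (Var v))"
  shows "f (g p) = g (f p)"
proof (induction p rule: mp_induct)
  case (3 p q)
  then show ?case using assms(1,2) unfolding endo_def by (auto simp: rhomD derivD)
next
  case (4 p q)
  then show ?case using assms(1,2) unfolding endo_def by (auto simp: rhomD derivD algebra_simps)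
qed (use assms in auto)

text \<open>Every variable is an iterated \<open>pd\<close> of one of the \<open>N\<close>
  generators, and both operators pass through \<open>pd\<close>.\<close>

lemma endo_comm_gens:
  assumes e: "endo f" "endo g" and pd: "\<And>x. f (pd x) = pd (f x)" "\<And>x. g (pd x) = pd (g x)"
    and C: "\<And>x. f (g (Cst x)) = g (f (Cst x))" and V: "\<And>v. v < N \<Longrightarrow> f (g (Var v)) = g (f (Var v))"
  shows "f (g p) = g (f p)"
proof (rule endo_comm[OF e C])
  fix v
  have "v mod N < N" using N_pos by simp
  from V[OF this] show "f (g (Var v)) = g (f (Var v))"
    by (subst (1 2) Var_decomp) (simp only: power_comm[where f=f, OF pd(1)] power_comm[where f=g, OF pd(2)])
qed

lemma lin_pd:
  assumes "rhom \<phi>" "\<And>x. \<phi> (pa x) = pa (\<phi> x)"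
  shows "lin \<phi> \<alpha> \<beta> (pd x) = pd (lin \<phi> \<alpha> \<beta> x)"
proof (rule endo_comm)
  show "endo (lin \<phi> \<alpha> \<beta>)" "endo pd" using lin(1)[OF assms(1)] pd(1) by (auto simp: endo_def)
  show "lin \<phi> \<alpha> \<beta> (pd (Cst x)) = pd (lin \<phi> \<alpha> \<beta> (Cst x))" for x by (simp add: pd lin[OF assms(1)] assms(2))
  show "lin \<phi> \<alpha> \<beta> (pd (Var v)) = pd (lin \<phi> \<alpha> \<beta> (Var v))" for v
    using N_pos by (simp add: pd lin(3)[OF assms(1)])
qed

lemma dlin_pd:
  assumes "deriv d" "\<And>x. d (pa x) = pa (d x)"
  shows "dlin d \<beta> (pd x) = pd (dlin d \<beta> x)"
proof (rule endo_comm)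
  show "endo (dlin d \<beta>)" "endo pd" using dlin(1)[OF assms(1)] pd(1) by (auto simp: endo_def)
  show "dlin d \<beta> (pd (Cst x)) = pd (dlin d \<beta> (Cst x))" for x by (simp add: pd dlin[OF assms(1)] assms(2))
  show "dlin d \<beta> (pd (Var v)) = pd (dlin d \<beta> (Var v))" for v
    using N_pos by (simp add: pd dlin(3)[OF assms(1)])
qed

lemma fsupp_xv: "fsupp n xv" and fsupp_yv: "fsupp n yv"
  by (auto simp: fsupp_def xv_def yv_def)

lemma fsupp_Cst: "fsupp n f \<Longrightarrow> fsupp n (fmap Cst f)"
  by (rule fsupp_fmap) (simp_all add: Cst_simps)

lemma lin_small:
  assumes \<phi>: "rhom \<phi>" and w: "fsupp n \<alpha>" "fsupp n \<beta>"
  shows "fmap (lin \<phi> \<alpha> \<beta>) xv = fmul n (fmap Cst \<alpha>) xv" "fmap (lin \<phi> \<alpha> \<beta>) yv = fmul n yv (fmap Cst \<beta>)"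
    "lin \<phi> \<alpha> \<beta> dummy = dummy" "fmap (lin \<phi> \<alpha> \<beta>) (fmap Cst f) = fmap Cst (fmap \<phi> f)"
proof -
  have less: "i * n + j < N" "n * n + (i * n + j) < N" if "i < n" "j < n" for i j
    using entry_less[OF that] by (auto simp: N_def)
  note w1 = fsupp_fmul[OF fsupp_Cst[OF w(1)] fsupp_xv] and w2 = fsupp_fmul[OF fsupp_yv fsupp_Cst[OF w(2)]]
  show "fmap (lin \<phi> \<alpha> \<beta>) xv = fmul n (fmap Cst \<alpha>) xv"
  proof (intro ext)
    fix i j
    show "fmap (lin \<phi> \<alpha> \<beta>) xv i j = fmul n (fmap Cst \<alpha>) xv i j"
      using w1 less[of i j] spread_entry(1,2)[of i j]
      by (cases "i < n \<and> j < n") (auto simp: fmap_def xv_def[of i j] lin(3)[OF \<phi>] rhomD(4)[OF lin(1)[OF \<phi>]] fsupp_def)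
  qed
  show "fmap (lin \<phi> \<alpha> \<beta>) yv = fmul n yv (fmap Cst \<beta>)"
  proof (intro ext)
    fix i j
    show "fmap (lin \<phi> \<alpha> \<beta>) yv i j = fmul n yv (fmap Cst \<beta>) i j"
      using w2 less[of i j] spread_entry(1,2)[of i j]
      by (cases "i < n \<and> j < n") (auto simp: fmap_def yv_def[of i j] lin(3)[OF \<phi>] rhomD(4)[OF lin(1)[OF \<phi>]] fsupp_def)
  qed
  show "lin \<phi> \<alpha> \<beta> dummy = dummy" by (simp add: dummy_def lin(3)[OF \<phi>] N_def spread_entry)
  show "fmap (lin \<phi> \<alpha> \<beta>) (fmap Cst f) = fmap Cst (fmap \<phi> f)" by (intro ext) (simp add: fmap_def lin(2)[OF \<phi>])
qed

lemma dlin_small: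
  assumes d: "deriv d" and w: "fsupp n \<beta>"
  shows "fmap (dlin d \<beta>) xv = fmul n (fmap Cst \<beta>) xv" "fmap (dlin d \<beta>) yv = (\<lambda>i j. - fmul n yv (fmap Cst \<beta>) i j)"
    "dlin d \<beta> dummy = 0" "fmap (dlin d \<beta>) (fmap Cst f) = fmap Cst (fmap d f)"
proof -
  have less: "i * n + j < N" "n * n + (i * n + j) < N" if "i < n" "j < n" for i j
    using entry_less[OF that] by (auto simp: N_def)
  note w1 = fsupp_fmul[OF fsupp_Cst[OF w] fsupp_xv] and w2 = fsupp_fmul[OF fsupp_yv fsupp_Cst[OF w]]
  show "fmap (dlin d \<beta>) xv = fmul n (fmap Cst \<beta>) xv"
  proof (intro ext)
    fix i j
    show "fmap (dlin d \<beta>) xv i j = fmul n (fmap Cst \<beta>) xv i j"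
      using w1 less[of i j] spread_entry(1,2)[of i j]
      by (cases "i < n \<and> j < n") (auto simp: fmap_def xv_def[of i j] dlin(3)[OF d] derivD(3)[OF dlin(1)[OF d]] fsupp_def)
  qed
  show "fmap (dlin d \<beta>) yv = (\<lambda>i j. - fmul n yv (fmap Cst \<beta>) i j)"
  proof (intro ext)
    fix i j
    show "fmap (dlin d \<beta>) yv i j = - fmul n yv (fmap Cst \<beta>) i j"
      using w2 less[of i j] spread_entry(1,2)[of i j]
      by (cases "i < n \<and> j < n") (auto simp: fmap_def yv_def[of i j] dlin(3)[OF d] derivD(3)[OF dlin(1)[OF d]] fsupp_def)
  qed
  show "dlin d \<beta> dummy = 0" by (simp add: dummy_def dlin(3)[OF d] N_def spread_entry)
  show "fmap (dlin d \<beta>) (fmap Cst f) = fmap Cst (fmap d f)" by (intro ext) (simp add: fmap_def dlin(2)[OF d])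
qed

lemma gens_eqI:
  assumes "v < N" "fmap f xv = fmap g xv" "fmap f yv = fmap g yv" "f dummy = g dummy"
  shows "f (Var v) = g (Var v)"
  using assms(1)
proof (cases rule: generator_cases)
  case (1 i j)
  then show ?thesis using fun_cong[OF fun_cong[OF assms(2), of i], of j] by (simp add: fmap_def xv_def)
next
  case (2 i j)
  then show ?thesis using fun_cong[OF fun_cong[OF assms(3), of i], of j] by (simp add: fmap_def yv_def)
qed (use assms(4) in \<open>simp add: dummy_def\<close>)

text \<open>The composite multiplies \<open>X\<close> on the left by
  \<open>fmul n (fmap \<phi> \<alpha>') \<alpha>\<close> and \<open>Y\<close> on the right by
  \<open>fmul n \<beta> (fmap \<phi> \<beta>')\<close>; \<open>m\<close> says that both are the
  identity.\<close>

lemma lin_inverse: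
  assumes \<phi>: "rhom \<phi>" "\<And>x. \<phi> (pa x) = pa (\<phi> x)" and \<psi>: "rhom \<psi>" "\<And>x. \<psi> (pa x) = pa (\<psi> x)"
    and inv: "\<And>x. \<phi> (\<psi> x) = x"
    and w: "fsupp n \<alpha>" "fsupp n \<beta>" "fsupp n \<alpha>'" "fsupp n \<beta>'"
    and m: "fmul n (fmap \<phi> \<alpha>') \<alpha> = fone n" "fmul n \<beta> (fmap \<phi> \<beta>') = fone n"
  shows "lin \<phi> \<alpha> \<beta> (lin \<psi> \<alpha>' \<beta>' p) = p"
proof (rule rhom_eqI[of "\<lambda>p. lin \<phi> \<alpha> \<beta> (lin \<psi> \<alpha>' \<beta>' p)" "\<lambda>p. p"])
  note f = lin(1)[OF \<phi>(1), of \<alpha> \<beta>] and g = lin(1)[OF \<psi>(1), of \<alpha>' \<beta>']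
  note F = lin_small[OF \<phi>(1) w(1,2)] and G = lin_small[OF \<psi>(1) w(3,4)]
  show "rhom (\<lambda>p. lin \<phi> \<alpha> \<beta> (lin \<psi> \<alpha>' \<beta>' p))" by (rule rhom_comp[OF f g])
  show "rhom (\<lambda>p. p)" by (simp add: rhom_def)
  show "lin \<phi> \<alpha> \<beta> (lin \<psi> \<alpha>' \<beta>' (Cst x)) = Cst x" for x by (simp add: lin(2) \<phi> \<psi> inv)
  fix v
  have X: "fmap (\<lambda>p. lin \<phi> \<alpha> \<beta> (lin \<psi> \<alpha>' \<beta>' p)) xv = fmap (\<lambda>p. p) xv"
  proof -
    have "fmap (\<lambda>p. lin \<phi> \<alpha> \<beta> (lin \<psi> \<alpha>' \<beta>' p)) xv = fmap (lin \<phi> \<alpha> \<beta>) (fmap (lin \<psi> \<alpha>' \<beta>') xv)"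
      by (intro ext) (simp add: fmap_def)
    also have "\<dots> = fmul n (fmap Cst (fmul n (fmap \<phi> \<alpha>') \<alpha>)) xv"
      unfolding G(1) by (simp add: fmap_fmul[OF f] F fmap_fmul[OF Cst_rhom] fmul_assoc)
    finally show ?thesis unfolding m(1) by (simp add: fmap_fone[OF Cst_rhom] fmul_fone[OF fsupp_xv] fmap_id)
  qed
  have Y: "fmap (\<lambda>p. lin \<phi> \<alpha> \<beta> (lin \<psi> \<alpha>' \<beta>' p)) yv = fmap (\<lambda>p. p) yv"
  proof -
    have "fmap (\<lambda>p. lin \<phi> \<alpha> \<beta> (lin \<psi> \<alpha>' \<beta>' p)) yv = fmap (lin \<phi> \<alpha> \<beta>) (fmap (lin \<psi> \<alpha>' \<beta>') yv)"
      by (intro ext) (simp add: fmap_def)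
    also have "\<dots> = fmul n yv (fmap Cst (fmul n \<beta> (fmap \<phi> \<beta>')))"
      unfolding G(2) by (simp add: fmap_fmul[OF f] F fmap_fmul[OF Cst_rhom] fmul_assoc)
    finally show ?thesis unfolding m(2) by (simp add: fmap_fone[OF Cst_rhom] fmul_fone[OF fsupp_yv] fmap_id)
  qed
  have "v mod N < N" using N_pos by simp
  from gens_eqI[OF this X Y] have "lin \<phi> \<alpha> \<beta> (lin \<psi> \<alpha>' \<beta>' (Var (v mod N))) = Var (v mod N)"
    by (simp add: F G)
  then have "(pd ^^ (v div N)) (lin \<phi> \<alpha> \<beta> (lin \<psi> \<alpha>' \<beta>' (Var (v mod N)))) = Var v"
    by (simp add: Var_decomp[symmetric])
  moreover have "lin \<phi> \<alpha> \<beta> (lin \<psi> \<alpha>' \<beta>' ((pd ^^ (v div N)) (Var (v mod N)))) =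
      (pd ^^ (v div N)) (lin \<phi> \<alpha> \<beta> (lin \<psi> \<alpha>' \<beta>' (Var (v mod N))))"
    by (simp only: power_comm[where f="lin \<phi> \<alpha> \<beta>", OF lin_pd[OF \<phi>]] power_comm[where f="lin \<psi> \<alpha>' \<beta>'", OF lin_pd[OF \<psi>]])
  ultimately show "lin \<phi> \<alpha> \<beta> (lin \<psi> \<alpha>' \<beta>' (Var v)) = Var v"
    by (simp only: Var_decomp[of v, symmetric])
qed

lemma pd_below: "x \<in> vars_below j \<Longrightarrow> pd x \<in> vars_below (j + N)"
  by (rule shift_deriv_below[OF pd])

lemma pd_power_below: "x \<in> vars_below j \<Longrightarrow> (pd ^^ k) x \<in> vars_below (j + k * N)"
proof (induction k)
  case (Suc k)
  from pd_below[OF Suc.IH[OF Suc.prems]] show ?case by (simp add: add_ac)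
qed simp

lemma spread_below:
  assumes "\<And>i j. U i j \<in> vars_below N" "\<And>i j. V i j \<in> vars_below N" "d \<in> vars_below N"
  shows "(pd ^^ (v div N)) (spread U V d (v mod N)) \<in> vars_below (Suc (v div N) * N)"
proof -
  have "spread U V d (v mod N) \<in> vars_below N" using assms by (simp add: spread_def)
  from pd_power_below[OF this, of "v div N"] show ?thesis by (simp add: add_ac)
qed

lemma xv_below: "xv i j \<in> vars_below N" and yv_below: "yv i j \<in> vars_below N" and dummy_below: "dummy \<in> vars_below N"
proof -
  have "i * n + j < N" "n * n + (i * n + j) < N" if "i < n" "j < n"
    using entry_less[OF that] by (auto simp: N_def)
  then show "xv i j \<in> vars_below N" "yv i j \<in> vars_below N"
    by (auto simp: xv_def yv_def Var_in_vars_below intro: sringD(2)[OF vars_below_sring])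
  show "dummy \<in> vars_below N" unfolding dummy_def by (intro Var_in_vars_below) (simp add: N_def)
qed

lemma fmul_below: "(\<And>i j. f i j \<in> vars_below N) \<Longrightarrow> (\<And>i j. g i j \<in> vars_below N) \<Longrightarrow> fmul n f g i j \<in> vars_below N"
  unfolding fmul_def by (intro sring_sum[OF vars_below_sring] sringD(4)[OF vars_below_sring]) auto

lemma Cst_below: "fmap Cst f i j \<in> vars_below N"
  by (simp add: fmap_def Cst_in_vars_below)

lemma div_below: "v < r * N \<Longrightarrow> Suc (v div N) * N \<le> r * N"
proof -
  assume "v < r * N"
  then have "v div N < r" by (simp add: less_mult_imp_div_less)
  then show ?thesis by (intro mult_right_mono) auto
qed

lemma endo_below:
  assumes f: "endo f" "\<And>x. f (Cst x) \<in> Set.range Cst" "\<And>v. f (Var v) \<in> vars_below (Suc (v div N) * N)"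
    and x: "x \<in> vars_below (r * N)"
  shows "f x \<in> vars_below (r * N)"
  using x
proof (induction rule: vars_below_induct)
  case (Cst a) then show ?case using f(2)[of a] Cst_in_vars_below by auto
next
  case (Var i)
  then show ?case using f(3)[of i] vars_below_mono[OF div_below[OF Var]] by blast
next
  case (add p q)
  then show ?case using f(1) by (auto simp: endo_def rhomD derivD intro!: sringD(3)[OF vars_below_sring])
next
  case (mult p q)
  then show ?case using f(1)
    by (auto simp: endo_def rhomD derivD intro!: sringD(3)[OF vars_below_sring] sringD(4)[OF vars_below_sring])
qed

lemma lin_below: "rhom \<phi> \<Longrightarrow> x \<in> vars_below (r * N) \<Longrightarrow> lin \<phi> \<alpha> \<beta> x \<in> vars_below (r * N)"
  by (rule endo_below) (auto simp: endo_def lin(1,2) lin(3) intro!: spread_below fmul_below xv_below yv_below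
      dummy_below Cst_below simp del: mult_Suc)

lemma dlin_below: "deriv d \<Longrightarrow> x \<in> vars_below (r * N) \<Longrightarrow> dlin d \<beta> x \<in> vars_below (r * N)"
  by (rule endo_below) (auto simp: endo_def dlin(1,2) dlin(3) intro!: spread_below fmul_below xv_below yv_below
      sringD(2,5)[OF vars_below_sring] Cst_below simp del: mult_Suc)

end

lemma fmap_comp: "fmap (\<lambda>x. f (g x)) h = fmap f (fmap g h)"
  by (intro ext) (simp add: fmap_def)

lemma fmap_deriv_fmul:
  "deriv d \<Longrightarrow> fmap d (fmul n f g) = (\<lambda>i j. fmul n (fmap d f) g i j + fmul n f (fmap d g) i j)"
  by (intro ext) (simp add: deriv_fmul fmap_def[of d "fmul n f g"])

lemma fmap_deriv_fone: "deriv d \<Longrightarrow> fmap d (fone n) = (\<lambda>i j. 0)"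
  by (intro ext) (simp add: fmap_def fone_def derivD)

section \<open>Commuting operators from the integrability conditions, and the defining ideal\<close>

locale sd_data = var_space n pa
  for n :: nat and pa :: "'a::field_char_0 \<Rightarrow> 'a" +
  fixes Sig :: "'s set" and Del :: "'d set" and sg :: "'s \<Rightarrow> 'a \<Rightarrow> 'a" and dl :: "'d \<Rightarrow> 'a \<Rightarrow> 'a"
    and a a' :: "'s \<Rightarrow> 'a fmat" and b :: "'d \<Rightarrow> 'a fmat"
  assumes sg: "s \<in> Sig \<Longrightarrow> rhom (sg s)" "s \<in> Sig \<Longrightarrow> bij (sg s)"
    and dl: "d \<in> Del \<Longrightarrow> deriv (dl d)"
    and sg_sg: "s \<in> Sig \<Longrightarrow> t \<in> Sig \<Longrightarrow> sg s (sg t x) = sg t (sg s x)"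
    and sg_dl: "s \<in> Sig \<Longrightarrow> d \<in> Del \<Longrightarrow> sg s (dl d x) = dl d (sg s x)"
    and dl_dl: "d \<in> Del \<Longrightarrow> e \<in> Del \<Longrightarrow> dl d (dl e x) = dl e (dl d x)"
    and sg_pa: "s \<in> Sig \<Longrightarrow> sg s (pa x) = pa (sg s x)"
    and dl_pa: "d \<in> Del \<Longrightarrow> dl d (pa x) = pa (dl d x)"
    and fs: "s \<in> Sig \<Longrightarrow> fsupp n (a s)" "s \<in> Sig \<Longrightarrow> fsupp n (a' s)" "d \<in> Del \<Longrightarrow> fsupp n (b d)"
    and inv_a: "s \<in> Sig \<Longrightarrow> fmul n (a s) (a' s) = fone n" "s \<in> Sig \<Longrightarrow> fmul n (a' s) (a s) = fone n"
    and int_ss: "s \<in> Sig \<Longrightarrow> t \<in> Sig \<Longrightarrow>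
      fmul n (fmap (sg s) (a t)) (a s) = fmul n (fmap (sg t) (a s)) (a t)"
    and int_sd: "s \<in> Sig \<Longrightarrow> d \<in> Del \<Longrightarrow>
      fmul n (fmap (sg s) (b d)) (a s) = (\<lambda>i j. fmap (dl d) (a s) i j + fmul n (a s) (b d) i j)"
    and int_dd: "d \<in> Del \<Longrightarrow> e \<in> Del \<Longrightarrow>
      (\<lambda>i j. fmap (dl d) (b e) i j + fmul n (b e) (b d) i j) = (\<lambda>i j. fmap (dl e) (b d) i j + fmul n (b d) (b e) i j)"
begin

definition sig :: "'s \<Rightarrow> 'a mp \<Rightarrow> 'a mp" where "sig s = lin (sg s) (a s) (a' s)"
definition del :: "'d \<Rightarrow> 'a mp \<Rightarrow> 'a mp" where "del d = dlin (dl d) (b d)"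

lemma sig:
  assumes "s \<in> Sig"
  shows "rhom (sig s)" "sig s (Cst x) = Cst (sg s x)" "sig s (pd y) = pd (sig s y)"
    "fmap (sig s) xv = fmul n (fmap Cst (a s)) xv" "fmap (sig s) yv = fmul n yv (fmap Cst (a' s))"
    "sig s dummy = dummy" "fmap (sig s) (fmap Cst f) = fmap Cst (fmap (sg s) f)"
    "z \<in> vars_below (r * N) \<Longrightarrow> sig s z \<in> vars_below (r * N)"
  unfolding sig_def using lin[OF sg(1)[OF assms]] lin_pd[OF sg(1)[OF assms] sg_pa[OF assms]]
    lin_small[OF sg(1)[OF assms] fs(1,2)[OF assms]] lin_below[OF sg(1)[OF assms]] by blast+

lemma del:
  assumes "d \<in> Del"
  shows "deriv (del d)" "del d (Cst x) = Cst (dl d x)" "del d (pd y) = pd (del d y)"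
    "fmap (del d) xv = fmul n (fmap Cst (b d)) xv" "fmap (del d) yv = (\<lambda>i j. - fmul n yv (fmap Cst (b d)) i j)"
    "del d dummy = 0" "fmap (del d) (fmap Cst f) = fmap Cst (fmap (dl d) f)"
    "z \<in> vars_below (r * N) \<Longrightarrow> del d z \<in> vars_below (r * N)"
  unfolding del_def using dlin[OF dl[OF assms]] dlin_pd[OF dl[OF assms] dl_pa[OF assms]]
    dlin_small[OF dl[OF assms] fs(3)[OF assms]] dlin_below[OF dl[OF assms]] by blast+

text \<open>The two sides are a left and a right inverse of the same matrix \<open>U\<close>,
  written in the two ways that \<open>int_ss\<close> provides.\<close>

lemma int_ss_inverse:
  assumes s: "s \<in> Sig" and t: "t \<in> Sig"
  shows "fmul n (a' s) (fmap (sg s) (a' t)) = fmul n (a' t) (fmap (sg t) (a' s))"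
proof -
  define U L R where "U = fmul n (fmap (sg s) (a t)) (a s)"
    and "L = fmul n (a' s) (fmap (sg s) (a' t))" and "R = fmul n (a' t) (fmap (sg t) (a' s))"
  have w: "fsupp n L" "fsupp n R" unfolding L_def R_def using s t
    by (auto intro!: fsupp_fmul fsupp_fmap fs simp: rhomD[OF sg(1)])
  have wa: "fsupp n (a s)" "fsupp n (fmap (sg t) (a' s))" using s t
    by (auto intro!: fsupp_fmap fs simp: rhomD[OF sg(1)])
  have "fmul n L U = fmul n (a' s) (fmul n (fmul n (fmap (sg s) (a' t)) (fmap (sg s) (a t))) (a s))"
    by (simp add: L_def U_def fmul_assoc)
  also have "fmul n (fmap (sg s) (a' t)) (fmap (sg s) (a t)) = fone n"
    by (simp only: fmap_fmul[OF sg(1)[OF s], symmetric] inv_a[OF t] fmap_fone[OF sg(1)[OF s]])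
  finally have LU: "fmul n L U = fone n" by (simp add: fmul_fone wa inv_a s)
  have "fmul n U R = fmul n (fmap (sg t) (a s)) (fmul n (fmul n (a t) (a' t)) (fmap (sg t) (a' s)))"
    unfolding U_def R_def int_ss[OF s t] by (simp add: fmul_assoc)
  also have "\<dots> = fmap (sg t) (fmul n (a s) (a' s))"
    by (simp add: inv_a t fmul_fone wa fmap_fmul[OF sg(1)[OF t]])
  finally have UR: "fmul n U R = fone n" by (simp add: inv_a s fmap_fone[OF sg(1)[OF t]])
  have "L = fmul n L (fmul n U R)" by (simp add: UR fmul_fone w)
  also have "\<dots> = R" by (simp add: LU fmul_fone w flip: fmul_assoc)
  finally show ?thesis unfolding L_def R_def .
qed

text \<open>Differentiate the product of \<open>a s\<close> and \<open>a' s\<close>, which is the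
  identity, and replace the derivative of \<open>a s\<close> by means of
  \<open>int_sd\<close>.\<close>

lemma dl_inverse:
  assumes s: "s \<in> Sig" and d: "d \<in> Del"
  shows "fmap (dl d) (a' s) i j = fmul n (b d) (a' s) i j - fmul n (a' s) (fmap (sg s) (b d)) i j"
proof -
  define da da' sb where "da = fmap (dl d) (a s)" and "da' = fmap (dl d) (a' s)" and "sb = fmap (sg s) (b d)"
  note w = fs(1,2)[OF s] fs(3)[OF d]
  have wd: "fsupp n da'" "fsupp n sb" unfolding da'_def sb_def
    using w by (auto intro!: fsupp_fmap simp: derivD[OF dl[OF d]] rhomD[OF sg(1)[OF s]])
  have "(\<lambda>i j. fmul n da (a' s) i j + fmul n (a s) da' i j) = (\<lambda>i j. 0)"
    unfolding da_def da'_def fmap_deriv_fmul[OF dl[OF d], symmetric] inv_a[OF s] by (rule fmap_deriv_fone[OF dl[OF d]])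
  from fun_cong[OF fun_cong[OF this]] have e: "fmul n (a s) da' = (\<lambda>i j. - fmul n da (a' s) i j)"
    by (intro ext) (simp add: eq_neg_iff_add_eq_0 add.commute)
  have da: "da = (\<lambda>i j. fmul n sb (a s) i j - fmul n (a s) (b d) i j)"
    using fun_cong[OF fun_cong[OF int_sd[OF s d]]] unfolding da_def sb_def by (intro ext) simp
  have "da' i j = fmul n (a' s) (fmul n (a s) da') i j" by (simp add: inv_a s fmul_fone wd flip: fmul_assoc)
  also have "\<dots> = - fmul n (a' s) (fmul n da (a' s)) i j" unfolding e by (rule fmul_minus)
  also have "fmul n (a' s) (fmul n da (a' s)) i j =
      fmul n (fmul n (a' s) (fmul n sb (fmul n (a s) (a' s)))) (fone n) i j - fmul n (fmul n (fmul n (a' s) (a s)) (b d)) (a' s) i j"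
  proof -
    have "fmul n da (a' s) = (\<lambda>i j. fmul n (fmul n sb (a s)) (a' s) i j - fmul n (fmul n (a s) (b d)) (a' s) i j)"
      unfolding da by (intro ext) (rule fmul_diff)
    moreover have "fmul n (a' s) (fmul n (a s) f) = fmul n (fmul n (a' s) (a s)) f" for f
      by (simp add: fmul_assoc)
    ultimately show ?thesis by (simp add: fmul_diff fmul_assoc[of n f "a s" "a' s" for f] fmul_assoc[of n "a s"]
        inv_a[OF s] fmul_fone fsupp_fmul w wd)
  qed
  also have "\<dots> = fmul n (a' s) sb i j - fmul n (b d) (a' s) i j"
    by (simp add: inv_a[OF s] fmul_fone w wd fsupp_fmul)
  finally show ?thesis by (simp add: da'_def sb_def)
qed

lemma endo_ops: "s \<in> Sig \<Longrightarrow> endo (sig s)" "d \<in> Del \<Longrightarrow> endo (del d)"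
  by (auto simp: endo_def sig del)

text \<open>On \<open>X\<close> the composite acts by \<open>fmap (sg s) (a t)\<close> times
  \<open>a s\<close>, so \<open>int_ss\<close> is commutation on the entries of \<open>X\<close>,
  and \<open>int_ss_inverse\<close> is the same for \<open>Y\<close>. The conditions
  \<open>int_sd\<close> and \<open>int_dd\<close> play this role in the two lemmas that
  follow.\<close>

lemma sig_sig:
  assumes s: "s \<in> Sig" and t: "t \<in> Sig"
  shows "sig s (sig t p) = sig t (sig s p)"
proof (rule endo_comm_gens[OF endo_ops(1)[OF s] endo_ops(1)[OF t] sig(3)[OF s] sig(3)[OF t]])
  show "sig s (sig t (Cst x)) = sig t (sig s (Cst x))" for x by (simp add: sig s t sg_sg[OF s t])
  fix v assume v: "v < N"
  have x: "fmap (\<lambda>p. sig s (sig t p)) xv = fmul n (fmap Cst (fmul n (fmap (sg s) (a t)) (a s))) xv"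
    if "s \<in> Sig" "t \<in> Sig" for s t
    by (simp add: fmap_comp sig that fmap_fmul[OF sig(1)] fmap_fmul[OF Cst_rhom] fmul_assoc)
  have y: "fmap (\<lambda>p. sig s (sig t p)) yv = fmul n yv (fmap Cst (fmul n (a' s) (fmap (sg s) (a' t))))"
    if "s \<in> Sig" "t \<in> Sig" for s t
    by (simp add: fmap_comp sig that fmap_fmul[OF sig(1)] fmap_fmul[OF Cst_rhom] fmul_assoc)
  show "sig s (sig t (Var v)) = sig t (sig s (Var v))"
    by (rule gens_eqI[OF v]) (simp_all add: x y s t int_ss[OF s t] int_ss_inverse[OF s t] sig)
qed

lemma sig_del:
  assumes s: "s \<in> Sig" and d: "d \<in> Del"
  shows "sig s (del d p) = del d (sig s p)"
proof (rule endo_comm_gens[OF endo_ops(1)[OF s] endo_ops(2)[OF d] sig(3)[OF s] del(3)[OF d]])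
  note S = sig[OF s] and D = del[OF d]
  show "sig s (del d (Cst x)) = del d (sig s (Cst x))" for x by (simp add: S D sg_dl[OF s d])
  fix v assume v: "v < N"
  have "fmap (\<lambda>p. sig s (del d p)) xv = fmap (\<lambda>p. del d (sig s p)) xv"
  proof -
    have "fmap (\<lambda>p. sig s (del d p)) xv = fmul n (fmap Cst (fmul n (fmap (sg s) (b d)) (a s))) xv"
      by (simp add: fmap_comp S D fmap_fmul[OF S(1)] fmap_fmul[OF Cst_rhom] fmul_assoc)
    also have "fmap Cst (fmul n (fmap (sg s) (b d)) (a s)) =
        (\<lambda>i j. fmap Cst (fmap (dl d) (a s)) i j + fmul n (fmap Cst (a s)) (fmap Cst (b d)) i j)"
      unfolding int_sd[OF s d] fmap_fmul[OF Cst_rhom, symmetric] by (intro ext) (simp add: fmap_def Cst_simps)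
    also have "fmul n \<dots> xv = fmap (\<lambda>p. del d (sig s p)) xv"
      by (intro ext) (simp add: fmap_comp S D fmap_deriv_fmul[OF D(1)] fmul_add fmul_assoc)
    finally show ?thesis .
  qed
  moreover have "fmap (\<lambda>p. sig s (del d p)) yv = fmap (\<lambda>p. del d (sig s p)) yv"
  proof (intro ext)
    fix i j
    let ?C = "fmap (Cst :: 'a \<Rightarrow> _)"
    have m: "fmap (sig s) (\<lambda>i j. - f i j) = (\<lambda>i j. - fmap (sig s) f i j)" for f
      by (intro ext) (simp add: fmap_def rhomD[OF S(1)])
    have "fmap (\<lambda>p. sig s (del d p)) yv i j = - fmul n yv (?C (fmul n (a' s) (fmap (sg s) (b d)))) i j"
      by (simp add: fmap_comp S D m fmap_fmul[OF S(1)] fmap_fmul[OF Cst_rhom] fmul_assoc)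
    moreover have "fmap (\<lambda>p. del d (sig s p)) yv i j =
        - fmul n yv (?C (fmul n (b d) (a' s))) i j + fmul n yv (?C (fmap (dl d) (a' s))) i j"
      by (simp add: fmap_comp S D fmap_deriv_fmul[OF D(1)] fmul_minus fmap_fmul[OF Cst_rhom] fmul_assoc)
    moreover have "?C (fmap (dl d) (a' s)) = (\<lambda>i j. ?C (fmul n (b d) (a' s)) i j - ?C (fmul n (a' s) (fmap (sg s) (b d))) i j)"
      by (intro ext) (simp add: fmap_def[of Cst] dl_inverse[OF s d] Cst_simps)
    ultimately show "fmap (\<lambda>p. sig s (del d p)) yv i j = fmap (\<lambda>p. del d (sig s p)) yv i j"
      by (simp add: fmul_diff)
  qed
  ultimately show "sig s (del d (Var v)) = del d (sig s (Var v))"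
    by (intro gens_eqI[OF v, of "\<lambda>p. sig s (del d p)" "\<lambda>p. del d (sig s p)"])
      (simp_all add: S D rhomD[OF S(1)] derivD[OF D(1)])
qed

lemma del_del:
  assumes d: "d \<in> Del" and e: "e \<in> Del"
  shows "del d (del e p) = del e (del d p)"
proof (rule endo_comm_gens[OF endo_ops(2)[OF d] endo_ops(2)[OF e] del(3)[OF d] del(3)[OF e]])
  let ?C = "fmap (Cst :: 'a \<Rightarrow> _)"
  show "del d (del e (Cst x)) = del e (del d (Cst x))" for x by (simp add: del d e dl_dl[OF d e])
  fix v assume v: "v < N"
  have x: "fmap (\<lambda>p. del d (del e p)) xv =
      fmul n (?C (\<lambda>i j. fmap (dl d) (b e) i j + fmul n (b e) (b d) i j)) xv" if d: "d \<in> Del" and e: "e \<in> Del" for d e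
  proof -
    have "?C (\<lambda>i j. fmap (dl d) (b e) i j + fmul n (b e) (b d) i j) =
        (\<lambda>i j. ?C (fmap (dl d) (b e)) i j + fmul n (?C (b e)) (?C (b d)) i j)"
      unfolding fmap_fmul[OF Cst_rhom, symmetric] by (intro ext) (simp add: fmap_def Cst_simps)
    then show ?thesis
      by (intro ext) (simp add: fmap_comp del d e fmap_deriv_fmul[OF del(1)] fmul_add fmul_assoc)
  qed
  have y: "fmap (\<lambda>p. del d (del e p)) yv i j =
      fmul n yv (?C (fmul n (b d) (b e))) i j - fmul n yv (?C (fmap (dl d) (b e))) i j" if d: "d \<in> Del" and e: "e \<in> Del" for d e i j
  proof -
    have m: "fmap (del d) (\<lambda>i j. - f i j) = (\<lambda>i j. - fmap (del d) f i j)" for f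
      by (intro ext) (simp add: fmap_def derivD[OF del(1)[OF d]])
    show ?thesis
      by (simp add: fmap_comp del d e m fmap_deriv_fmul[OF del(1)] fmul_minus fmap_fmul[OF Cst_rhom] fmul_assoc)
  qed
  have yy: "fmap (\<lambda>p. del d (del e p)) yv i j = fmap (\<lambda>p. del e (del d p)) yv i j" for i j
  proof -
    have "?C (fmul n (b d) (b e)) i j - ?C (fmap (dl d) (b e)) i j = ?C (fmul n (b e) (b d)) i j - ?C (fmap (dl e) (b d)) i j" for i j
    proof -
      have "fmul n (b d) (b e) i j - fmap (dl d) (b e) i j = fmul n (b e) (b d) i j - fmap (dl e) (b d) i j"
        using fun_cong[OF fun_cong[OF int_dd[OF d e], of i], of j] by (simp add: algebra_simps)
      then show ?thesis by (simp add: fmap_def[of Cst] flip: Cst_simps(6))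
    qed
    then have "fmul n yv (\<lambda>i j. ?C (fmul n (b d) (b e)) i j - ?C (fmap (dl d) (b e)) i j) i j =
      fmul n yv (\<lambda>i j. ?C (fmul n (b e) (b d)) i j - ?C (fmap (dl e) (b d)) i j) i j" by simp
    then show ?thesis unfolding y[OF d e] y[OF e d] fmul_diff .
  qed
  show "del d (del e (Var v)) = del e (del d (Var v))"
  proof (rule gens_eqI[OF v, of "\<lambda>p. del d (del e p)" "\<lambda>p. del e (del d p)"])
    show "fmap (\<lambda>p. del d (del e p)) yv = fmap (\<lambda>p. del e (del d p)) yv" by (intro ext) (rule yy)
  qed (simp_all add: x d e int_dd[OF d e] del derivD[OF del(1)])
qed

abbreviation "SS \<equiv> sig ` Sig"
abbreviation "DD \<equiv> del ` Del"

lemma sig_bij: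
  assumes s: "s \<in> Sig"
  shows "bij (sig s)"
proof -
  define \<psi> where "\<psi> = inv_into UNIV (sg s)"
  note h = rhomD[OF sg(1)[OF s]]
  have inv1: "sg s (\<psi> x) = x" and inv2: "\<psi> (sg s x) = x" for x
    using sg(2)[OF s] unfolding \<psi>_def by (auto simp: bij_is_surj surj_f_inv_f bij_is_inj inv_f_f)
  have \<psi>: "rhom \<psi>" unfolding rhom_def
    by (metis h(1) h(2) h(3) inv1 inv2)
  have \<psi>pa: "\<psi> (pa x) = pa (\<psi> x)" for x using sg_pa[OF s, of "\<psi> x"] inv1 inv2 by metis
  \<comment> \<open>The inverse has the same form: applying the inverse of \<open>sg s\<close> to
    the equation for \<open>X\<close> shows which matrices it needs.\<close>
  define \<tau> where "\<tau> = lin \<psi> (fmap \<psi> (a' s)) (fmap \<psi> (a s))"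
  have w: "fsupp n (fmap \<psi> (a' s))" "fsupp n (fmap \<psi> (a s))"
    using fs(1,2)[OF s] by (auto intro!: fsupp_fmap rhomD[OF \<psi>])
  have id: "fmap (sg s) (fmap \<psi> f) = f" for f by (intro ext) (simp add: fmap_def inv1)
  have "sig s (\<tau> p) = p" for p unfolding sig_def \<tau>_def
    by (rule lin_inverse[OF sg(1)[OF s] sg_pa[OF s] \<psi> \<psi>pa inv1 fs(1,2)[OF s] w])
      (simp_all add: id inv_a[OF s])
  moreover have "\<tau> (sig s p) = p" for p unfolding sig_def \<tau>_def
    by (rule lin_inverse[OF \<psi> \<psi>pa sg(1)[OF s] sg_pa[OF s] inv2 w fs(1,2)[OF s]])
      (simp_all add: inv_a[OF s] fmap_fone[OF \<psi>] flip: fmap_fmul[OF \<psi>])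
  ultimately show ?thesis by (intro o_bij[of \<tau>]) (auto simp: fun_eq_iff)
qed

lemma tower: "sd_tower N SS DD pd pa"
proof
  show "0 < N" by (rule N_pos)
  show "s \<in> SS \<Longrightarrow> rhom s" "s \<in> SS \<Longrightarrow> bij s" for s using sig(1) sig_bij by auto
  show "d \<in> DD \<Longrightarrow> deriv d" for d using del(1) by auto
  show "f x \<in> vars_below (r * N)" if "f \<in> SS \<union> DD" "x \<in> vars_below (r * N)" for f x r
    using that sig(8) del(8) by auto
  show "f (g x) = g (f x)" if fg: "f \<in> SS \<union> DD" "g \<in> SS \<union> DD" for f g x
  proof -
    consider s t where "s \<in> Sig" "t \<in> Sig" "f = sig s" "g = sig t"
      | s d where "s \<in> Sig" "d \<in> Del" "f = sig s" "g = del d"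
      | s d where "s \<in> Sig" "d \<in> Del" "g = sig s" "f = del d"
      | d e where "d \<in> Del" "e \<in> Del" "f = del d" "g = del e" using fg by auto
    then show ?thesis
    proof cases
      case 1 then show ?thesis by (simp add: sig_sig[OF 1(1,2)])
    next
      case 2 then show ?thesis by (simp add: sig_del[OF 2(1,2)])
    next
      case 3 then show ?thesis by (simp add: sig_del[OF 3(1,2)])
    next
      case 4 then show ?thesis by (simp add: del_del[OF 4(1,2)])
    qed
  qed
  show "f (pd x) = pd (f x)" if "f \<in> SS \<union> DD" for f x using that sig(3) del(3) by auto
qed (rule pd)+

text \<open>The relations are imposed in order zero only; those between derivatives follow because
  the ideal from \<open>exists_tower\<close> is closed under \<open>pd\<close>.\<close>

definition J0 :: "'a mp set" where
  "J0 = {fmul n xv yv i j - fone n i j | i j. True} \<union> {fmul n yv xv i j - fone n i j | i j. True} \<union> {dummy}"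

lemma exists_pv_ideal:
  "\<exists>m. sd_quotient N SS DD pd pa m \<and> J0 \<subseteq> m"
proof -
  interpret T: sd_tower N SS DD pd pa by (rule tower)
  define B where "B = (vars_below N :: 'a mp set)"
  define I where "I = genid B J0"
  have B: "sring B" unfolding B_def by (rule vars_below_sring)
  have CB: "fmap Cst f i j \<in> B" for f i j unfolding B_def by (rule Cst_below)
  have JB: "J0 \<subseteq> B" unfolding J0_def B_def
    using dummy_below by (auto intro!: sringD(6)[OF vars_below_sring] fmul_below xv_below yv_below
      simp: fone_def sringD[OF vars_below_sring])
  have I: "ideal_on B I" unfolding I_def by (rule genid_ideal[OF B JB])
  have gens: "fmul n xv yv i j - fone n i j \<in> I" "fmul n yv xv i j - fone n i j \<in> I" "dummy \<in> I" for i j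
    unfolding I_def by (auto simp: J0_def intro!: genid.gen)
  define E where "E i j = fmul n xv yv i j - fone n i j" for i j
  have EC: "fmul n (fmap Cst f) (fmul n E (fmap Cst g)) i j \<in> I" "fmul n (fmap Cst f) E i j \<in> I"
    "fmul n E (fmap Cst f) i j \<in> I" for f g i j
    unfolding fmul_def[of n "fmap Cst f"] fmul_def[of n E] E_def
    by (intro ideal_on_sum[OF I] ideal_onD(5)[OF I CB] ideal_onD(6)[OF I CB] gens)+
  have f1: "fmul n (fone n) (fone n) = (fone n :: 'a mp fmat)" by (rule fmul_fone[OF fsupp_fone])
  have sigJ: "sig s g \<in> I" if s: "s \<in> Sig" and g: "g \<in> J0" for s g
  proof -
    note S = sig[OF s] and h = rhomD[OF sig(1)[OF s]]
    have fo: "sig s (fone n i j) = fone n i j" for i j by (simp add: fone_def h)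
    have XY: "fmap (sig s) (fmul n xv yv) = fmul n (fmap Cst (a s)) (fmul n (fmul n xv yv) (fmap Cst (a' s)))"
      by (simp add: fmap_fmul[OF S(1)] S fmul_assoc)
    have CC: "fmul n (fmap Cst (a s)) (fmap Cst (a' s)) = fone n" "fmul n (fmap Cst (a' s)) (fmap Cst (a s)) = fone n"
      by (simp_all add: inv_a[OF s] fmap_fone[OF Cst_rhom] flip: fmap_fmul[OF Cst_rhom])
    have wa: "fsupp n (fmap Cst (a' s))" by (rule fsupp_Cst[OF fs(2)[OF s]])
    have YX: "fmap (sig s) (fmul n yv xv) = fmul n yv xv"
    proof -
      have "fmap (sig s) (fmul n yv xv) = fmul n yv (fmul n (fmul n (fmap Cst (a' s)) (fmap Cst (a s))) xv)"
        by (simp add: fmap_fmul[OF S(1)] S fmul_assoc)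
      then show ?thesis by (simp add: CC fmul_fone[OF fsupp_xv])
    qed
    \<comment> \<open>The defect \<open>E\<close> of \<open>X Y\<close> from the identity is
      transformed into \<open>a E a'\<close>, whose entries are combinations of entries of
      \<open>E\<close>; the other defect is fixed.\<close>
    have 1: "sig s (fmul n xv yv i j - fone n i j) = fmul n (fmap Cst (a s)) (fmul n E (fmap Cst (a' s))) i j" for i j
    proof -
      have "fmul n E (fmap Cst (a' s)) = (\<lambda>i j. fmul n (fmul n xv yv) (fmap Cst (a' s)) i j - fmap Cst (a' s) i j)"
      proof -
        have "E = (\<lambda>i j. fmul n xv yv i j - fone n i j)" by (intro ext) (rule E_def)
        then show ?thesis by (intro ext) (simp add: fmul_diff fmul_fone[OF wa])
      qed
      then have "fmul n (fmap Cst (a s)) (fmul n E (fmap Cst (a' s))) i j =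
          fmap (sig s) (fmul n xv yv) i j - fone n i j" by (simp add: fmul_diff XY CC)
      then show ?thesis by (simp add: h fo fmap_def[of "sig s"])
    qed
    have 2: "sig s (fmul n yv xv i j - fone n i j) = fmul n yv xv i j - fone n i j" for i j
      using fun_cong[OF fun_cong[OF YX, of i], of j] by (simp add: h fo fmap_def[of "sig s"])
    show ?thesis using g EC(1) gens S(6) unfolding J0_def by (auto simp: 1 2)
  qed
  have delJ: "del d g \<in> I" if d: "d \<in> Del" and g: "g \<in> J0" for d g
  proof -
    note D = del[OF d] and h = derivD[OF del(1)[OF d]]
    have fo: "del d (fone n i j) = 0" for i j by (simp add: fone_def h)
    have wb: "fsupp n (fmap Cst (b d))" by (rule fsupp_Cst[OF fs(3)[OF d]])
    \<comment> \<open>The derivative of the defect is its commutator with the system matrix.\<close>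
    have 1: "del d (fmul n xv yv i j - fone n i j) = fmul n (fmap Cst (b d)) E i j - fmul n E (fmap Cst (b d)) i j" for i j
    proof -
      have "del d (fmul n xv yv i j) = fmul n (fmap Cst (b d)) (fmul n xv yv) i j - fmul n (fmul n xv yv) (fmap Cst (b d)) i j"
        by (simp add: deriv_fmul[OF D(1)] D fmul_minus fmul_assoc)
      moreover have "E = (\<lambda>i j. fmul n xv yv i j - fone n i j)" by (intro ext) (rule E_def)
      ultimately show ?thesis by (simp add: h fo fmul_diff fmul_fone[OF wb])
    qed
    have 2: "del d (fmul n yv xv i j - fone n i j) = 0" for i j
      by (simp add: h fo deriv_fmul[OF D(1)] D fmul_minus fmul_assoc)
    show ?thesis using g D(6) EC(2,3) ideal_onD(3)[OF I] ideal_on_diff[OF I B] unfolding J0_def by (auto simp: 1 2)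
  qed
  have one: "1 \<notin> I"
  proof
    assume "1 \<in> I"
    \<comment> \<open>Identity matrices satisfy \<open>J0\<close>, with 0 for the dummy. Indices
      beyond the generators fall into the last case of \<open>spread\<close>, so derivatives go to 0
      as well. The evaluation need not respect the operators, as \<open>I\<close> is the plain ideal
      generated by \<open>J0\<close>.\<close>
    define \<xi> where "\<xi> = spread (fone n) (fone n) (0 :: 'a)"
    define \<epsilon> where "\<epsilon> = ev (\<lambda>x. x) \<xi>"
    have id: "rhom (\<lambda>x :: 'a. x)" by (simp add: rhom_def)
    note e = ev_rhom[OF id, of \<xi>, folded \<epsilon>_def] and eV = ev_Var[OF id, of \<xi>, folded \<epsilon>_def]
    have x: "fmap \<epsilon> xv = fone n" "fmap \<epsilon> yv = fone n"
      by (intro ext; simp add: fmap_def xv_def yv_def eV \<xi>_def spread_entry rhomD[OF e] fone_def)+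
    have "\<epsilon> g = 0" if "g \<in> J0" for g
    proof -
      have z: "\<epsilon> (fmul n f g i j - fone n i j) = 0" if "fmap \<epsilon> f = fone n" "fmap \<epsilon> g = fone n" for f g i j
      proof -
        have "\<epsilon> (fmul n f g i j) = fmap \<epsilon> (fmul n f g) i j" by (simp add: fmap_def)
        also have "\<dots> = fone n i j" by (simp add: fmap_fmul[OF e] that fmul_fone[OF fsupp_fone])
        finally show ?thesis by (simp add: rhomD[OF e] fone_def)
      qed
      have "\<epsilon> dummy = 0" by (simp add: dummy_def eV \<xi>_def spread_entry)
      then show ?thesis using \<open>g \<in> J0\<close> z[OF x] z[OF x(2,1)] by (auto simp: J0_def)
    qed
    from genid_kernel[OF e this \<open>1 \<in> I\<close>[unfolded I_def]] show False by (simp add: rhomD(1)[OF e])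
  qed
  have "stable (SS \<union> DD) I" unfolding stable_def
  proof (intro ballI)
    fix f x assume f: "f \<in> SS \<union> DD" and x: "x \<in> I"
    have fB: "f z \<in> B" if "z \<in> B" for z using T.below[OF f, of z 1] that by (simp add: B_def)
    from f show "f x \<in> I"
    proof
      assume f': "f \<in> SS"
      then have "rhom f" "\<And>g. g \<in> J0 \<Longrightarrow> f g \<in> genid B J0" using sig(1) sigJ by (auto simp: I_def)
      from genid_rhom[OF this fB] x show ?thesis by (simp add: I_def)
    next
      assume f': "f \<in> DD"
      then have "deriv f" "\<And>g. g \<in> J0 \<Longrightarrow> f g \<in> genid B J0" using del(1) delJ by (auto simp: I_def)
      from genid_deriv[OF this fB] x show ?thesis by (simp add: I_def)
    qed
  qed
  moreover have "ideal_on (T.P 1) I" using I by (simp add: B_def)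
  ultimately obtain m where m: "max_stable_ideal (SS \<union> DD) UNIV m" "I \<subseteq> m" "\<forall>x\<in>m. pd x \<in> m"
    "\<forall>r. max_stable_ideal (SS \<union> DD) (T.P (Suc r)) (m \<inter> T.P (Suc r))"
    using T.exists_tower[OF _ _ one] by blast
  have "sd_quotient N SS DD pd pa m"
  proof (unfold_locales; (fact m(1) | (use m(3) in blast) | (use m(4) in blast) | -))
    fix s x assume "s \<in> SS"
    then obtain t where t: "t \<in> Sig" "s = sig t" by blast
    obtain y where "sg t y = x" using sg(2)[OF t(1)] by (metis bij_pointE)
    then show "\<exists>y. s (Cst y) = Cst x" using sig(2)[OF t(1)] t(2) by metis
  qed
  moreover have "J0 \<subseteq> m" using m(2) unfolding I_def by (auto intro: genid.gen)
  ultimately show ?thesis by blast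
qed

end

section \<open>The Picard-Vessiot ring on a subset of the base field\<close>

lemma det_in_sring:
  assumes "sring S" "M \<in> carrier_mat k k" "\<And>i j. i < k \<Longrightarrow> j < k \<Longrightarrow> M $$ (i, j) \<in> S"
  shows "det M \<in> S"
  unfolding det_def'[OF assms(2)]
proof (intro sring_sum[OF assms(1)] sringD(4)[OF assms(1)] sring_prod[OF assms(1)])
  fix p assume p: "p \<in> {p. p permutes {0..<k}}"
  show "signof p \<in> S" using sringD[OF assms(1)] by (simp add: sign_def)
  fix i assume "i \<in> {0..<k}"
  then show "M $$ (i, p i) \<in> S" using p permutes_in_image[of p "{0..<k}" i] by (intro assms(3)) auto
qed

definition fdet :: "nat \<Rightarrow> 'b::comm_ring_1 fmat \<Rightarrow> 'b" where
  "fdet n f = (\<Sum>p | p permutes {..<n}. if evenperm p then \<Prod>i<n. f i (p i) else - (\<Prod>i<n. f i (p i)))"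

lemma fdet_det: "fdet n f = det (mat n n (\<lambda>(i, j). f i j))"
proof -
  have "(if evenperm p then \<Prod>i<n. f i (p i) else - (\<Prod>i<n. f i (p i))) =
      signof p * (\<Prod>i = 0..<n. mat n n (\<lambda>(i, j). f i j) $$ (i, p i))" if p: "p permutes {..<n}" for p
  proof -
    have "(\<Prod>i = 0..<n. mat n n (\<lambda>(i, j). f i j) $$ (i, p i)) = (\<Prod>i<n. f i (p i))"
      unfolding atLeast0LessThan using permutes_in_image[OF p] by (intro prod.cong) auto
    then show ?thesis by (simp add: sign_def)
  qed
  then show ?thesis
    unfolding fdet_def det_def'[OF mat_carrier] atLeast0LessThan by (intro sum.cong) auto
qed

lemma mat_fmul: "mat n n (\<lambda>(i, j). fmul n f g i j) = mat n n (\<lambda>(i, j). f i j) * mat n n (\<lambda>(i, j). g i j)"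
  by (intro eq_matI) (auto simp: fmul_def scalar_prod_def atLeast0LessThan intro!: sum.cong)

lemma fdet_fmul: "fdet n (fmul n f g) = fdet n f * fdet n g"
  unfolding fdet_det mat_fmul by (rule det_mult) auto

lemma fdet_fone: "fdet n (fone n) = 1"
proof -
  have "mat n n (\<lambda>(i, j). fone n i j) = 1\<^sub>m n" by (intro eq_matI) (auto simp: fone_def)
  then have "fdet n (fone n) = det (1\<^sub>m n)" unfolding fdet_det by (rule arg_cong)
  then show ?thesis by simp
qed

text \<open>Needed because the prescribed generators are the entries of \<open>Z\<close> and the
  inverse determinant, not the entries of the inverse matrix.\<close>

lemma exists_fadj:
  assumes S: "sring S" "\<And>i j. f i j \<in> S"
  shows "\<exists>g. (\<forall>i j. g i j \<in> S) \<and> (\<forall>i<n. \<forall>j<n. fmul n g f i j = fdet n f * fone n i j)"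
proof -
  define M where "M = mat n n (\<lambda>(i, j). f i j)"
  have M: "M \<in> carrier_mat n n" by (simp add: M_def)
  define g where "g i j = (if i < n \<and> j < n then adj_mat M $$ (i, j) else 0)" for i j
  have "g i j \<in> S" for i j
  proof (cases "i < n \<and> j < n")
    case True
    have "det (mat_delete M j i) \<in> S"
      by (rule det_in_sring[OF S(1) mat_delete_carrier[OF M]])
        (use True in \<open>auto simp: mat_delete_def M_def S(2)\<close>)
    then have "cofactor M j i \<in> S" unfolding cofactor_def
      using sringD[OF S(1)] by (intro sringD(4)[OF S(1)] sring_power[OF S(1)]) auto
    then show ?thesis using True by (simp add: g_def adj_mat_def M_def)
  qed (use sringD(2)[OF S(1)] in \<open>auto simp: g_def\<close>)
  moreover have "fmul n g f i j = fdet n f * fone n i j" if ij: "i < n" "j < n" for i j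
  proof -
    have "(adj_mat M * M) $$ (i, j) = (det M \<cdot>\<^sub>m 1\<^sub>m n) $$ (i, j)" by (simp add: adj_mat(3)[OF M])
    moreover have "(adj_mat M * M) $$ (i, j) = fmul n g f i j"
      using ij adj_mat(1)[OF M] M
      by (auto simp: fmul_def g_def M_def scalar_prod_def atLeast0LessThan intro!: sum.cong)
    ultimately show ?thesis using ij by (simp add: fdet_det M_def[symmetric] fone_def)
  qed
  ultimately show ?thesis by blast
qed

text \<open>A surjection \<open>q\<close> with fibres the cosets of \<open>m\<close> replaces the quotient map, so that the quotient
  lives on a subset of an arbitrary large enough type.\<close>

locale pv_quotient = sd_data n pa Sig Del sg dl a a' b
  for n and pa :: "'a::field_char_0 \<Rightarrow> 'a" and Sig :: "'s set" and Del :: "'d set" and sg dl a a' b +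
  fixes m :: "'a mp set" and q :: "'a mp \<Rightarrow> 'a"
  assumes Qm: "sd_quotient N SS DD pd pa m" and J0: "J0 \<subseteq> m"
    and q: "q x = q y \<longleftrightarrow> x - y \<in> m"

sublocale pv_quotient \<subseteq> Q: sd_quotient N SS DD pd pa m by (rule Qm)

section \<open>The quotient as a Picard-Vessiot ring\<close>

context pv_quotient
begin

definition rp :: "'a \<Rightarrow> 'a mp" where "rp u = (SOME x. q x = u)"

definition R :: "('a, 's, 'd) op_ring" where
  "R = \<lparr>carrier = Set.range q, monoid.mult = (\<lambda>u v. q (rp u * rp v)), one = q 1, ring.zero = q 0,
     add = (\<lambda>u v. q (rp u + rp v)), aut = (\<lambda>s u. q (sig s (rp u))), der = (\<lambda>d u. q (del d (rp u))),
     par = (\<lambda>u. q (pd (rp u)))\<rparr>"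

lemma q_rp: "q (rp (q x)) = q x"
  unfolding rp_def by (rule someI) (rule refl)

lemma rp_m: "rp (q x) - x \<in> m"
  using q_rp q by blast

lemma q_0_iff: "q x = q 0 \<longleftrightarrow> x \<in> m"
  by (simp add: q)

lemma R_simps:
  "carrier R = Set.range q" "\<one>\<^bsub>R\<^esub> = q 1" "\<zero>\<^bsub>R\<^esub> = q 0"
  "q x \<otimes>\<^bsub>R\<^esub> q y = q (x * y)" "q x \<oplus>\<^bsub>R\<^esub> q y = q (x + y)" "par R (q x) = q (pd x)"
proof -
  show "carrier R = Set.range q" "\<one>\<^bsub>R\<^esub> = q 1" "\<zero>\<^bsub>R\<^esub> = q 0" by (simp_all add: R_def)
  have "rp (q x) * rp (q y) - x * y = rp (q x) * (rp (q y) - y) + (rp (q x) - x) * y"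
    by (simp add: algebra_simps)
  also have "\<dots> \<in> m" by (rule Q.mI(4)[OF Q.mI(5)[OF UNIV_I rp_m] Q.mI(6)[OF UNIV_I rp_m]])
  finally show "q x \<otimes>\<^bsub>R\<^esub> q y = q (x * y)" by (simp add: R_def q)
  have "rp (q x) + rp (q y) - (x + y) = (rp (q x) - x) + (rp (q y) - y)" by simp
  also have "\<dots> \<in> m" by (rule Q.mI(4)[OF rp_m rp_m])
  finally show "q x \<oplus>\<^bsub>R\<^esub> q y = q (x + y)" by (simp add: R_def q)
  have "pd (rp (q x)) - pd x \<in> m" using Q.pd_m[OF rp_m[of x]] by (simp add: derivD[OF pd(1)])
  then show "par R (q x) = q (pd x)" by (simp add: R_def q)
qed

lemma R_aut: "s \<in> Sig \<Longrightarrow> aut R s (q x) = q (sig s x)"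
  using Q.m_stable[of "sig s", OF _ rp_m[of x]] by (simp add: R_def q rhomD[OF sig(1)])

lemma R_der: "d \<in> Del \<Longrightarrow> der R d (q x) = q (del d x)"
  using Q.m_stable[of "del d", OF _ rp_m[of x]] by (simp add: R_def q derivD[OF del(1)])

lemma cring_R: "cring R"
proof (rule cringI)
  show "abelian_group R"
  proof (rule abelian_groupI)
    fix x assume "x \<in> carrier R"
    then obtain y where "x = q y" by (auto simp: R_simps)
    then show "\<exists>z\<in>carrier R. z \<oplus>\<^bsub>R\<^esub> x = \<zero>\<^bsub>R\<^esub>"
      by (intro bexI[of _ "q (- y)"]) (simp_all add: R_simps)
  qed (auto simp: R_simps add_ac)
  show "comm_monoid R" by (rule comm_monoidI) (auto simp: R_simps mult_ac)
qed (auto simp: R_simps algebra_simps)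

interpretation R: cring R by (rule cring_R)

lemma q_in_R [simp]: "q x \<in> carrier R"
  by (simp add: R_simps)

lemma R_uminus: "\<ominus>\<^bsub>R\<^esub> q x = q (- x)"
  by (rule R.minus_equality) (simp_all add: R_simps)

lemma R_finsum: "finite S \<Longrightarrow> finsum R (\<lambda>i. q (f i)) S = q (sum f S)"
  by (induction S rule: finite_induct) (auto simp: R_simps R.finsum_insert)

lemma R_finprod: "finite S \<Longrightarrow> finprod R (\<lambda>i. q (f i)) S = q (prod f S)"
  by (induction S rule: finite_induct) (auto simp: R_simps R.finprod_insert)

lemma operatorsE:
  assumes "f \<in> operators Sig Del R"
  obtains g where "g \<in> SS \<union> DD \<union> {pd}" "\<And>x. f (q x) = q (g x)"
proof -
  consider s where "s \<in> Sig" "f = aut R s" | d where "d \<in> Del" "f = der R d" | "f = par R"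
    using assms unfolding operators_def by blast
  then show thesis
  proof cases
    case 1 then show thesis by (intro that[of "sig s" for s]) (auto simp: R_aut)
  next
    case 2 then show thesis by (intro that[of "del d" for d]) (auto simp: R_der)
  next
    case 3 then show thesis by (intro that[of pd]) (auto simp: R_simps)
  qed
qed

lemma R_derivation: "deriv g \<Longrightarrow> (\<And>x. f (q x) = q (g x)) \<Longrightarrow> derivation R f"
  unfolding derivation_def by (auto simp: R_simps derivD)

lemma sdp_ring_R: "sdp_ring Sig Del R"
proof
  fix s assume s: "s \<in> Sig"
  note h = rhomD[OF sig(1)[OF s]]
  show "aut R s \<in> ring_iso R R"
  proof (rule ring_iso_memI)
    show "bij_betw (aut R s) (carrier R) (carrier R)"
    proof (rule bij_betwI')
      fix x y assume "x \<in> carrier R" "y \<in> carrier R"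
      then obtain x' y' where xy: "x = q x'" "y = q y'" by (auto simp: R_simps)
      show "aut R s x = aut R s y \<longleftrightarrow> x = y"
        using Q.SS_reflect[of "sig s" "x' - y'"] Q.m_stable[of "sig s" "x' - y'"] s
        by (auto simp: xy R_aut q h)
    next
      fix y assume "y \<in> carrier R"
      then obtain y' where "y = q y'" by (auto simp: R_simps)
      moreover obtain z where "sig s z = y'" using sig_bij[OF s] by (metis bij_pointE)
      ultimately show "\<exists>x\<in>carrier R. y = aut R s x" using R_aut[OF s, of z] by (intro bexI[of _ "q z"]) auto
    qed (auto simp: R_simps(1) R_aut[OF s])
  qed (auto simp: R_simps R_aut[OF s] h)
next
  show "derivation R (der R d)" if "d \<in> Del" for d
    by (rule R_derivation[OF del(1)[OF that] R_der[OF that]])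
  show "derivation R (par R)" by (rule R_derivation[OF pd(1) R_simps(6)])
  fix f g x assume f: "f \<in> operators Sig Del R" and g: "g \<in> operators Sig Del R" and "x \<in> carrier R"
  obtain f' where f': "f' \<in> SS \<union> DD \<union> {pd}" "\<And>x. f (q x) = q (f' x)" using operatorsE[OF f] by blast
  obtain g' where g': "g' \<in> SS \<union> DD \<union> {pd}" "\<And>x. g (q x) = q (g' x)" using operatorsE[OF g] by blast
  obtain y where y: "x = q y" using \<open>x \<in> carrier R\<close> by (auto simp: R_simps)
  have "f' (g' y) = g' (f' y)" using f'(1) g'(1) Q.comm[of f' g' y] Q.comm_pd by auto
  then show "f (g x) = g (f x)" by (simp add: f'(2) g'(2) y)
qed

definition h :: "'a \<Rightarrow> 'a" where "h x = q (Cst x)"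

lemma sd_simple_R: "sd_simple Sig Del R"
  unfolding sd_simple_def
proof (intro conjI allI impI)
  have "q 1 \<noteq> q 0" using q_0_iff Q.m_ideal(3) by simp
  then show "carrier R \<noteq> {\<zero>\<^bsub>R\<^esub>}" by (auto simp: R_simps)
  fix I assume "sd_ideal Sig Del I R"
  then have I: "ideal I R" "\<And>s. s \<in> Sig \<Longrightarrow> aut R s ` I \<subseteq> I" "\<And>d. d \<in> Del \<Longrightarrow> der R d ` I \<subseteq> I"
    by (auto simp: sd_ideal_def)
  interpret I: ideal I R by (rule I(1))
  define J where "J = {x. q x \<in> I}"
  have mJ: "m \<subseteq> J" using I.zero_closed by (auto simp: J_def R_simps simp flip: q_0_iff)
  have J: "ideal_on UNIV J" unfolding ideal_on_def J_def
    using I.a_closed I.I_l_closed I.zero_closed by (auto simp: R_simps simp flip: R_simps(4,5))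
  have st: "stable (SS \<union> DD) J" unfolding stable_def J_def
    using I(2,3) R_aut R_der by (fastforce simp: image_subset_iff)
  have IJ: "I = q ` J" using I.Icarr by (auto simp: J_def R_simps image_iff)
  show "I = {\<zero>\<^bsub>R\<^esub>} \<or> I = carrier R"
  proof (cases "1 \<in> J")
    case True
    then have "J = UNIV" using ideal_onD(5)[OF J, of x 1 for x] by auto
    then show ?thesis by (simp add: IJ R_simps)
  next
    case False
    then have "J = m" using Q.m_max[OF J st mJ] by blast
    then have "I = {\<zero>\<^bsub>R\<^esub>}" using Q.mI(3) q_0_iff by (auto simp: IJ R_simps)
    then show ?thesis ..
  qed
qed

definition Z :: "'a mat" where "Z = mat n n (\<lambda>(i, j). q (xv i j))"
definition W :: "'a mat" where "W = mat n n (\<lambda>(i, j). q (yv i j))"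

lemma q_xy: "q (fmul n xv yv i j) = q (fone n i j)" "q (fmul n yv xv i j) = q (fone n i j)" "q dummy = q 0"
  using J0 unfolding q by (auto simp: J0_def)

lemma mats_R: "mat n n (\<lambda>(i, j). q (f i j)) \<in> mats R n"
  by (auto simp: mats_def)

lemma mmul_R: "mmul R n (mat n n (\<lambda>(i, j). q (f i j))) (mat n n (\<lambda>(i, j). q (g i j))) = mat n n (\<lambda>(i, j). q (fmul n f g i j))"
proof (intro eq_matI)
  fix i j assume ij: "i < dim_row (mat n n (\<lambda>(i, j). q (fmul n f g i j)))" "j < dim_col (mat n n (\<lambda>(i, j). q (fmul n f g i j)))"
  have "mmul R n (mat n n (\<lambda>(i, j). q (f i j))) (mat n n (\<lambda>(i, j). q (g i j))) $$ (i, j) =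
      finsum R (\<lambda>k. q (f i k * g k j)) {..<n}"
    using ij by (auto simp: mmul_def R_simps intro!: R.finsum_cong')
  then show "mmul R n (mat n n (\<lambda>(i, j). q (f i j))) (mat n n (\<lambda>(i, j). q (g i j))) $$ (i, j) =
      mat n n (\<lambda>(i, j). q (fmul n f g i j)) $$ (i, j)"
    using ij by (simp add: R_finsum fmul_def)
qed (auto simp: mmul_def)

lemma mone_R: "mone R n = mat n n (\<lambda>(i, j). q (fone n i j))"
  by (intro eq_matI) (auto simp: mone_def fone_def R_simps)

lemma Z_GL: "Z \<in> GL R n"
proof -
  have "mmul R n Z W = mone R n" "mmul R n W Z = mone R n"
    unfolding Z_def W_def mmul_R mone_R q_xy by simp_all
  then show ?thesis unfolding GL_def using mats_R by (auto simp: Z_def W_def)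
qed

lemma map_mat_h:
  "M \<in> carrier_mat n n \<Longrightarrow> (\<And>i j. i < n \<Longrightarrow> j < n \<Longrightarrow> M $$ (i, j) = c i j) \<Longrightarrow>
    map_mat h M = mat n n (\<lambda>(i, j). q (fmap Cst c i j))"
  by (intro eq_matI) (auto simp: h_def fmap_def)

lemma map_mat_Z: "(\<And>x. f (q x) = q (g x)) \<Longrightarrow> map_mat f Z = mat n n (\<lambda>(i, j). q (fmap g xv i j))"
  by (intro eq_matI) (auto simp: Z_def fmap_def)

lemma fundamental_matrix_R:
  assumes A: "\<And>s. s \<in> Sig \<Longrightarrow> A s \<in> carrier_mat n n" "\<And>s i j. s \<in> Sig \<Longrightarrow> i < n \<Longrightarrow> j < n \<Longrightarrow> A s $$ (i, j) = a s i j"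
    and B: "\<And>d. d \<in> Del \<Longrightarrow> B d \<in> carrier_mat n n" "\<And>d i j. d \<in> Del \<Longrightarrow> i < n \<Longrightarrow> j < n \<Longrightarrow> B d $$ (i, j) = b d i j"
  shows "fundamental_matrix Sig Del n A B R h Z"
  unfolding fundamental_matrix_def
proof (intro conjI ballI Z_GL)
  fix s assume s: "s \<in> Sig"
  show "map_mat (aut R s) Z = mmul R n (map_mat h (A s)) Z"
  proof -
    have "map_mat h (A s) = mat n n (\<lambda>(i, j). q (fmap Cst (a s) i j))"
      by (rule map_mat_h) (simp_all add: A s)
    then show ?thesis unfolding map_mat_Z[of "aut R s", OF R_aut[OF s]] sig(4)[OF s]
      by (simp only: Z_def mmul_R)
  qed
next
  fix d assume d: "d \<in> Del"
  show "map_mat (der R d) Z = mmul R n (map_mat h (B d)) Z"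
  proof -
    have "map_mat h (B d) = mat n n (\<lambda>(i, j). q (fmap Cst (b d) i j))"
      by (rule map_mat_h) (simp_all add: B d)
    then show ?thesis unfolding map_mat_Z[of "der R d", OF R_der[OF d]] del(4)[OF d]
      by (simp only: Z_def mmul_R)
  qed
qed

lemma q_fdet: "q (fdet n f) = finsum R (\<lambda>p. if evenperm p then finprod R (\<lambda>i. q (f i (p i))) {..<n}
    else \<ominus>\<^bsub>R\<^esub> finprod R (\<lambda>i. q (f i (p i))) {..<n}) {p. p permutes {..<n}}"
proof -
  have fin: "finite {p. p permutes {..<n}}" by (rule finite_permutations) simp
  have "(if evenperm p then finprod R (\<lambda>i. q (f i (p i))) {..<n} else \<ominus>\<^bsub>R\<^esub> finprod R (\<lambda>i. q (f i (p i))) {..<n}) =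
      q (if evenperm p then \<Prod>i<n. f i (p i) else - (\<Prod>i<n. f i (p i)))" for p
    by (simp add: R_finprod R_uminus)
  then show ?thesis unfolding fdet_def by (simp add: R_finsum[OF fin])
qed

lemma mdet_Z: "mdet R n Z = q (fdet n xv)"
proof -
  have "mdet R n Z = finsum R (\<lambda>p. if evenperm p then finprod R (\<lambda>i. q (xv i (p i))) {..<n}
    else \<ominus>\<^bsub>R\<^esub> finprod R (\<lambda>i. q (xv i (p i))) {..<n}) {p. p permutes {..<n}}"
    unfolding mdet_def Let_def
  proof (rule R.finsum_cong')
    fix p assume "p \<in> {p. p permutes {..<n}}"
    then have "p i < n" if "i < n" for i using permutes_in_image[of p "{..<n}" i] that by simp
    then have "finprod R (\<lambda>i. Z $$ (i, p i)) {..<n} = finprod R (\<lambda>i. q (xv i (p i))) {..<n}"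
      by (intro R.finprod_cong') (auto simp: Z_def)
    then show "(if evenperm p then finprod R (\<lambda>i. Z $$ (i, p i)) {..<n} else \<ominus>\<^bsub>R\<^esub> finprod R (\<lambda>i. Z $$ (i, p i)) {..<n}) =
      (if evenperm p then finprod R (\<lambda>i. q (xv i (p i))) {..<n} else \<ominus>\<^bsub>R\<^esub> finprod R (\<lambda>i. q (xv i (p i))) {..<n})"
      by simp
  qed (auto simp: R_finprod R_uminus)
  then show ?thesis by (simp add: q_fdet)
qed

lemma fdet_xv_yv: "q (fdet n xv * fdet n yv) = q 1"
proof -
  have "q (fdet n (fmul n xv yv)) = q (fdet n (fone n))" by (simp only: q_fdet q_xy)
  then show ?thesis by (simp add: fdet_fmul fdet_fone)
qed

lemma inv_mdet_Z: "inv\<^bsub>R\<^esub> (mdet R n Z) = q (fdet n yv)"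
  unfolding mdet_Z
  by (rule R.inv_unique'[symmetric]) (simp_all add: R_simps fdet_xv_yv mult.commute[of "fdet n yv"])

lemma R_generated:
  assumes K: "K = op_ring_of_type sg dl pa"
  shows "carrier R = par_generated K R h (elements_mat Z \<union> {inv\<^bsub>R\<^esub> (mdet R n Z)})"
proof -
  define H where "H = h ` carrier K \<union> {(par R ^^ k) x | k x. x \<in> elements_mat Z \<union> {inv\<^bsub>R\<^esub> (mdet R n Z)}}"
  define G where "G = generate_ring R H"
  have par_pow: "(par R ^^ k) (q x) = q ((pd ^^ k) x)" for k x by (induction k) (auto simp: R_simps)
  have "\<exists>y. x = q y" if "x \<in> elements_mat Z \<union> {inv\<^bsub>R\<^esub> (mdet R n Z)}" for x
  proof -
    have "\<exists>y. x = q y" if "x \<in> elements_mat Z" using elements_matD[OF that] by (auto simp: Z_def)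
    then show ?thesis using that inv_mdet_Z by auto
  qed
  then have HR: "H \<subseteq> carrier R"
    unfolding H_def by (force simp: h_def par_pow)
  have GR: "G \<subseteq> carrier R" unfolding G_def by (rule R.generate_ring_incl[OF HR])
  define S where "S = {p. q p \<in> G}"
  have S: "sring S" unfolding sring_def S_def G_def
    using generate_ring.one[of R H] generate_ring.eng_add[of _ R H] generate_ring.eng_mult[of _ R H]
      generate_ring.a_inv[of _ R H] by (auto simp: R_simps simp flip: R_simps(4,5) R_uminus)
  \<comment> \<open>The generators are closed under \<open>\<partial>\<close> as a set, and by the
    Leibniz rule so is the ring they generate.\<close>
  have par_G: "par R u \<in> G" if "u \<in> G" for u
    using that unfolding G_def
  proof (induction rule: generate_ring.induct)
    case one
    have "par R \<one>\<^bsub>R\<^esub> = q 0" by (simp add: R_simps derivD[OF pd(1)])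
    then show ?case using sringD(2)[OF S] by (simp add: S_def G_def)
  next
    case (incl u)
    show ?case
    proof (cases "u \<in> h ` carrier K")
      case True
      then obtain x where "u = h x" by blast
      then have "par R u = h (pa x)" by (simp add: h_def R_simps pd)
      moreover have "h (pa x) \<in> H" by (simp add: H_def K op_ring_of_type_def)
      ultimately show ?thesis by (simp add: generate_ring.incl)
    next
      case False
      then obtain k x where kx: "u = (par R ^^ k) x" "x \<in> elements_mat Z \<union> {inv\<^bsub>R\<^esub> (mdet R n Z)}"
        using incl by (auto simp: H_def)
      then have "par R u = (par R ^^ Suc k) x" by simp
      then have "par R u \<in> H" using kx(2) unfolding H_def by blast
      then show ?thesis by (rule generate_ring.incl)
    qed
  next
    case (a_inv u)
    then obtain x where x: "u = q x" using GR by (auto simp: G_def R_simps)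
    have "par R (\<ominus>\<^bsub>R\<^esub> u) = \<ominus>\<^bsub>R\<^esub> par R u" by (simp add: x R_uminus R_simps derivD[OF pd(1)])
    then show ?case using a_inv by (simp add: generate_ring.a_inv)
  next
    case (eng_add u v)
    obtain x y where x: "u = q x" "v = q y"
    proof -
      have "u \<in> Set.range q" "v \<in> Set.range q" using eng_add GR by (auto simp: G_def R_simps)
      then show thesis using that by blast
    qed
    have "par R (u \<oplus>\<^bsub>R\<^esub> v) = par R u \<oplus>\<^bsub>R\<^esub> par R v" by (simp add: x R_simps derivD[OF pd(1)])
    then show ?case using eng_add by (simp add: generate_ring.eng_add)
  next
    case (eng_mult u v)
    obtain x y where x: "u = q x" "v = q y"
    proof -
      have "u \<in> Set.range q" "v \<in> Set.range q" using eng_mult GR by (auto simp: G_def R_simps)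
      then show thesis using that by blast
    qed
    have "par R (u \<otimes>\<^bsub>R\<^esub> v) = par R u \<otimes>\<^bsub>R\<^esub> v \<oplus>\<^bsub>R\<^esub> u \<otimes>\<^bsub>R\<^esub> par R v" by (simp add: x R_simps derivD[OF pd(1)])
    then show ?case using eng_mult by (simp add: generate_ring.eng_add generate_ring.eng_mult)
  qed
  have pdS: "pd x \<in> S" if "x \<in> S" for x using par_G[of "q x"] that by (simp add: S_def R_simps)
  have CS: "Cst x \<in> S" for x
    unfolding S_def G_def by (auto simp: H_def h_def K op_ring_of_type_def intro!: generate_ring.incl)
  have base: "q x \<in> elements_mat Z \<union> {inv\<^bsub>R\<^esub> (mdet R n Z)} \<Longrightarrow> x \<in> S" for x
  proof -
    assume "q x \<in> elements_mat Z \<union> {inv\<^bsub>R\<^esub> (mdet R n Z)}"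
    then have "(par R ^^ 0) (q x) \<in> H" unfolding H_def by blast
    then show "x \<in> S" unfolding S_def G_def by (simp add: generate_ring.incl)
  qed
  have xS: "xv i j \<in> S" for i j
  proof (cases "i < n \<and> j < n")
    case True
    then show ?thesis by (intro base UnI1 elements_matI[of Z n n i j]) (auto simp: Z_def)
  qed (use sringD(2)[OF S] in \<open>auto simp: xv_def\<close>)
  have dS: "fdet n yv \<in> S" by (rule base) (simp add: inv_mdet_Z)
  have yS: "yv i j \<in> S" for i j
  proof (cases "i < n \<and> j < n")
    case True
    \<comment> \<open>With \<open>g\<close> the adjugate of \<open>X\<close>, the product of
      \<open>det X\<close> and \<open>Y\<close> is \<open>g\<close> modulo \<open>m\<close>;
      multiplying by \<open>det Y\<close>, which is inverse to \<open>det X\<close>, expresses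
      \<open>Y\<close> through elements of \<open>S\<close>.\<close>
    obtain g where g: "\<And>i j. g i j \<in> S" "\<And>i j. i < n \<Longrightarrow> j < n \<Longrightarrow> fmul n g xv i j = fdet n xv * fone n i j"
      using exists_fadj[where f=xv and n=n, OF S xS] by blast
    have "fmul n (fmul n g xv) yv i j = fdet n xv * fmul n (fone n) yv i j"
      unfolding fmul_def[of n "fmul n g xv"] fmul_def[of n "fone n"] sum_distrib_left
      using True g(2) by (intro sum.cong) (auto simp: mult.assoc)
    then have e: "fmul n g (fmul n xv yv) i j = fdet n xv * yv i j"
      by (simp add: fmul_fone[OF fsupp_yv] fmul_assoc)
    have "q (fmul n g (fmul n xv yv) i j) = q (fmul n g (fone n) i j)"
    proof -
      have "fmul n g (fmul n xv yv) i j - fmul n g (fone n) i j = (\<Sum>k<n. g i k * (fmul n xv yv k j - fone n k j))"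
        by (simp add: fmul_def[of n g] algebra_simps sum_subtractf)
      also have "\<dots> \<in> m"
        using q_xy(1) by (intro ideal_on_sum[OF Q.m_ideal(1)] Q.mI(5)[OF UNIV_I]) (simp add: q)
      finally show ?thesis by (simp add: q)
    qed
    also have "fmul n g (fone n) i j = g i j"
    proof -
      have "fmul n g (fone n) i j = (\<Sum>k<n. if k = j then g i j else 0)"
        unfolding fmul_def by (intro sum.cong) (auto simp: fone_def)
      then show ?thesis using True by simp
    qed
    finally have "q (fdet n xv * yv i j) = q (g i j)" by (simp add: e)
    then have "q (fdet n yv * (fdet n xv * yv i j)) = q (fdet n yv * g i j)" by (simp flip: R_simps(4))
    moreover have "q (fdet n yv * (fdet n xv * yv i j)) = q (fdet n xv * fdet n yv * yv i j)" by (simp add: mult_ac)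
    moreover have "\<dots> = q (1 * yv i j)" by (simp only: R_simps(4)[symmetric] fdet_xv_yv[unfolded R_simps(4)[symmetric]])
    moreover have "fdet n yv * g i j \<in> S" by (rule sringD(4)[OF S dS g(1)])
    ultimately show ?thesis by (simp add: S_def)
  qed (use sringD(2)[OF S] in \<open>auto simp: yv_def\<close>)
  have duS: "dummy \<in> S" using sringD(2)[OF S] q_xy(3) by (simp add: S_def)
  have small: "Var v \<in> S" if "v < N" for v
    using that
  proof (cases rule: generator_cases)
    case (1 i j) then show ?thesis using xS[of i j] by (simp add: xv_def)
  next
    case (2 i j) then show ?thesis using yS[of i j] by (simp add: yv_def)
  qed (use duS in \<open>simp add: dummy_def\<close>)
  have "(pd ^^ k) x \<in> S" if "x \<in> S" for k x using that by (induction k) (auto intro: pdS)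
  then have "Var v \<in> S" for v using small[of "v mod N"] N_pos by (subst Var_decomp) simp
  then have "p \<in> S" for p
    by (induction p rule: mp_induct) (auto intro: CS sringD(3,4)[OF S])
  then have "carrier R \<subseteq> G" by (auto simp: R_simps S_def)
  then show ?thesis using GR unfolding par_generated_def G_def H_def by blast
qed

lemma sdp_algebra_R:
  assumes K: "K = op_ring_of_type sg dl pa"
  shows "sdp_algebra Sig Del K R h"
proof -
  have "h \<in> Ring.ring_hom K R"
    by (rule ring_hom_memI) (auto simp: K op_ring_of_type_def h_def R_simps Cst_simps)
  then show ?thesis unfolding sdp_algebra_def sdp_hom_def using sdp_ring_R
    by (auto simp: K op_ring_of_type_def h_def R_aut R_der R_simps sig del pd)
qed

section \<open>Fields of constants and finiteness of the extension\<close>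

lemma field_subring:
  assumes C: "C \<subseteq> carrier R" "q 1 \<in> C" "\<And>x y. q x \<in> C \<Longrightarrow> q y \<in> C \<Longrightarrow> q (x + y) \<in> C"
    "\<And>x y. q x \<in> C \<Longrightarrow> q y \<in> C \<Longrightarrow> q (x * y) \<in> C" "\<And>x. q x \<in> C \<Longrightarrow> q (- x) \<in> C"
    and inv: "\<And>x. q x \<in> C \<Longrightarrow> x \<notin> m \<Longrightarrow> \<exists>y. q y \<in> C \<and> q (x * y) = q 1"
  shows "field (R\<lparr>carrier := C\<rparr>)"
proof -
  have ex: "\<exists>x. u = q x" if "u \<in> C" for u using that C(1) by (auto simp: R_simps)
  have "subring C R"
  proof (rule R.subringI)
    fix u v assume u: "u \<in> C" and v: "v \<in> C"
    obtain x y where xy: "u = q x" "v = q y" using ex u v by meson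
    show "u \<otimes>\<^bsub>R\<^esub> v \<in> C" "u \<oplus>\<^bsub>R\<^esub> v \<in> C" using C(3,4) u v by (auto simp: xy R_simps)
  next
    fix u assume u: "u \<in> C"
    obtain x where x: "u = q x" using ex u by meson
    show "\<ominus>\<^bsub>R\<^esub> u \<in> C" using C(5) u by (auto simp: x R_uminus)
  qed (use C in \<open>auto simp: R_simps\<close>)
  then have "cring (R\<lparr>carrier := C\<rparr>)" using R.subcring_iff[OF C(1)] R.subcringI' by blast
  then show ?thesis
  proof (rule cring.cring_fieldI2)
    show "\<zero>\<^bsub>R\<lparr>carrier := C\<rparr>\<^esub> \<noteq> \<one>\<^bsub>R\<lparr>carrier := C\<rparr>\<^esub>" using q_0_iff[of 1] Q.m_ideal(3) by (auto simp: R_simps)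
    fix u assume "u \<in> carrier (R\<lparr>carrier := C\<rparr>)" "u \<noteq> \<zero>\<^bsub>R\<lparr>carrier := C\<rparr>\<^esub>"
    then have u: "u \<in> C" "u \<noteq> q 0" by (auto simp: R_simps)
    obtain x where x: "u = q x" using ex u by meson
    obtain y where "q y \<in> C" "q (x * y) = q 1" using inv[of x] u q_0_iff by (auto simp: x)
    then show "\<exists>v\<in>carrier (R\<lparr>carrier := C\<rparr>). u \<otimes>\<^bsub>R\<lparr>carrier := C\<rparr>\<^esub> v = \<one>\<^bsub>R\<lparr>carrier := C\<rparr>\<^esub>"
      by (intro bexI[of _ "q y"]) (auto simp: x R_simps)
  qed
qed

abbreviation "C \<equiv> sd_constants Sig Del R"

lemma q_in_C: "q x \<in> C \<longleftrightarrow> Q.const x"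
  unfolding sd_constants_def Q.const_def by (auto simp: R_aut R_der R_simps q_0_iff q)

lemma C_sub: "C \<subseteq> carrier R"
  by (auto simp: sd_constants_def)

lemma const_closed:
  "Q.const x \<Longrightarrow> Q.const y \<Longrightarrow> Q.const (x + y)" "Q.const x \<Longrightarrow> Q.const y \<Longrightarrow> Q.const (x * y)"
  "Q.const x \<Longrightarrow> Q.const (- x)"
proof -
  show "Q.const (- x)" if x: "Q.const x"
    unfolding Q.const_def
  proof (intro conjI ballI)
    fix s assume s: "s \<in> SS"
    have "s (- x) - - x = - (s x - x)" by (simp add: rhomD[OF Q.SS(1)[OF s]])
    then show "s (- x) - - x \<in> m" using x s Q.mI(8) by (simp only: Q.const_def)
  next
    fix d assume d: "d \<in> DD"
    then have "d x \<in> m" using x unfolding Q.const_def by blast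
    then show "d (- x) \<in> m" unfolding derivD(5)[OF Q.DD[OF d]] by (rule Q.mI(8))
  qed
  assume x: "Q.const x" and y: "Q.const y"
  show "Q.const (x + y)" unfolding Q.const_def
  proof (intro conjI ballI)
    fix s assume s: "s \<in> SS"
    have "s (x + y) - (x + y) = (s x - x) + (s y - y)" by (simp add: rhomD[OF Q.SS(1)[OF s]])
    then show "s (x + y) - (x + y) \<in> m" using x y s Q.mI(4) by (simp only: Q.const_def)
  next
    fix d assume d: "d \<in> DD"
    then have "d x \<in> m" "d y \<in> m" using x y unfolding Q.const_def by blast+
    then show "d (x + y) \<in> m" unfolding derivD(1)[OF Q.DD[OF d]] by (rule Q.mI(4))
  qed
  show "Q.const (x * y)" unfolding Q.const_def
  proof (intro conjI ballI)
    fix s assume s: "s \<in> SS"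
    have "s (x * y) - x * y = s x * (s y - y) + (s x - x) * y"
      by (simp add: rhomD[OF Q.SS(1)[OF s]] algebra_simps)
    also have "\<dots> \<in> m"
    proof -
      have "s x - x \<in> m" "s y - y \<in> m" using x y s unfolding Q.const_def by blast+
      then show ?thesis by (intro Q.mI(4)[OF Q.mI(5)[OF UNIV_I] Q.mI(6)[OF UNIV_I]])
    qed
    finally show "s (x * y) - x * y \<in> m" .
  next
    fix d assume d: "d \<in> DD"
    have "d (x * y) = d x * y + x * d y" by (simp add: derivD[OF Q.DD[OF d]])
    also have "\<dots> \<in> m"
    proof -
      have "d x \<in> m" "d y \<in> m" using x y d unfolding Q.const_def by blast+
      then show ?thesis by (intro Q.mI(4)[OF Q.mI(6)[OF UNIV_I] Q.mI(5)[OF UNIV_I]])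
    qed
    finally show "d (x * y) \<in> m" .
  qed
qed

text \<open>An inverse of a constant is constant: applying an operator to \<open>y * x - 1\<close>
  shows that \<open>x\<close> kills the defect of \<open>y\<close>, and \<open>x\<close> is a unit
  modulo \<open>m\<close>.\<close>

lemma const_inverse:
  assumes x: "Q.const x" "x \<notin> m"
  shows "\<exists>y. Q.const y \<and> x * y - 1 \<in> m"
proof -
  obtain r where "x \<in> Q.P (Suc r)" using Q.in_some_P by blast
  from Q.const_unit[OF x(1) this x(2)] obtain y where y: "y * x - 1 \<in> m" by blast
  have e: "w \<in> m" if "w * x \<in> m" for w
  proof -
    have "w = (w * x) * y - w * (y * x - 1)" by (simp add: algebra_simps)
    also have "\<dots> \<in> m" by (rule Q.mI(7)[OF Q.mI(6)[OF UNIV_I that] Q.mI(5)[OF UNIV_I y]])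
    finally show ?thesis .
  qed
  have "Q.const y" unfolding Q.const_def
  proof (intro conjI ballI)
    fix s assume s: "s \<in> SS"
    note h = rhomD[OF Q.SS(1)[OF s]]
    have sy: "s (y * x - 1) \<in> m" using Q.m_stable[OF _ y] s by blast
    have "(s y - y) * x = s (y * x - 1) - (y * x - 1) - s y * (s x - x)" by (simp add: h algebra_simps)
    also have "\<dots> \<in> m"
    proof -
      have "s x - x \<in> m" using x(1) s unfolding Q.const_def by blast
      then show ?thesis by (rule Q.mI(7)[OF Q.mI(7)[OF sy y] Q.mI(5)[OF UNIV_I]])
    qed
    finally show "s y - y \<in> m" by (rule e)
  next
    fix d assume d: "d \<in> DD"
    note h = derivD[OF Q.DD[OF d]]
    have dy: "d (y * x - 1) \<in> m" using Q.m_stable[OF _ y] d by blast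
    have "d y * x = d (y * x - 1) - y * d x" by (simp add: h algebra_simps)
    also have "\<dots> \<in> m"
    proof -
      have "d x \<in> m" using x(1) d unfolding Q.const_def by blast
      then show ?thesis by (rule Q.mI(7)[OF dy Q.mI(5)[OF UNIV_I]])
    qed
    finally show "d y \<in> m" by (rule e)
  qed
  then show ?thesis using y by (auto simp: mult.commute)
qed

lemma field_C: "field (R\<lparr>carrier := C\<rparr>)"
proof (rule field_subring[OF C_sub])
  show "\<exists>y. q y \<in> C \<and> q (x * y) = q 1" if "q x \<in> C" "x \<notin> m" for x
    using const_inverse[of x] that by (auto simp: q_in_C q)
qed (use const_closed Q.const_1 in \<open>auto simp: q_in_C\<close>)

lemma kconst_iff: "Q.kconst x \<longleftrightarrow> (\<forall>s\<in>Sig. sg s x = x) \<and> (\<forall>d\<in>Del. dl d x = 0)"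
  unfolding Q.kconst_def using Q.Cst_eq_iff[of _ x] Q.Cst_eq_iff[of _ 0] by (auto simp: sig del Cst_simps)

lemma field_hK:
  assumes F: "F = h ` Collect Q.kconst"
  shows "field (R\<lparr>carrier := F\<rparr>)" "F \<subseteq> C"
proof -
  show FC: "F \<subseteq> C"
  proof
    fix u assume "u \<in> F"
    then obtain x where x: "u = q (Cst x)" "Q.kconst x" by (auto simp: F h_def)
    have "Q.const (Cst x)" using x(2) Q.mI(3) by (auto simp: Q.const_def Q.kconst_def)
    then show "u \<in> C" by (simp add: x q_in_C)
  qed
  have mem: "q x \<in> F \<longleftrightarrow> (\<exists>c. Q.kconst c \<and> x - Cst c \<in> m)" for x
    unfolding F h_def by (auto simp: q image_iff)
  have Fq: "h c \<in> F" if "Q.kconst c" for c using that by (auto simp: F)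
  have k1: "Q.kconst 1" "Q.kconst (x + y)" "Q.kconst (x * y)" "Q.kconst (- x)" if "Q.kconst x" "Q.kconst y" for x y
    using that unfolding kconst_iff by (auto simp: rhomD[OF sg(1)] derivD[OF dl])
  have k0: "Q.kconst 1" unfolding kconst_iff by (auto simp: rhomD[OF sg(1)] derivD[OF dl])
  have repr: "\<exists>c. Q.kconst c \<and> q x = h c" if "q x \<in> F" for x using that by (auto simp: F)
  show "field (R\<lparr>carrier := F\<rparr>)"
  proof (rule field_subring)
    show "F \<subseteq> carrier R" using FC C_sub by blast
    show "q 1 \<in> F" using Fq[OF k0] by (simp add: h_def Cst_simps)
    fix x assume x: "q x \<in> F"
    then obtain c where c: "Q.kconst c" "q x = h c" using repr by blast
    have "q (- x) = \<ominus>\<^bsub>R\<^esub> q x" by (simp add: R_uminus)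
    also have "\<dots> = h (- c)" unfolding c(2) by (simp add: h_def R_uminus Cst_simps)
    finally show "q (- x) \<in> F" using Fq[OF k1(4)[OF c(1) c(1)]] by simp
    {
      fix y assume "q y \<in> F"
      then obtain e where e: "Q.kconst e" "q y = h e" using repr by blast
      have "q (x + y) = h (c + e)" using c(2) e(2) by (simp add: h_def Cst_simps flip: R_simps(5))
      then show "q (x + y) \<in> F" using Fq[OF k1(2)[OF c(1) e(1)]] by simp
      have "q (x * y) = h (c * e)" using c(2) e(2) by (simp add: h_def Cst_simps flip: R_simps(4))
      then show "q (x * y) \<in> F" using Fq[OF k1(3)[OF c(1) e(1)]] by simp
    }
    assume "x \<notin> m"
    have "c \<noteq> 0"
    proof
      assume "c = 0"
      then have "q x = q 0" using c(2) by (simp add: h_def Cst_simps)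
      with \<open>x \<notin> m\<close> show False by (simp add: q_0_iff)
    qed
    have "Q.kconst (inverse c)" unfolding kconst_iff
    proof (intro conjI ballI)
      fix s assume s: "s \<in> Sig"
      have "sg s (c * inverse c) = c * sg s (inverse c)" using c(1) s by (simp add: kconst_iff rhomD[OF sg(1)[OF s]])
      then have "c * sg s (inverse c) = 1" using \<open>c \<noteq> 0\<close> by (simp add: rhomD[OF sg(1)[OF s]])
      then show "sg s (inverse c) = inverse c" by (metis inverse_unique)
    next
      fix d assume d: "d \<in> Del"
      have "dl d (c * inverse c) = c * dl d (inverse c)" using c(1) d by (simp add: kconst_iff derivD[OF dl[OF d]])
      then have "c * dl d (inverse c) = 0" using \<open>c \<noteq> 0\<close> by (simp add: derivD[OF dl[OF d]])
      then show "dl d (inverse c) = 0" using \<open>c \<noteq> 0\<close> by simp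
    qed
    moreover have "q (x * Cst (inverse c)) = q 1"
    proof -
      have "q (x * Cst (inverse c)) = h c \<otimes>\<^bsub>R\<^esub> q (Cst (inverse c))" by (simp add: R_simps(4)[symmetric] c(2))
      also have "\<dots> = q (Cst (c * inverse c))" by (simp add: h_def R_simps Cst_simps)
      finally show ?thesis using \<open>c \<noteq> 0\<close> by (simp add: Cst_simps)
    qed
    ultimately show "\<exists>y. q y \<in> F \<and> q (x * y) = q 1" using Fq by (auto simp: h_def)
  qed
qed

text \<open>Dependence of all families of \<open>M\<close> constants bounds the length of
  independent lists; a longest one is a basis.\<close>

lemma finite_algebraic_R:
  assumes F: "F = h ` Collect Q.kconst"
  shows "finite_algebraic_extension F (R\<lparr>carrier := C\<rparr>)"
proof -
  define E where "E = R\<lparr>carrier := C\<rparr>"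
  interpret E: field E unfolding E_def by (rule field_C)
  note FF = field_hK[OF F]
  have sF: "subfield F E"
    by (rule E.subfield_iff(1)) (use FF in \<open>auto simp: E_def\<close>)
  obtain M :: nat where M: "\<forall>c. (\<forall>i<M. Q.const (c i)) \<longrightarrow>
      (\<exists>a. (\<forall>i<M. Q.kconst (a i)) \<and> (\<exists>i<M. a i \<noteq> 0) \<and> (\<Sum>i<M. Cst (a i) * c i) \<in> m)"
    using Q.const_finite_dimension by (elim exE)
  have combine: "E.combine (map (\<lambda>i. q (f i)) xs) (map (\<lambda>i. q (g i)) xs) = q (\<Sum>i\<leftarrow>xs. f i * g i)" for f g and xs :: "nat list"
  proof (induction xs)
    case (Cons i xs)
    then have "E.combine (q (f i) # map (\<lambda>i. q (f i)) xs) (q (g i) # map (\<lambda>i. q (g i)) xs) =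
      q (f i) \<otimes>\<^bsub>E\<^esub> q (g i) \<oplus>\<^bsub>E\<^esub> q (\<Sum>i\<leftarrow>xs. f i * g i)" by simp
    also have "\<dots> = q (f i * g i + (\<Sum>i\<leftarrow>xs. f i * g i))" by (simp add: E_def R_simps)
    finally show ?case by simp
  next
    case Nil
    have "E.combine [] [] = \<zero>\<^bsub>E\<^esub>" by simp
    then show ?case by (simp add: E_def R_simps)
  qed
  have dep: "\<not> E.independent F Us" if Us: "set Us \<subseteq> C" "length Us = M" for Us
  proof -
    define c where "c i = rp (Us ! i)" for i
    have UsC: "Us ! i \<in> C" if "i < M" for i using Us that nth_mem[of i Us] by blast
    have c: "Us ! i = q (c i)" if i: "i < M" for i
    proof -
      obtain x where "Us ! i = q x" using UsC[OF i] C_sub by (auto simp: R_simps)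
      then show ?thesis by (simp add: c_def q_rp)
    qed
    have "\<forall>i<M. Q.const (c i)" using UsC c by (simp flip: q_in_C)
    from M[THEN spec, THEN mp, OF this] obtain e where
      "(\<forall>i<M. Q.kconst (e i)) \<and> (\<exists>i<M. e i \<noteq> 0) \<and> (\<Sum>i<M. Cst (e i) * c i) \<in> m" by (elim exE)
    then have e: "\<forall>i<M. Q.kconst (e i)" "\<exists>i<M. e i \<noteq> 0" "(\<Sum>i<M. Cst (e i) * c i) \<in> m" by simp_all
    define Ks where "Ks = map (\<lambda>i. q (Cst (e i))) [0..<M]"
    have UsM: "Us = map (\<lambda>i. q (c i)) [0..<M]" using Us(2) c by (intro nth_equalityI) auto
    have "E.combine Ks Us = q (\<Sum>i\<leftarrow>[0..<M]. Cst (e i) * c i)" unfolding Ks_def by (subst UsM) (rule combine)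
    also have "(\<Sum>i\<leftarrow>[0..<M]. Cst (e i) * c i) = (\<Sum>i<M. Cst (e i) * c i)"
      by (simp add: interv_sum_list_conv_sum_set_nat atLeast0LessThan)
    finally have "E.combine Ks Us = \<zero>\<^bsub>E\<^esub>" using e(3) by (simp add: E_def R_simps q_0_iff)
    moreover have "set Ks \<subseteq> F" using e(1) by (auto simp: Ks_def F h_def)
    moreover have "\<not> set (take (length Us) Ks) \<subseteq> {\<zero>\<^bsub>E\<^esub>}"
    proof -
      obtain i where i: "i < M" "e i \<noteq> 0" using e(2) by blast
      have "Cst (e i) \<notin> m"
      proof
        assume "Cst (e i) \<in> m"
        then have "Cst (inverse (e i)) * Cst (e i) \<in> m" by (rule Q.mI(5)[OF UNIV_I])
        then show False using i(2) Q.m_ideal(3) by (simp flip: Cst_simps)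
      qed
      then have "q (Cst (e i)) \<noteq> \<zero>\<^bsub>E\<^esub>" by (simp add: E_def R_simps q_0_iff)
      moreover have "q (Cst (e i)) \<in> set (take (length Us) Ks)" using i(1) Us(2) by (auto simp: Ks_def)
      ultimately show ?thesis by auto
    qed
    ultimately show ?thesis using E.non_trivial_combine_imp_dependent[OF sF] by blast
  qed
  have short: "length Us < M" if "E.independent F Us" for Us
  proof (rule ccontr)
    assume "\<not> length Us < M"
    \<comment> \<open>The last \<open>M\<close> members of a longer independent list would be
      independent too.\<close>
    define Vs where "Vs = drop (length Us - M) Us"
    have "set Us \<subseteq> C" using E.independent_in_carrier[OF that] by (simp add: E_def)
    from subset_trans[OF set_drop_subset this] have "set Vs \<subseteq> C" unfolding Vs_def .
    moreover have "length Vs = M" using \<open>\<not> length Us < M\<close> by (simp add: Vs_def)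
    moreover have "E.independent F Vs"
    proof -
      have "E.independent F (take (length Us - M) Us @ Vs)" using that by (simp add: Vs_def)
      then show ?thesis by (rule E.independent_split(1)[OF sF])
    qed
    ultimately show False using dep by blast
  qed
  have nil: "E.independent F []" by simp
  have "\<forall>Vs. E.independent F Vs \<longrightarrow> length Vs < M"
    by (intro allI impI short)
  \<comment> \<open>A vector outside the span of an independent list could be prepended, so a list
    of greatest length spans.\<close>
  from ex_has_greatest_nat[of "E.independent F" "[]" length, OF nil this] obtain Us where
    "E.independent F Us \<and> (\<forall>Vs. E.independent F Vs \<longrightarrow> length Vs \<le> length Us)" by (elim exE)
  then have Us: "E.independent F Us" "\<And>Vs. E.independent F Vs \<Longrightarrow> length Vs \<le> length Us" by simp_all
  have "E.Span F Us = carrier E"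
  proof
    show "E.Span F Us \<subseteq> carrier E"
      using E.Span_in_carrier[OF _ E.independent_in_carrier[OF Us(1)], of F] FF(2) by (auto simp: E_def)
    show "carrier E \<subseteq> E.Span F Us"
    proof (rule ccontr)
      assume "\<not> carrier E \<subseteq> E.Span F Us"
      then obtain u where "u \<in> carrier E" "u \<notin> E.Span F Us" by blast
      then have "E.independent F (u # Us)" using Us(1) by (rule E.li_Cons)
      from Us(2)[OF this] show False by simp
    qed
  qed
  then have "E.dimension (length Us) F (carrier E)" using E.dimension_independent[OF Us(1)] by simp
  then have fd: "E.finite_dimension F (carrier E)" by (rule E.finite_dimensionI)
  have "\<forall>x\<in>carrier E. E.algebraic F x"
    using E.finite_dimension_imp_algebraic[OF sF E.carrier_is_subring fd] by (simp add: over_def)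
  then show ?thesis unfolding finite_algebraic_extension_def E_def[symmetric]
    using fd sF E.field_axioms by blast
qed

end

section \<open>Placing the quotient on the type of the base field\<close>

lemma poly_mapping_inj_list: "\<exists>f :: ('k \<Rightarrow>\<^sub>0 'v::zero) \<Rightarrow> ('k \<times> 'v) list. inj f"
proof -
  define f where "f p = map (\<lambda>k. (k, Poly_Mapping.lookup p k)) (SOME xs. set xs = Poly_Mapping.keys p)" for p :: "'k \<Rightarrow>\<^sub>0 'v"
  have f: "set (f p) = (\<lambda>k. (k, Poly_Mapping.lookup p k)) ` Poly_Mapping.keys p" for p
  proof -
    have "set (SOME xs. set xs = Poly_Mapping.keys p) = Poly_Mapping.keys p"
      by (rule someI_ex) (rule finite_list, rule finite_keys)
    then show ?thesis by (simp add: f_def)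
  qed
  have "p = p'" if e: "f p = f p'" for p p'
  proof (rule poly_mapping_eqI)
    fix k
    have s: "(\<lambda>k. (k, Poly_Mapping.lookup p k)) ` Poly_Mapping.keys p =
        (\<lambda>k. (k, Poly_Mapping.lookup p' k)) ` Poly_Mapping.keys p'" unfolding f[symmetric] e ..
    have *: "Poly_Mapping.lookup p k = v \<longleftrightarrow> (k, v) \<in> (\<lambda>k. (k, Poly_Mapping.lookup p k)) ` Poly_Mapping.keys p"
      if "v \<noteq> 0" for p :: "'k \<Rightarrow>\<^sub>0 'v" and v using that by (auto simp: in_keys_iff)
    show "Poly_Mapping.lookup p k = Poly_Mapping.lookup p' k"
      using *[of "Poly_Mapping.lookup p k" p] *[of "Poly_Mapping.lookup p k" p'] 
        *[of "Poly_Mapping.lookup p' k" p] *[of "Poly_Mapping.lookup p' k" p'] s by metis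
  qed
  then have "inj f" by (rule injI)
  then show ?thesis by blast
qed

text \<open>There are countably many monomials and the field is infinite, so coefficient-monomial
  pairs, and then finite lists of them, are no more numerous than field elements.\<close>

lemma mp_inj: "\<exists>f :: 'a::field_char_0 mp \<Rightarrow> 'a. inj f"
proof -
  have inf: "infinite (UNIV :: 'a set)" by (rule infinite_UNIV_char_0)
  obtain f :: "'a mp \<Rightarrow> ((nat \<Rightarrow>\<^sub>0 nat) \<times> 'a) list" where f: "inj f" using poly_mapping_inj_list by blast
  obtain g :: "(nat \<Rightarrow>\<^sub>0 nat) \<Rightarrow> (nat \<times> nat) list" where g: "inj g" using poly_mapping_inj_list by blast
  have "inj (to_nat \<circ> g)" by (rule inj_compose[OF inj_to_nat g])
  then have "(card_of (UNIV :: (nat \<Rightarrow>\<^sub>0 nat) set), card_of (UNIV :: nat set)) \<in> ordLeq"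
    using card_of_ordLeq[of UNIV UNIV] by blast
  moreover have "(card_of (UNIV :: nat set), card_of (UNIV :: 'a set)) \<in> ordLeq"
    using inf infinite_iff_card_of_nat by blast
  ultimately have "(card_of (UNIV :: (nat \<Rightarrow>\<^sub>0 nat) set), card_of (UNIV :: 'a set)) \<in> ordLeq"
    by (rule ordLeq_transitive)
  then have "(card_of ((UNIV :: (nat \<Rightarrow>\<^sub>0 nat) set) \<times> (UNIV :: 'a set)), card_of (UNIV :: 'a set)) \<in> ordLeq"
    by (intro card_of_Times_ordLeq_infinite inf ordLeq_reflexive card_of_Well_order)
  then obtain e :: "(nat \<Rightarrow>\<^sub>0 nat) \<times> 'a \<Rightarrow> 'a" where e: "inj e"
    using card_of_ordLeq[of "UNIV :: ((nat \<Rightarrow>\<^sub>0 nat) \<times> 'a) set" "UNIV :: 'a set"] by auto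
  have "(card_of (lists (UNIV :: 'a set)), card_of (UNIV :: 'a set)) \<in> ordLeq"
    by (rule ordIso_imp_ordLeq[OF card_of_lists_infinite[OF inf]])
  then obtain l :: "'a list \<Rightarrow> 'a" where l: "inj l"
    using card_of_ordLeq[of "lists UNIV :: 'a list set" "UNIV :: 'a set"] by auto
  have "inj (\<lambda>p. l (map e (f p)))"
    by (rule injI) (metis injD[OF l] injD[OF f] inj_map_eq_map[OF e])
  then show ?thesis by blast
qed

text \<open>Choose one representative in each coset and transport it along the injection.\<close>

lemma exists_quotient_map:
  fixes m :: "'r::comm_ring_1 set" and f :: "'r \<Rightarrow> 'b"
  assumes m: "ideal_on UNIV m" and f: "inj f"
  shows "\<exists>q :: 'r \<Rightarrow> 'b. \<forall>x y. q x = q y \<longleftrightarrow> x - y \<in> m"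
proof -
  note I = ideal_onD[OF m] and D = ideal_on_diff[OF m sring_UNIV] and U = ideal_on_uminus[OF m sring_UNIV]
  define c where "c x = (SOME z. x - z \<in> m)" for x
  have c: "x - c x \<in> m" for x unfolding c_def by (rule someI[of _ x]) (simp add: I(3))
  have "c x = c y \<longleftrightarrow> x - y \<in> m" for x y
  proof
    assume "c x = c y"
    then have e: "x - y = (x - c x) - (y - c y)" by simp
    show "x - y \<in> m" unfolding e by (rule D[OF c c])
  next
    assume xy: "x - y \<in> m"
    \<comment> \<open>Congruent elements define the same predicate, hence the choice operator picks
      the same representative for both.\<close>
    have "x - z \<in> m \<longleftrightarrow> y - z \<in> m" for z
      using I(4)[OF xy, of "y - z"] D[OF _ xy, of "x - z"] by auto
    then show "c x = c y" by (simp add: c_def)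
  qed
  then show ?thesis using f by (intro exI[of _ "\<lambda>x. f (c x)"]) (auto simp: inj_eq)
qed

section \<open>Translation of the system into function matrices\<close>

definition ent :: "nat \<Rightarrow> 'b::zero mat \<Rightarrow> 'b fmat" where
  "ent n M i j = (if i < n \<and> j < n then M $$ (i, j) else 0)"

lemma fsupp_ent: "fsupp n (ent n M)"
  by (simp add: fsupp_def ent_def)

lemma ent_map_mat: "M \<in> carrier_mat n n \<Longrightarrow> f 0 = 0 \<Longrightarrow> ent n (map_mat f M) = fmap f (ent n M)"
  by (intro ext) (auto simp: ent_def fmap_def)

context
  fixes K :: "('a::field_char_0, 's, 'd) op_ring" and sg dl pa
  assumes K: "K = op_ring_of_type sg dl pa" and cK: "cring K"
begin

interpretation cring K by (rule cK)

lemma K_simps: "carrier K = UNIV" "x \<otimes>\<^bsub>K\<^esub> y = x * y" "x \<oplus>\<^bsub>K\<^esub> y = x + y" "\<one>\<^bsub>K\<^esub> = 1" "\<zero>\<^bsub>K\<^esub> = 0"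
  "aut K = sg" "der K = dl" "par K = pa"
  by (simp_all add: K op_ring_of_type_def)

lemma K_finsum: "finite S \<Longrightarrow> finsum K f S = sum f S"
  by (induction S rule: finite_induct) (auto simp: K_simps finsum_insert)

lemma ent_mmul: "ent n (mmul K n M M') = fmul n (ent n M) (ent n M')"
  by (intro ext) (auto simp: ent_def mmul_def K_finsum K_simps fmul_def)

lemma ent_madd: "ent n (madd K n M M') = (\<lambda>i j. ent n M i j + ent n M' i j)"
  by (intro ext) (auto simp: ent_def madd_def K_simps)

lemma ent_mone: "ent n (mone K n) = fone n"
  by (intro ext) (auto simp: ent_def mone_def K_simps fone_def)

end

theorem theorem8:
  fixes \<Sigma> :: "'s set" and \<Delta> :: "'d set"
    and sg :: "'s \<Rightarrow> 'a \<Rightarrow> 'a::field_char_0" and dl :: "'d \<Rightarrow> 'a \<Rightarrow> 'a" and pa :: "'a \<Rightarrow> 'a"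
    and K :: "('a, 's, 'd) op_ring"
    and n :: nat and A :: "'s \<Rightarrow> 'a mat" and B :: "'d \<Rightarrow> 'a mat"
  assumes "\<Sigma> \<noteq> {} \<or> \<Delta> \<noteq> {}"
    and "K = op_ring_of_type sg dl pa"
    and "sdp_field \<Sigma> \<Delta> K"
    and "sd_linear_system \<Sigma> \<Delta> K n A B"
  shows "\<exists>(R :: ('a, 's, 'd) op_ring) (h :: 'a \<Rightarrow> 'a).
    par_picard_vessiot_ring \<Sigma> \<Delta> K n A B R h \<and>
    finite_algebraic_extension (h ` sd_constants \<Sigma> \<Delta> K) (R\<lparr>carrier := sd_constants \<Sigma> \<Delta> R\<rparr>)"
proof -
  interpret K: sdp_field \<Sigma> \<Delta> K by (rule assms(3))
  note KK = assms(2) K.cring_axioms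
  note Ks = K_simps[OF KK]
  note sys = assms(4)[unfolded sd_linear_system_def]
  have sg: "rhom (sg s)" "bij (sg s)" if "s \<in> \<Sigma>" for s
    using K.aut_iso[OF that] by (auto simp: ring_iso_def Ring.ring_hom_def rhom_def Ks)
  have derivation: "deriv f" if "derivation K f" for f
    using that by (auto simp: derivation_def deriv_def Ks)
  have dl: "deriv (dl d)" if "d \<in> \<Delta>" for d
    using derivation[OF K.der_derivation[OF that]] by (simp add: Ks)
  have pa: "deriv pa" using derivation[OF K.par_derivation] by (simp add: Ks)
  have comm: "f (g x) = g (f x)" if "f \<in> sg ` \<Sigma> \<union> dl ` \<Delta> \<union> {pa}" "g \<in> sg ` \<Sigma> \<union> dl ` \<Delta> \<union> {pa}" for f g x
    using K.operators_commute[of f g x] that by (simp add: operators_def Ks)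
  have A: "A s \<in> GL K n" if "s \<in> \<Sigma>" for s using sys that by blast
  have Ac: "A s \<in> carrier_mat n n" if "s \<in> \<Sigma>" for s using A[OF that] by (simp add: GL_def mats_def)
  have Bc: "B d \<in> carrier_mat n n" if "d \<in> \<Delta>" for d using sys that by (simp add: mats_def)
  define A' where "A' s = (SOME M. M \<in> mats K n \<and> mmul K n (A s) M = mone K n \<and> mmul K n M (A s) = mone K n)" for s
  have A': "A' s \<in> mats K n \<and> mmul K n (A s) (A' s) = mone K n \<and> mmul K n (A' s) (A s) = mone K n" if "s \<in> \<Sigma>" for s
    unfolding A'_def by (rule someI_ex) (use A[OF that] in \<open>auto simp: GL_def\<close>)
  define a a' b where "a s = ent n (A s)" and "a' s = ent n (A' s)" and "b d = ent n (B d)" for s d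
  note em = ent_mmul[OF KK] and ea = ent_madd[OF KK] and e1 = ent_mone[OF KK]
  have sg0: "sg s 0 = 0" if "s \<in> \<Sigma>" for s by (rule rhomD(4)[OF sg(1)[OF that]])
  have dl0: "dl d 0 = 0" if "d \<in> \<Delta>" for d by (rule derivD(3)[OF dl[OF that]])
  interpret D: sd_data n pa \<Sigma> \<Delta> sg dl a a' b
  proof
    fix s t assume s: "s \<in> \<Sigma>"
    show "rhom (sg s)" "bij (sg s)" using sg[OF s] .
    show "sg s (pa x) = pa (sg s x)" for x using comm[of "sg s" pa x] s by blast
    show "fmul n (a s) (a' s) = fone n" "fmul n (a' s) (a s) = fone n"
      unfolding a_def a'_def em[symmetric] using A'[OF s] e1 by simp_all
    assume t: "t \<in> \<Sigma>"
    show "sg s (sg t x) = sg t (sg s x)" for x using comm[of "sg s" "sg t" x] s t by blast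
    have "mmul K n (map_mat (aut K s) (A t)) (A s) = mmul K n (map_mat (aut K t) (A s)) (A t)"
      using sys s t by blast
    from arg_cong[OF this, of "ent n"]
    show "fmul n (fmap (sg s) (a t)) (a s) = fmul n (fmap (sg t) (a s)) (a t)"
      by (simp add: em Ks ent_map_mat[where f = "sg t", OF Ac[OF s] sg0[OF t]] ent_map_mat[where f = "sg s", OF Ac[OF t] sg0[OF s]] a_def)
  next
    fix s d assume s: "s \<in> \<Sigma>" and d: "d \<in> \<Delta>"
    show "sg s (dl d x) = dl d (sg s x)" for x using comm[of "sg s" "dl d" x] s d by blast
    have "mmul K n (map_mat (aut K s) (B d)) (A s) = madd K n (map_mat (der K d) (A s)) (mmul K n (A s) (B d))"
      using sys s d by blast
    from arg_cong[OF this, of "ent n"]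
    show "fmul n (fmap (sg s) (b d)) (a s) = (\<lambda>i j. fmap (dl d) (a s) i j + fmul n (a s) (b d) i j)"
      by (simp add: em ea Ks ent_map_mat[where f = "dl d", OF Ac[OF s] dl0[OF d]] ent_map_mat[where f = "sg s", OF Bc[OF d] sg0[OF s]] a_def b_def)
  next
    fix d e assume d: "d \<in> \<Delta>"
    show "deriv (dl d)" using dl[OF d] .
    show "dl d (pa x) = pa (dl d x)" for x using comm[of "dl d" pa x] d by blast
    assume e: "e \<in> \<Delta>"
    show "dl d (dl e x) = dl e (dl d x)" for x using comm[of "dl d" "dl e" x] d e by blast
    have "madd K n (map_mat (der K d) (B e)) (mmul K n (B e) (B d)) =
      madd K n (map_mat (der K e) (B d)) (mmul K n (B d) (B e))" using sys d e by blast
    from arg_cong[OF this, of "ent n"]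
    show "(\<lambda>i j. fmap (dl d) (b e) i j + fmul n (b e) (b d) i j) = (\<lambda>i j. fmap (dl e) (b d) i j + fmul n (b d) (b e) i j)"
      by (simp add: em ea Ks ent_map_mat[where f = "dl d", OF Bc[OF e] dl0[OF d]] ent_map_mat[where f = "dl e", OF Bc[OF d] dl0[OF e]] b_def)
  qed (simp_all add: pa a_def a'_def b_def fsupp_ent)
  obtain m where m: "sd_quotient D.N D.SS D.DD D.pd pa m" "D.J0 \<subseteq> m" using D.exists_pv_ideal by blast
  obtain f :: "'a mp \<Rightarrow> 'a" where f: "inj f" using mp_inj by blast
  obtain q :: "'a mp \<Rightarrow> 'a" where q: "\<forall>x y. q x = q y \<longleftrightarrow> x - y \<in> m"
    using exists_quotient_map[OF sd_quotient.m_ideal(1)[OF m(1)] f] by blast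
  interpret V: pv_quotient n pa \<Sigma> \<Delta> sg dl a a' b m q
    by (intro pv_quotient.intro pv_quotient_axioms.intro D.sd_data_axioms) (use m q in simp_all)
  have "fundamental_matrix \<Sigma> \<Delta> n A B V.R V.h V.Z"
    by (rule V.fundamental_matrix_R) (simp_all add: Ac Bc a_def b_def ent_def)
  then have "par_picard_vessiot_ring \<Sigma> \<Delta> K n A B V.R V.h"
    unfolding par_picard_vessiot_ring_def
    using V.sdp_algebra_R[OF assms(2)] V.sd_simple_R V.R_generated[OF assms(2)] by blast
  moreover have "sd_constants \<Sigma> \<Delta> K = Collect V.Q.kconst"
    by (auto simp: sd_constants_def Ks V.kconst_iff)
  ultimately show ?thesis using V.finite_algebraic_R by metis
qed

end
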